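(* For every $1\le p<+\infty$ there exists a constant $C_p>0$, depending only on $p$, such that the following holds. Let $\Theta$ be an inner function in the upper half-plane such that $\Theta'\in L^\infty(\mathbb{R})$, let $\mu$ be a (positive) $\sigma$-finite Borel measure on $\mathbb{R}$, and let $\delta>0$. Then for every $f\in K^p_\Theta$, $$ \int_{\mathbb{R}} |f(x)|^p\,d\mu(x)\le C_p\,\bigl(1+\|\Theta'\|_\infty\,\delta\bigr)^p\, D_\mu(\delta)\int_{\mathbb{R}}|f(x)|^p\,dx . $$
   Context: $\mathbb{C}^+=\{z\in\mathbb{C}:\operatorname{Im} z>0\}$. For $1\le p<\infty$, $H^p$ is the Hardy space of $\mathbb{C}^+$ (holomorphic $f$ on $\mathbb{C}^+$ with $\sup_{y>0}\int_{\mathbb{R}}|f(x+iy)|^p\,dx<\infty$), identified through boundary values with a closed subspace of $L^p(\mathbb{R})$. An inner function $\Theta$ is a bounded analytic function on $\mathbb{C}^+$ whose boundary values have modulus one almost everywhere on $\mathbb{R}$. The model space is $K^p_\Theta=H^p\cap\Theta\,\overline{H^p}$ (as a subspace of $L^p(\mathbb{R})$); for $p=2$ this equals $H^2\cap(\Theta H^2)^\perp$. The condition $\Theta'\in L^\infty(\mathbb{R})$ means $\Theta'\in H^\infty(\mathbb{C}^+)$; it implies that $\Theta$ is a meromorphic inner function (it has a meromorphic continuation to $\mathbb{C}$), so that $\Theta=e^{i\varphi}$ on $\mathbb{R}$ with $\varphi$ increasing and real analytic, and $|\Theta'|=\varphi'$ is bounded on $\mathbb{R}$; $\|\Theta'\|_\infty=\sup_{\mathbb{R}}|\Theta'|$.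 In this case the elements of $K^p_\Theta$ are meromorphic in $\mathbb{C}$ and analytic across $\mathbb{R}$, and $f(x)$, $x\in\mathbb{R}$, denotes the value of this continuation. For a positive measure $\mu$ and $\delta>0$, $$D_\mu(\delta)=\sup\Bigl\{\frac{\mu(I)}{|I|}: I\subset\mathbb{R}\text{ closed interval},\ |I|=\delta\Bigr\}=\sup_{x\in\mathbb{R}}\frac{\mu([x,x+\delta])}{\delta},$$ where $|I|$ is the length of $I$ (the value $+\infty$ is allowed, with $0\cdot\infty=0$). *)

theory Defs
  imports "HOL-Complex_Analysis.Complex_Analysis"
begin

definition upper_half_plane :: "complex set" where
  "upper_half_plane = {z. Im z > 0}"

definition hardy :: "real \<Rightarrow> (complex \<Rightarrow> complex) set" where
  "hardy p = {f. f holomorphic_on upper_half_plane \<and>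
     (SUP y\<in>{0<..}. \<integral>\<^sup>+x. ennreal (norm (f (Complex x y)) powr p) \<partial>lborel) < \<infinity>}"

definition hardy_inf :: "(complex \<Rightarrow> complex) set" where
  "hardy_inf = {f. f holomorphic_on upper_half_plane \<and> bounded (f ` upper_half_plane)}"

(* Boundary values are nontangential limits almost everywhere; a is the aperture of the
   approach sector with vertex x. *)
definition nontangential_limit :: "(complex \<Rightarrow> complex) \<Rightarrow> real \<Rightarrow> complex \<Rightarrow> bool" where
  "nontangential_limit f x w \<longleftrightarrow>
     (\<forall>a>0. (f \<longlongrightarrow> w) (at (complex_of_real x) within {z. \<bar>Re z - x\<bar> < a * Im z}))"

definition has_boundary_values :: "(complex \<Rightarrow> complex) \<Rightarrow> (real \<Rightarrow> complex) \<Rightarrow> bool" where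
  "has_boundary_values f g \<longleftrightarrow> (AE x in lborel. nontangential_limit f x (g x))"

definition inner_function :: "(complex \<Rightarrow> complex) \<Rightarrow> bool" where
  "inner_function \<Theta> \<longleftrightarrow> \<Theta> \<in> hardy_inf \<and>
     (\<exists>\<theta>. has_boundary_values \<Theta> \<theta> \<and> (AE x in lborel. norm (\<theta> x) = 1))"

(* H^p as a space of functions on the real line. Its elements lie in L^p by Fatou's lemma, and
   every function in hardy p has boundary values, so nothing is lost by the existential. *)
definition hardy_boundary :: "real \<Rightarrow> (real \<Rightarrow> complex) set" where
  "hardy_boundary p = {g. \<exists>f\<in>hardy p. has_boundary_values f g}"

(* An element of the model space is represented by its holomorphic function on the upper
   half-plane; membership in \<Theta> * cnj H^p is tested on boundary values. Values of
   f outside the upper half-plane are irrelevant. *)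
definition model_space :: "real \<Rightarrow> (complex \<Rightarrow> complex) \<Rightarrow> (complex \<Rightarrow> complex) set" where
  "model_space p \<Theta> = {f \<in> hardy p. \<exists>u \<theta>. \<exists>h\<in>hardy_boundary p.
     has_boundary_values f u \<and> has_boundary_values \<Theta> \<theta> \<and>
     (AE x in lborel. u x = \<theta> x * cnj (h x))}"

(* The meromorphic continuation to the whole plane, analytic on the real line, of a function
   on the upper half-plane. Where one exists, its values and derivatives on the real line are
   uniquely determined (its values at poles are not). *)
definition continuation :: "(complex \<Rightarrow> complex) \<Rightarrow> complex \<Rightarrow> complex" where
  "continuation f = (SOME g. g meromorphic_on UNIV \<and> g analytic_on range complex_of_real \<and>
     (\<forall>z\<in>upper_half_plane. g z = f z))"

definition real_trace :: "(complex \<Rightarrow> complex) \<Rightarrow> real \<Rightarrow> complex" where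
  "real_trace f x = continuation f (complex_of_real x)"

(* The supremum over the real line of the modulus of the derivative; meaningful when the
   derivative is bounded there, as it is for an inner \<Theta> with derivative in hardy_inf. *)
definition deriv_sup_norm :: "(complex \<Rightarrow> complex) \<Rightarrow> real" where
  "deriv_sup_norm \<Theta> = (SUP x. norm (deriv (continuation \<Theta>) (complex_of_real x)))"

definition interval_density :: "real measure \<Rightarrow> real \<Rightarrow> ennreal" where
  "interval_density \<mu> \<delta> = (SUP x. emeasure \<mu> {x..x + \<delta>} / ennreal \<delta>)"

end

theory Submission
  imports Defs
begin

text \<open>
  Write \<open>M\<close> for the supremum of \<open>|\<Theta>'|\<close> on the real line. On the line \<open>\<Theta>\<close> is unimodular, and
  \<open>|\<Theta>'| \<le> M\<close> on the whole half-plane, so \<open>|\<Theta>| \<ge> 1/2\<close> up to height \<open>1/(2M)\<close>. An element \<open>f\<close> of the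
  model space equals \<open>\<Theta> \<sqdot> cnj h\<close> on the line, with \<open>h\<close> the boundary function of some \<open>H\<close> in the
  Hardy space; so below the line it must continue as
  \<open>cnj (H (cnj z)) / cnj (\<Theta> (cnj z))\<close>, whose \<open>p\<close>-norm on the lines of depth less than \<open>1/(2M)\<close> is at
  most twice the \<open>p\<close>-norm of \<open>f\<close> on the real line. This is \<open>model_space_continuation\<close>.

  Given that, the embedding is a local matter (\<open>strip_Carleson_bound\<close>). The power \<open>|f(x)|\<^sup>p\<close> is at most a
  constant times the mean of \<open>|f|\<^sup>p\<close> over the square with centre \<open>x\<close> and half-side \<open>b\<close>
  (\<open>square_power_bound\<close>). Integrating this in \<open>x\<close> against \<open>\<mu>\<close> and exchanging the integrals leaves the
  Lebesgue integral of \<open>|f|\<^sup>p\<close> over the strip \<open>|Im z| < b\<close>, times \<open>1/b\<^sup>2\<close>, times the largest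
  \<open>\<mu>\<close>-measure of an interval of length \<open>2b\<close>. With \<open>b = \<delta>/(2(1 + M\<delta>))\<close> the strip has \<open>Mb \<le> 1/2\<close> and
  an interval of length \<open>2b\<close> lies in one of length \<open>\<delta>\<close>; the cost is the factor
  \<open>\<delta>/b = 2(1 + M\<delta>)\<close>, which is at most \<open>2(1 + M\<delta>)\<^sup>p\<close>.

  The continuation needs two facts about a function \<open>f\<close> in the Hardy space with boundary function
  \<open>u\<close>, for every \<open>p \<ge> 1\<close>: its \<open>p\<close>-norm on each horizontal line is at most that of \<open>u\<close>, and
  \<open>f(\<sqdot> + iy)\<close> tends to \<open>u\<close> in \<open>L\<^sup>1\<close> on bounded intervals. Both come from the inequality
  \<open>|f|\<^sup>p\<^sup>/\<^sup>2 \<le> P\<^sub>y * |u|\<^sup>p\<^sup>/\<^sup>2\<close> with the Poisson kernel (\<open>hardy_le_poisson_boundary\<close>). Working with the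
  exponent \<open>p/2\<close> is what makes \<open>p = 1\<close> no different from the rest: the functions
  \<open>|f(\<sqdot> + iy)|\<^sup>p\<^sup>/\<^sup>2\<close> are bounded in \<open>L\<^sup>2\<close>, and boundedness in \<open>L\<^sup>2\<close> with convergence almost everywhere
  suffices to pass to the limit under the Poisson integral. Cauchy--Schwarz then gives the first
  fact, and the second follows from it by Scheffe's lemma. The inequality itself is proved on lines above the
  boundary by a maximum principle for \<open>|f|\<^sup>q - Re W\<close> (\<open>power_norm_le_harmonic\<close>).

  Finally, the two halves of the continuation agree on the line only almost everywhere. By the
  \<open>L\<^sup>1\<close> convergence, their primitives extend continuously to the line and agree there after
  subtraction of constants; a continuous function that is holomorphic off a line is holomorphic, and the
  continuation is the derivative of the glued primitive (\<open>analytic_gluing_across_real_line\<close>).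
\<close>

section \<open>A mean value inequality over squares\<close>

lemma has_contour_integral_horizontal_iff:
  assumes "a < b"
  shows "(f has_contour_integral I) (linepath (Complex a c) (Complex b c)) \<longleftrightarrow>
         ((\<lambda>x. f (Complex x c)) has_integral I) {a..b}"
proof -
  have "(f has_contour_integral I) (linepath (Complex a c) (Complex b c)) \<longleftrightarrow>
      ((\<lambda>x. f (Complex (a + (b - a) * x) c) * of_real (b - a)) has_integral I) {0..1}"
    unfolding has_contour_integral_linepath
    by (intro has_integral_cong arg_cong2[of _ _ _ _ "(*)"] arg_cong[of _ _ f])
       (auto simp: linepath_def complex_eq_iff algebra_simps)
  also have "{0..1} = (\<lambda>x. x / (b - a)) ` {0..b-a}"
    using assms by simp
  also have "((\<lambda>x. f (Complex (a + (b - a) * x) c) * of_real (b - a)) has_integral I) \<dots> \<longleftrightarrow>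
      ((\<lambda>x. f (Complex (a + x) c) * of_real (b - a)) has_integral ((b-a) *\<^sub>R I)) {0..b-a}"
    by (subst has_integral_stretch_real_iff) (use assms in simp_all)
  also have "\<dots> \<longleftrightarrow> ((\<lambda>x. of_real (b-a) * f (Complex x c)) has_integral (b-a) *\<^sub>R I) {a..b}"
    by (subst has_integral_shift_real_ivl_iff[where c = "-a"])
       (simp_all add: scaleR_conv_of_real mult_ac)
  also have "\<dots> \<longleftrightarrow> ((\<lambda>x. f (Complex x c)) has_integral I) {a..b}"
    by (subst has_integral_mult_right_iff) (use assms in \<open>auto simp: scaleR_conv_of_real\<close>)
  finally show ?thesis .
qed

lemma norm_integral_le_nn_integral:
  fixes f :: "real \<Rightarrow> complex"
  assumes "(f has_integral I) {a..b}" "continuous_on {a..b} f"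
  shows "ennreal (norm I) \<le> (\<integral>\<^sup>+t. ennreal (norm (f t)) * indicator {a..b} t \<partial>lborel)"
proof -
  have cn: "continuous_on {a..b} (\<lambda>t. norm (f t))"
    using assms(2) by (intro continuous_intros)
  have "norm I \<le> integral {a..b} (\<lambda>t. norm (f t))"
    unfolding integral_unique[OF assms(1), symmetric]
    by (rule integral_norm_bound_integral)
       (auto intro!: integrable_continuous_interval assms(2) cn)
  also have "ennreal \<dots> = (\<integral>\<^sup>+t. ennreal (indicator {a..b} t * norm (f t)) \<partial>lborel)"
    by (rule nn_integral_has_integral_lebesgue[symmetric])
       (auto intro!: integrable_integral integrable_continuous_interval cn)
  also have "\<dots> = (\<integral>\<^sup>+t. ennreal (norm (f t)) * indicator {a..b} t \<partial>lborel)"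
    by (intro nn_integral_cong) (auto simp: indicator_def)
  finally show ?thesis by (simp add: ennreal_leI)
qed

lemma norm_contour_integral_horizontal_le:
  assumes "a < b" "continuous_on (closed_segment (Complex a c) (Complex b c)) f"
  shows "ennreal (norm (contour_integral (linepath (Complex a c) (Complex b c)) f))
       \<le> (\<integral>\<^sup>+t. ennreal (norm (f (Complex t c))) * indicator {a..b} t \<partial>lborel)"
proof -
  have seg: "Complex t c \<in> closed_segment (Complex a c) (Complex b c)" if "t \<in> {a..b}" for t
    using that assms(1) by (subst closed_segment_same_Im) (auto simp: closed_segment_eq_real_ivl)
  have cont: "continuous_on {a..b} (\<lambda>t. f (Complex t c))"
    by (rule continuous_on_compose2[OF assms(2)])
       (use seg in \<open>auto simp: Complex_eq intro!: continuous_intros\<close>)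
  have "f contour_integrable_on linepath (Complex a c) (Complex b c)"
    using assms(2) by (rule contour_integrable_continuous_linepath)
  then have hi: "((\<lambda>x. f (Complex x c)) has_integral
      contour_integral (linepath (Complex a c) (Complex b c)) f) {a..b}"
    using has_contour_integral_horizontal_iff[OF assms(1)] has_contour_integral_integral by blast
  show ?thesis
    by (rule norm_integral_le_nn_integral[OF hi cont])
qed

lemma norm_contour_integral_vertical_le:
  assumes "a < b" "continuous_on (closed_segment (Complex c a) (Complex c b)) f"
  shows "ennreal (norm (contour_integral (linepath (Complex c a) (Complex c b)) f))
       \<le> (\<integral>\<^sup>+t. ennreal (norm (f (Complex c t))) * indicator {a..b} t \<partial>lborel)"
proof -
  have seg: "Complex c t \<in> closed_segment (Complex c a) (Complex c b)" if "t \<in> {a..b}" for t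
    using that assms(1) by (subst closed_segment_same_Re) (auto simp: closed_segment_eq_real_ivl)
  have cont: "continuous_on {a..b} (\<lambda>t. f (Complex c t))"
    by (rule continuous_on_compose2[OF assms(2)])
       (use seg in \<open>auto simp: Complex_eq intro!: continuous_intros\<close>)
  have "f contour_integrable_on linepath (Complex c a) (Complex c b)"
    using assms(2) by (rule contour_integrable_continuous_linepath)
  then have hi: "((\<lambda>x. f (Complex c x)) has_integral
      (- \<i> * contour_integral (linepath (Complex c a) (Complex c b)) f)) {a..b}"
    using has_contour_integral_linepath_same_Re_iff[of "Complex c a" c "Complex c b" a b f] assms(1)
      has_contour_integral_integral by auto
  from norm_integral_le_nn_integral[OF this cont] show ?thesis
    by (simp add: norm_mult)
qed

text \<open>
  Cauchy's formula on the boundary of the square of half-side \<open>\<rho>\<close>, where \<open>|w| \<ge> \<rho>\<close>. Squares rather than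
  discs, because their sides are coordinate segments: integrating over \<open>\<rho>\<close> will give an area
  integral by Tonelli alone, without polar coordinates.
\<close>
lemma square_Cauchy_bound:
  fixes g :: "complex \<Rightarrow> complex"
  assumes holo: "g holomorphic_on {w. \<bar>Re w\<bar> < r \<and> \<bar>Im w\<bar> < r}" and \<rho>: "0 < \<rho>" "\<rho> < r"
  shows "ennreal (2 * pi * \<rho> * norm (g 0)) \<le>
     (\<integral>\<^sup>+t. ennreal (norm (g (Complex t (-\<rho>)))) * indicator {-\<rho>..\<rho>} t \<partial>lborel) +
     (\<integral>\<^sup>+t. ennreal (norm (g (Complex \<rho> t))) * indicator {-\<rho>..\<rho>} t \<partial>lborel) +
     (\<integral>\<^sup>+t. ennreal (norm (g (Complex t \<rho>))) * indicator {-\<rho>..\<rho>} t \<partial>lborel) +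
     (\<integral>\<^sup>+t. ennreal (norm (g (Complex (-\<rho>) t))) * indicator {-\<rho>..\<rho>} t \<partial>lborel)"
proof -
  define S where "S = {w. \<bar>Re w\<bar> < r \<and> \<bar>Im w\<bar> < r}"
  have Sbox: "S = box (Complex (-r) (-r)) (Complex r r)"
    by (auto simp: S_def in_box_complex_iff)
  have S: "open S" "convex S" unfolding Sbox by (auto simp: convex_box)
  define h where "h w = g w / (w - 0)" for w
  define a1 a2 a3 a4 where "a1 = Complex (-\<rho>) (-\<rho>)" and "a2 = Complex \<rho> (-\<rho>)"
    and "a3 = Complex \<rho> \<rho>" and "a4 = Complex (-\<rho>) \<rho>"
  have hcont: "continuous_on (S - {0}) h"
    unfolding h_def using holo
    by (intro continuous_intros holomorphic_on_imp_continuous_on) (auto simp: S_def intro: holomorphic_on_subset)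
  have aS: "a1 \<in> S" "a2 \<in> S" "a3 \<in> S" "a4 \<in> S"
    using \<rho> by (auto simp: S_def a1_def a2_def a3_def a4_def)
  have img: "path_image (rectpath a1 a3) \<subseteq> S - {0}"
  proof
    fix w assume "w \<in> path_image (rectpath a1 a3)"
    then have "w \<in> cbox a1 a3 - box a1 a3"
      using path_image_rectpath_cbox_minus_box[of a1 a3] \<rho> by (auto simp: a1_def a3_def)
    then show "w \<in> S - {0}"
      using \<rho> by (auto simp: in_cbox_complex_iff in_box_complex_iff S_def a1_def a3_def)
  qed
  have pieces: "path_image (rectpath a1 a3) =
      closed_segment a1 a2 \<union> closed_segment a2 a3 \<union> closed_segment a3 a4 \<union> closed_segment a4 a1"
    by (simp add: rectpath_def Let_def path_image_join Un_assoc a1_def a2_def a3_def a4_def)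
  have int: "(h has_contour_integral (2*pi * \<i> * winding_number (rectpath a1 a3) 0 * g 0)) (rectpath a1 a3)"
    unfolding h_def
  proof (rule Cauchy_integral_formula_convex_simple)
    show "convex S" by (rule S) 
    show "g holomorphic_on S" using holo by (simp add: S_def)
    show "0 \<in> interior S" using S(1) \<rho> by (auto simp: interior_open S_def)
    show "path_image (rectpath a1 a3) \<subseteq> S - {0}" by (rule img)
  qed (auto simp: rectpath_def Let_def)
  have "winding_number (rectpath a1 a3) 0 = 1"
    by (rule winding_number_rectpath) (use \<rho> in \<open>auto simp: a1_def a3_def in_box_complex_iff\<close>)
  with int have int: "(h has_contour_integral (2*pi * \<i> * g 0)) (rectpath a1 a3)" by simp
  have c1: "continuous_on (closed_segment a1 a2) h" and c2: "continuous_on (closed_segment a2 a3) h"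
    and c3: "continuous_on (closed_segment a3 a4) h" and c4: "continuous_on (closed_segment a4 a1) h"
    using img by (auto intro!: continuous_on_subset[OF hcont] simp: pieces)
  note ci = c1[THEN contour_integrable_continuous_linepath, THEN has_contour_integral_integral]
            c2[THEN contour_integrable_continuous_linepath, THEN has_contour_integral_integral]
            c3[THEN contour_integrable_continuous_linepath, THEN has_contour_integral_integral]
            c4[THEN contour_integrable_continuous_linepath, THEN has_contour_integral_integral]
  have "(h has_contour_integral contour_integral (linepath a1 a2) h +
      (contour_integral (linepath a2 a3) h + (contour_integral (linepath a3 a4) h + contour_integral (linepath a4 a1) h)))
      (rectpath a1 a3)"
    unfolding rectpath_def Let_def a1_def[symmetric] a2_def[symmetric] a3_def[symmetric] a4_def[symmetric]
    using has_contour_integral_join[OF ci(1) has_contour_integral_join[OF ci(2) has_contour_integral_join[OF ci(3,4)]]]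
    by (simp add: a1_def a2_def a3_def a4_def)
  then have "2*pi * \<i> * g 0 = contour_integral (linepath a1 a2) h +
      (contour_integral (linepath a2 a3) h + (contour_integral (linepath a3 a4) h + contour_integral (linepath a4 a1) h))"
    using int contour_integral_unique by metis
  then have "norm (2*pi * \<i> * g 0) \<le> norm (contour_integral (linepath a1 a2) h) +
     (norm (contour_integral (linepath a2 a3) h) + (norm (contour_integral (linepath a3 a4) h) + norm (contour_integral (linepath a4 a1) h)))"
    by (metis (no_types, lifting) add_mono norm_triangle_le norm_triangle_ineq order_refl)
  also have "contour_integral (linepath a3 a4) h = - contour_integral (linepath a4 a3) h"
    using c3 by (rule contour_integral_reverse_linepath)
  also have "contour_integral (linepath a4 a1) h = - contour_integral (linepath a1 a4) h"
    using c4 by (rule contour_integral_reverse_linepath)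
  finally have main: "2 * pi * norm (g 0) \<le> norm (contour_integral (linepath a1 a2) h) +
     norm (contour_integral (linepath a2 a3) h) + norm (contour_integral (linepath a4 a3) h) + norm (contour_integral (linepath a1 a4) h)"
    by (simp add: norm_mult)
  have hb: "norm (h w) \<le> norm (g w) / \<rho>" if "\<rho> \<le> norm w" for w
    using that \<rho> by (auto simp: h_def norm_divide intro!: divide_left_mono mult_pos_pos)
  have sub: "ennreal \<rho> * (\<integral>\<^sup>+t. ennreal (norm (h (\<gamma> t))) * indicator {-\<rho>..\<rho>} t \<partial>lborel)
       \<le> (\<integral>\<^sup>+t. ennreal (norm (g (\<gamma> t))) * indicator {-\<rho>..\<rho>} t \<partial>lborel)"
    if \<gamma>: "\<And>t. \<rho> \<le> norm (\<gamma> t)" "continuous_on {-\<rho>..\<rho>} (\<lambda>t. h (\<gamma> t))" for \<gamma>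
  proof -
    have [measurable]: "(\<lambda>t. ennreal (norm (h (\<gamma> t))) * indicator {-\<rho>..\<rho>} t) \<in> borel_measurable lborel"
    proof -
      have "(\<lambda>t. indicator {-\<rho>..\<rho>} t *\<^sub>R norm (h (\<gamma> t))) \<in> borel_measurable borel"
        using \<gamma>(2) by (intro borel_measurable_continuous_on_indicator continuous_intros) auto
      then have "(\<lambda>t. ennreal (indicator {-\<rho>..\<rho>} t *\<^sub>R norm (h (\<gamma> t)))) \<in> borel_measurable lborel" by simp
      also have "(\<lambda>t. ennreal (indicator {-\<rho>..\<rho>} t *\<^sub>R norm (h (\<gamma> t)))) = (\<lambda>t. ennreal (norm (h (\<gamma> t))) * indicator {-\<rho>..\<rho>} t)"
        by (auto simp: fun_eq_iff indicator_def)
      finally show ?thesis .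
    qed
    have "ennreal \<rho> * (\<integral>\<^sup>+t. ennreal (norm (h (\<gamma> t))) * indicator {-\<rho>..\<rho>} t \<partial>lborel)
        = (\<integral>\<^sup>+t. ennreal \<rho> * (ennreal (norm (h (\<gamma> t))) * indicator {-\<rho>..\<rho>} t) \<partial>lborel)"
      by (rule nn_integral_cmult[symmetric]) measurable
    also have "\<dots> \<le> (\<integral>\<^sup>+t. ennreal (norm (g (\<gamma> t))) * indicator {-\<rho>..\<rho>} t \<partial>lborel)"
    proof (rule nn_integral_mono)
      fix t
      have "\<rho> * norm (h (\<gamma> t)) \<le> norm (g (\<gamma> t))"
        using hb[OF \<gamma>(1), of t] \<rho> by (simp add: field_simps)
      then show "ennreal \<rho> * (ennreal (norm (h (\<gamma> t))) * indicator {-\<rho>..\<rho>} t) \<le> ennreal (norm (g (\<gamma> t))) * indicator {-\<rho>..\<rho>} t"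
        using \<rho> by (auto simp: indicator_def ennreal_mult'[symmetric] ennreal_leI)
    qed
    finally show ?thesis .
  qed
  have segh: "continuous_on {-\<rho>..\<rho>} (\<lambda>t. h (Complex t c))" if "\<bar>c\<bar> = \<rho>" for c
    by (rule continuous_on_compose2[OF hcont])
       (use that \<rho> in \<open>auto simp: Complex_eq S_def complex_eq_iff intro!: continuous_intros\<close>)
  have segv: "continuous_on {-\<rho>..\<rho>} (\<lambda>t. h (Complex c t))" if "\<bar>c\<bar> = \<rho>" for c
    by (rule continuous_on_compose2[OF hcont])
       (use that \<rho> in \<open>auto simp: Complex_eq S_def complex_eq_iff intro!: continuous_intros\<close>)
  have nh: "\<rho> \<le> norm (Complex t c)" and nv: "\<rho> \<le> norm (Complex c t)" if "\<bar>c\<bar> = \<rho>" for t c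
    using that abs_Im_le_cmod[of "Complex t c"] abs_Re_le_cmod[of "Complex c t"] by auto
  have lt: "-\<rho> < \<rho>" using \<rho> by simp
  have "ennreal (2 * pi * \<rho> * norm (g 0)) = ennreal \<rho> * ennreal (2 * pi * norm (g 0))"
    using \<rho> by (simp add: ennreal_mult'[symmetric] mult_ac)
  also have "\<dots> \<le> ennreal \<rho> * ennreal (norm (contour_integral (linepath a1 a2) h) +
     norm (contour_integral (linepath a2 a3) h) + norm (contour_integral (linepath a4 a3) h) + norm (contour_integral (linepath a1 a4) h))"
    using main by (intro mult_left_mono ennreal_leI) auto
  also have "\<dots> = ennreal \<rho> * ennreal (norm (contour_integral (linepath a1 a2) h))
     + ennreal \<rho> * ennreal (norm (contour_integral (linepath a2 a3) h)) 
     + ennreal \<rho> * ennreal (norm (contour_integral (linepath a4 a3) h))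
     + ennreal \<rho> * ennreal (norm (contour_integral (linepath a1 a4) h))"
    by (simp add: distrib_left)
  also have "\<dots> \<le> ennreal \<rho> * (\<integral>\<^sup>+t. ennreal (norm (h (Complex t (-\<rho>)))) * indicator {-\<rho>..\<rho>} t \<partial>lborel) +
     ennreal \<rho> * (\<integral>\<^sup>+t. ennreal (norm (h (Complex \<rho> t))) * indicator {-\<rho>..\<rho>} t \<partial>lborel) +
     ennreal \<rho> * (\<integral>\<^sup>+t. ennreal (norm (h (Complex t \<rho>))) * indicator {-\<rho>..\<rho>} t \<partial>lborel) +
     ennreal \<rho> * (\<integral>\<^sup>+t. ennreal (norm (h (Complex (-\<rho>) t))) * indicator {-\<rho>..\<rho>} t \<partial>lborel)"
    using c1 c2 c3 c4 unfolding a1_def a2_def a3_def a4_def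
    by (intro add_mono mult_left_mono norm_contour_integral_vertical_le norm_contour_integral_horizontal_le lt)
       (auto simp: closed_segment_commute)
  also have "\<dots> \<le> (\<integral>\<^sup>+t. ennreal (norm (g (Complex t (-\<rho>)))) * indicator {-\<rho>..\<rho>} t \<partial>lborel) +
     (\<integral>\<^sup>+t. ennreal (norm (g (Complex \<rho> t))) * indicator {-\<rho>..\<rho>} t \<partial>lborel) +
     (\<integral>\<^sup>+t. ennreal (norm (g (Complex t \<rho>))) * indicator {-\<rho>..\<rho>} t \<partial>lborel) +
     (\<integral>\<^sup>+t. ennreal (norm (g (Complex (-\<rho>) t))) * indicator {-\<rho>..\<rho>} t \<partial>lborel)"
    using \<rho> by (intro add_mono sub segh segv nh nv) auto
  finally show ?thesis .
qed

lemma measurable_Complex [measurable (raw)]: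
  assumes [measurable]: "f \<in> borel_measurable M" "g \<in> borel_measurable M"
  shows "(\<lambda>x. Complex (f x) (g x)) \<in> borel_measurable M"
  unfolding Complex_eq by measurable

lemma power_norm_indicator_measurable:
  fixes f :: "complex \<Rightarrow> complex"
  assumes "open S" "continuous_on S f"
  shows "(\<lambda>z. ennreal (norm (f z) powr p) * indicator S z) \<in> borel_measurable borel"
proof -
  have "(\<lambda>z. indicator S z *\<^sub>R norm (f z)) \<in> borel_measurable borel"
    using assms by (intro borel_measurable_continuous_on_indicator continuous_intros) auto
  then have "(\<lambda>z. ennreal ((indicator S z *\<^sub>R norm (f z)) powr p)) \<in> borel_measurable borel" by simp
  also have "(\<lambda>z. ennreal ((indicator S z *\<^sub>R norm (f z)) powr p)) = (\<lambda>z. ennreal (norm (f z) powr p) * indicator S z)"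
    by (auto simp: fun_eq_iff indicator_def)
  finally show ?thesis .
qed

text \<open>
  Integrate the preceding bound over \<open>\<rho>\<close> from \<open>0\<close> to \<open>r\<close> and enlarge each side to the full width of
  the square. The horizontal sides together sweep the square at most once, and so do the vertical
  ones, whence the factor \<open>2\<close>.
\<close>
lemma square_area_bound:
  fixes g :: "complex \<Rightarrow> complex"
  assumes holo: "g holomorphic_on {w. \<bar>Re w\<bar> < r \<and> \<bar>Im w\<bar> < r}" and r: "0 < r"
  shows "ennreal (pi * r\<^sup>2 * norm (g 0)) \<le> 2 * (\<integral>\<^sup>+\<tau>. \<integral>\<^sup>+t. ennreal (norm (g (Complex t \<tau>))) *
           indicator {w. \<bar>Re w\<bar> < r \<and> \<bar>Im w\<bar> < r} (Complex t \<tau>) \<partial>lborel \<partial>lborel)"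
proof -
  define S where "S = {w. \<bar>Re w\<bar> < r \<and> \<bar>Im w\<bar> < r}"
  have Sbox: "S = box (Complex (-r) (-r)) (Complex r r)"
    by (auto simp: S_def in_box_complex_iff)
  have oS: "open S" unfolding Sbox by auto
  define N where "N w = ennreal (norm (g w)) * indicator S w" for w
  have [measurable]: "N \<in> borel_measurable borel"
    using power_norm_indicator_measurable[OF oS holomorphic_on_imp_continuous_on, of g 1] holo
    by (simp add: N_def[abs_def] S_def)
  define T where "T \<tau> = (\<integral>\<^sup>+t. N (Complex t \<tau>) \<partial>lborel)" for \<tau>
  define V where "V t = (\<integral>\<^sup>+\<tau>. N (Complex t \<tau>) \<partial>lborel)" for t
  have [measurable]: "T \<in> borel_measurable lborel" "V \<in> borel_measurable lborel"
    unfolding T_def V_def by measurable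
  have TV: "(\<integral>\<^sup>+\<tau>. T \<tau> \<partial>lborel) = (\<integral>\<^sup>+t. V t \<partial>lborel)"
    unfolding T_def V_def by (rule lborel_pair.Fubini') measurable
  have side: "ennreal (2 * pi * \<rho> * norm (g 0)) * indicator {0<..<r} \<rho> \<le>
      (T (-\<rho>) * indicator {0<..<r} \<rho> + V \<rho> * indicator {0<..<r} \<rho>) +
      (T \<rho> * indicator {0<..<r} \<rho> + V (-\<rho>) * indicator {0<..<r} \<rho>)" for \<rho>
  proof (cases "\<rho> \<in> {0<..<r}")
    case True
    then have \<rho>: "0 < \<rho>" "\<rho> < r" by auto
    have a: "(\<integral>\<^sup>+t. ennreal (norm (g (Complex t c))) * indicator {-\<rho>..\<rho>} t \<partial>lborel) \<le> T c" if "\<bar>c\<bar> = \<rho>" for c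
      unfolding T_def using \<rho> that by (intro nn_integral_mono) (auto simp: N_def S_def indicator_def)
    have b: "(\<integral>\<^sup>+t. ennreal (norm (g (Complex c t))) * indicator {-\<rho>..\<rho>} t \<partial>lborel) \<le> V c" if "\<bar>c\<bar> = \<rho>" for c
      unfolding V_def using \<rho> that by (intro nn_integral_mono) (auto simp: N_def S_def indicator_def)
    have "ennreal (2 * pi * \<rho> * norm (g 0)) \<le> T (-\<rho>) + V \<rho> + T \<rho> + V (-\<rho>)"
      by (rule order_trans[OF square_Cauchy_bound[OF holo \<rho>]], intro add_mono a b) (use \<rho> in auto)
    with True show ?thesis by (simp add: add_ac)
  qed auto
  have half: "(\<integral>\<^sup>+\<rho>. (X (-\<rho>) * indicator {0<..<r} \<rho>) \<partial>lborel) + (\<integral>\<^sup>+\<rho>. (X \<rho> * indicator {0<..<r} \<rho>) \<partial>lborel)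
     \<le> (\<integral>\<^sup>+\<rho>. X \<rho> \<partial>lborel)" if [measurable]: "X \<in> borel_measurable lborel" for X :: "real \<Rightarrow> ennreal"
  proof -
    have "(\<integral>\<^sup>+\<rho>. (X (-\<rho>) * indicator {0<..<r} \<rho>) \<partial>lborel) = (\<integral>\<^sup>+\<rho>. (X \<rho> * indicator {0<..<r} (-\<rho>)) \<partial>lborel)"
      by (subst nn_integral_real_affine[where c="-1" and t=0]) auto
    also have "\<dots> + (\<integral>\<^sup>+\<rho>. (X \<rho> * indicator {0<..<r} \<rho>) \<partial>lborel) =
        (\<integral>\<^sup>+\<rho>. (X \<rho> * indicator {0<..<r} (-\<rho>)) + (X \<rho> * indicator {0<..<r} \<rho>) \<partial>lborel)"
      by (subst nn_integral_add) auto
    also have "\<dots> \<le> (\<integral>\<^sup>+\<rho>. X \<rho> \<partial>lborel)"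
      by (intro nn_integral_mono) (auto simp: indicator_def)
    finally show ?thesis .
  qed
  have "ennreal (pi * r\<^sup>2 * norm (g 0)) = (\<integral>\<^sup>+\<rho>. ennreal (2 * pi * \<rho> * norm (g 0)) * indicator {0..r} \<rho> \<partial>lborel)"
    by (subst nn_integral_FTC_Icc[where F = "\<lambda>\<rho>. pi * \<rho>\<^sup>2 * norm (g 0)"])
       (use r in \<open>auto intro!: derivative_eq_intros\<close>)
  also have "\<dots> = (\<integral>\<^sup>+\<rho>. ennreal (2 * pi * \<rho> * norm (g 0)) * indicator {0<..<r} \<rho> \<partial>lborel)"
  proof (rule nn_integral_cong_AE)
    have "AE \<rho> in lborel. \<rho> \<noteq> 0 \<and> \<rho> \<noteq> r"
      using AE_lborel_singleton[of 0] AE_lborel_singleton[of r] by (rule AE_conjI)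
    then show "AE \<rho> in lborel. ennreal (2 * pi * \<rho> * norm (g 0)) * indicator {0..r} \<rho> =
        ennreal (2 * pi * \<rho> * norm (g 0)) * indicator {0<..<r} \<rho>"
      by eventually_elim (auto simp: indicator_def)
  qed
  also have "\<dots> \<le> (\<integral>\<^sup>+\<rho>. (T (-\<rho>) * indicator {0<..<r} \<rho> + V \<rho> * indicator {0<..<r} \<rho>) +
      (T \<rho> * indicator {0<..<r} \<rho> + V (-\<rho>) * indicator {0<..<r} \<rho>) \<partial>lborel)"
    by (intro nn_integral_mono side)
  also have "\<dots> = ((\<integral>\<^sup>+\<rho>. T (-\<rho>) * indicator {0<..<r} \<rho> \<partial>lborel) + (\<integral>\<^sup>+\<rho>. T \<rho> * indicator {0<..<r} \<rho> \<partial>lborel)) +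
      ((\<integral>\<^sup>+\<rho>. V (-\<rho>) * indicator {0<..<r} \<rho> \<partial>lborel) + (\<integral>\<^sup>+\<rho>. V \<rho> * indicator {0<..<r} \<rho> \<partial>lborel))"
    by (simp add: nn_integral_add add_ac)
  also have "\<dots> \<le> (\<integral>\<^sup>+\<tau>. T \<tau> \<partial>lborel) + (\<integral>\<^sup>+t. V t \<partial>lborel)"
    by (intro add_mono half) auto
  also have "\<dots> = 2 * (\<integral>\<^sup>+\<tau>. T \<tau> \<partial>lborel)"
    by (simp add: TV mult_2)
  finally show ?thesis by (simp add: T_def N_def S_def)
qed

text \<open>
  A mean value inequality for \<open>|f|\<^sup>p\<close>. The power is reached through
  \<open>x \<le> l + l\<^sup>1\<^sup>-\<^sup>p x\<^sup>p\<close> for \<open>l > 0\<close>; with \<open>l = |f c|/6\<close> the contribution of the constant \<open>l\<close> to the area bound is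
  less than half of \<open>|f c|\<close> and is absorbed on the left.
\<close>
lemma square_power_bound:
  fixes f :: "complex \<Rightarrow> complex"
  assumes holo: "f holomorphic_on {w. \<bar>Re w - Re c\<bar> < r \<and> \<bar>Im w - Im c\<bar> < r}"
    and r: "0 < r" and p: "1 \<le> p"
  shows "ennreal (norm (f c) powr p) \<le> ennreal (6 powr p / r\<^sup>2) *
     (\<integral>\<^sup>+\<tau>. \<integral>\<^sup>+t. ennreal (norm (f (c + Complex t \<tau>)) powr p) *
         indicator {w. \<bar>Re w\<bar> < r \<and> \<bar>Im w\<bar> < r} (Complex t \<tau>) \<partial>lborel \<partial>lborel)"
    (is "_ \<le> _ * ?B")
proof -
  define S where "S = {w. \<bar>Re w\<bar> < r \<and> \<bar>Im w\<bar> < r}"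
  have Sbox: "S = box (Complex (-r) (-r)) (Complex r r)"
    by (auto simp: S_def in_box_complex_iff)
  have oS: "open S" unfolding Sbox by auto
  define g where "g w = f (c + w)" for w
  have holg: "g holomorphic_on S"
    unfolding g_def
    by (intro holomorphic_on_compose_gen[OF _ holo, unfolded o_def] holomorphic_intros) (auto simp: S_def)
  define w where "w = norm (f c)"
  define N where "N z = ennreal (norm (g z) powr p) * indicator S z" for z
  have [measurable]: "N \<in> borel_measurable borel"
    unfolding N_def[abs_def] by (intro power_norm_indicator_measurable oS holomorphic_on_imp_continuous_on holg)
  define I where "I = {-r<..<r}"
  have [measurable]: "I \<in> sets lborel" by (simp add: I_def)
  have Bdef: "?B = (\<integral>\<^sup>+\<tau>. \<integral>\<^sup>+t. N (Complex t \<tau>) \<partial>lborel \<partial>lborel)"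
    by (simp add: N_def g_def S_def)
  show ?thesis
  proof (cases "w = 0 \<or> ?B = \<infinity>")
    case True
    then show ?thesis using r by (auto simp: w_def ennreal_mult_top)
  next
    case False
    then have w: "w > 0" by (auto simp: w_def)
    from False obtain b where b: "?B = ennreal b" "b \<ge> 0"
      by (cases ?B rule: ennreal_cases) auto
    define l where "l = w / 6"
    have l: "l > 0" using w by (simp add: l_def)
    have tang: "x \<le> l + l powr (1 - p) * x powr p" if "x \<ge> 0" for x
    proof (cases "x \<le> l")
      case True
      then show ?thesis using l by (smt (verit) powr_ge_zero mult_nonneg_nonneg)
    next
      case False
      then have x: "x > l" "x > 0" using l by auto
      have "x powr (1 - p) \<le> l powr (1 - p)"
        using x l p by (intro powr_mono2') auto
      then have "x powr (1 - p) * x powr p \<le> l powr (1 - p) * x powr p"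
        by (intro mult_right_mono) auto
      then show ?thesis using x l by (simp add: powr_add[symmetric])
    qed
    have "ennreal (pi * r\<^sup>2 * w) \<le> 2 * (\<integral>\<^sup>+\<tau>. \<integral>\<^sup>+t. ennreal (norm (g (Complex t \<tau>))) *
           indicator S (Complex t \<tau>) \<partial>lborel \<partial>lborel)"
      using square_area_bound[of g r] holg r by (simp add: S_def w_def g_def)
    also have "\<dots> \<le> 2 * (\<integral>\<^sup>+\<tau>. \<integral>\<^sup>+t. (ennreal l * indicator I t) * indicator I \<tau> +
           ennreal (l powr (1-p)) * N (Complex t \<tau>) \<partial>lborel \<partial>lborel)"
    proof (intro mult_left_mono nn_integral_mono)
      fix \<tau> t :: real
      show "ennreal (norm (g (Complex t \<tau>))) * indicator S (Complex t \<tau>) \<le>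
         (ennreal l * indicator I t) * indicator I \<tau> + ennreal (l powr (1-p)) * N (Complex t \<tau>)"
      proof (cases "Complex t \<tau> \<in> S")
        case True
        then have "t \<in> I" "\<tau> \<in> I" by (auto simp: S_def I_def)
        with True show ?thesis
          using tang[of "norm (g (Complex t \<tau>))"] l
          by (simp add: N_def ennreal_leI flip: ennreal_mult' ennreal_plus)
      qed auto
    qed auto
    also have "(\<integral>\<^sup>+\<tau>. \<integral>\<^sup>+t. (ennreal l * indicator I t) * indicator I \<tau> +
           ennreal (l powr (1-p)) * N (Complex t \<tau>) \<partial>lborel \<partial>lborel) =
        (\<integral>\<^sup>+\<tau>. \<integral>\<^sup>+t. (ennreal l * indicator I t) * indicator I \<tau> \<partial>lborel \<partial>lborel) + ennreal (l powr (1-p)) * ?B"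
      unfolding Bdef by (simp add: nn_integral_add nn_integral_cmult)
    also have "(\<integral>\<^sup>+\<tau>. \<integral>\<^sup>+t. (ennreal l * indicator I t) * indicator I \<tau> \<partial>lborel \<partial>lborel) = ennreal (4 * r\<^sup>2 * l)"
    proof -
      have "(\<integral>\<^sup>+\<tau>. \<integral>\<^sup>+t. (ennreal l * indicator I t) * indicator I \<tau> \<partial>lborel \<partial>lborel) =
          ennreal l * ennreal (2 * r) * ennreal (2 * r)"
        using r by (simp add: nn_integral_multc nn_integral_cmult_indicator nn_integral_cmult I_def)
      also have "\<dots> = ennreal (l * (2 * r) * (2 * r))"
        using l r by (simp only: ennreal_mult'[symmetric] ennreal_mult''[symmetric])
      finally show ?thesis by (simp add: power2_eq_square mult_ac)
    qed
    also have "2 * (ennreal (4 * r\<^sup>2 * l) + ennreal (l powr (1-p)) * ?B) = ennreal (2 * (4 * r\<^sup>2 * l + l powr (1-p) * b))"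
    proof -
      have "ennreal (2 * (4 * r\<^sup>2 * l + l powr (1-p) * b)) = ennreal 2 * ennreal (4 * r\<^sup>2 * l + l powr (1-p) * b)"
        by (rule ennreal_mult') simp
      also have "ennreal (4 * r\<^sup>2 * l + l powr (1-p) * b) = ennreal (4 * r\<^sup>2 * l) + ennreal (l powr (1-p) * b)"
        using l b by (intro ennreal_plus) auto
      also have "ennreal (l powr (1-p) * b) = ennreal (l powr (1-p)) * ?B"
        unfolding b by (rule ennreal_mult') simp
      finally show ?thesis by simp
    qed
    finally have 1: "pi * r\<^sup>2 * w \<le> 2 * (4 * r\<^sup>2 * l + l powr (1-p) * b)"
      using l b by (subst (asm) ennreal_le_iff) auto
    have "3 * (r\<^sup>2 * w) \<le> pi * (r\<^sup>2 * w)"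
      using pi_gt3 w r by (intro mult_right_mono) auto
    moreover have "0 \<le> r\<^sup>2 * w" using w by simp
    moreover have "pi * (r\<^sup>2 * w) \<le> 4 / 3 * (r\<^sup>2 * w) + 2 * (l powr (1-p) * b)"
      using 1 by (simp add: l_def mult_ac distrib_left)
    ultimately have 2: "r\<^sup>2 * w \<le> 2 * (l powr (1-p) * b)" by linarith
    have "r\<^sup>2 * w powr p = r\<^sup>2 * w * (l powr (p - 1) * 6 powr (p - 1))"
    proof -
      have "w powr p = w powr (1 + (p - 1))" by simp
      also have "\<dots> = w * w powr (p - 1)" using w by (subst powr_add) simp
      also have "w powr (p - 1) = (l * 6) powr (p - 1)" by (simp add: l_def)
      also have "\<dots> = l powr (p - 1) * 6 powr (p - 1)" using l by (subst powr_mult) auto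
      finally show ?thesis by simp
    qed
    also have "\<dots> \<le> 2 * (l powr (1-p) * b) * (l powr (p - 1) * 6 powr (p - 1))"
      using 2 by (intro mult_right_mono) auto
    also have "\<dots> = (l powr (1 - p) * l powr (p - 1)) * (2 * 6 powr (p-1) * b)" by (simp add: mult_ac)
    also have "\<dots> = 2 * 6 powr (p-1) * b" using l by (simp add: powr_add[symmetric])
    also have "\<dots> \<le> 6 powr p * b"
      using b by (intro mult_right_mono) (auto simp: powr_diff)
    finally have "w powr p \<le> 6 powr p / r\<^sup>2 * b" using r by (simp add: field_simps)
    then show ?thesis
      using b by (simp add: w_def ennreal_mult'[symmetric] ennreal_leI)
  qed
qed

section \<open>Hardy functions on horizontal lines\<close>

lemma open_upper_half_plane: "open upper_half_plane"
  unfolding upper_half_plane_def by (rule open_halfspace_Im_gt)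

lemma convex_upper_half_plane: "convex upper_half_plane"
  unfolding upper_half_plane_def by (rule convex_halfspace_Im_gt)

lemma Complex_in_upper_half_plane [simp]: "Complex x y \<in> upper_half_plane \<longleftrightarrow> y > 0"
  by (simp add: upper_half_plane_def)

lemma horizontal_slice_measurable:
  assumes "continuous_on S f" "\<And>x. Complex x y \<in> S"
  shows "(\<lambda>x. f (Complex x y)) \<in> borel_measurable borel"
  by (intro borel_measurable_continuous_onI continuous_on_compose2[OF assms(1)])
     (use assms(2) in \<open>auto simp: Complex_eq intro!: continuous_intros\<close>)

lemma hardy_holomorphic: "f \<in> hardy p \<Longrightarrow> f holomorphic_on upper_half_plane"
  by (simp add: hardy_def)

lemma hardy_slice_measurable:
  "f \<in> hardy p \<Longrightarrow> y > 0 \<Longrightarrow> (\<lambda>x. f (Complex x y)) \<in> borel_measurable borel"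
  by (rule horizontal_slice_measurable[of upper_half_plane])
     (auto intro: holomorphic_on_imp_continuous_on hardy_holomorphic)

lemma hardy_slice_bound:
  assumes "f \<in> hardy p"
  obtains K where "K \<ge> 0" "\<And>y. y > 0 \<Longrightarrow> (\<integral>\<^sup>+x. ennreal (norm (f (Complex x y)) powr p) \<partial>lborel) \<le> ennreal K"
proof -
  define K where "K = (SUP y\<in>{0<..}. \<integral>\<^sup>+x. ennreal (norm (f (Complex x y)) powr p) \<partial>lborel)"
  have "K < \<infinity>" using assms by (simp add: hardy_def K_def)
  then obtain k where k: "K = ennreal k" "k \<ge> 0"
    by (cases K rule: ennreal_cases) auto
  have "(\<integral>\<^sup>+x. ennreal (norm (f (Complex x y)) powr p) \<partial>lborel) \<le> ennreal k" if "y > 0" for y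
    unfolding k(1)[symmetric] K_def by (rule SUP_upper) (use that in auto)
  with k(2) that show ?thesis by blast
qed

text \<open>
  The square of half-side \<open>\<epsilon>/2\<close> around a point of height at least \<open>\<epsilon>\<close> stays in the half-plane and is
  covered by lines on which the \<open>p\<close>-norm is uniformly bounded.
\<close>
lemma hardy_bounded:
  assumes f: "f \<in> hardy p" and p: "1 \<le> p" and \<epsilon>: "\<epsilon> > 0"
  obtains B where "B \<ge> 0" "\<And>z. Im z \<ge> \<epsilon> \<Longrightarrow> norm (f z) \<le> B"
proof -
  obtain K where K: "K \<ge> 0" "\<And>y. y > 0 \<Longrightarrow> (\<integral>\<^sup>+x. ennreal (norm (f (Complex x y)) powr p) \<partial>lborel) \<le> ennreal K"
    using hardy_slice_bound[OF f] by blast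
  define r where "r = \<epsilon> / 2"
  have r: "r > 0" using \<epsilon> by (simp add: r_def)
  define B where "B = (6 powr p / r\<^sup>2 * (K * (2 * r))) powr (1 / p)"
  have "norm (f z) \<le> B" if z: "Im z \<ge> \<epsilon>" for z
  proof -
    have im: "Im w > 0" if "\<bar>Im w - Im z\<bar> < r" for w
      using that z \<epsilon> unfolding r_def abs_less_iff by linarith
    have "ennreal (norm (f z) powr p) \<le> ennreal (6 powr p / r\<^sup>2) *
     (\<integral>\<^sup>+\<tau>. \<integral>\<^sup>+t. ennreal (norm (f (z + Complex t \<tau>)) powr p) *
         indicator {w. \<bar>Re w\<bar> < r \<and> \<bar>Im w\<bar> < r} (Complex t \<tau>) \<partial>lborel \<partial>lborel)"
      by (rule square_power_bound[OF _ r p])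
         (rule holomorphic_on_subset[OF hardy_holomorphic[OF f]],
          use im in \<open>auto simp: upper_half_plane_def\<close>)
    also have "\<dots> \<le> ennreal (6 powr p / r\<^sup>2) * (\<integral>\<^sup>+\<tau>. ennreal K * indicator {-r<..<r} \<tau> \<partial>lborel)"
    proof (intro mult_left_mono nn_integral_mono)
      fix \<tau> :: real
      show "(\<integral>\<^sup>+t. ennreal (norm (f (z + Complex t \<tau>)) powr p) *
         indicator {w. \<bar>Re w\<bar> < r \<and> \<bar>Im w\<bar> < r} (Complex t \<tau>) \<partial>lborel) \<le> ennreal K * indicator {-r<..<r} \<tau>"
      proof (cases "\<tau> \<in> {-r<..<r}")
        case True
        then have pos: "Im z + \<tau> > 0" using z \<epsilon> by (auto simp: r_def)
        note [measurable] = hardy_slice_measurable[OF f pos]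
        have "(\<integral>\<^sup>+t. ennreal (norm (f (z + Complex t \<tau>)) powr p) *
         indicator {w. \<bar>Re w\<bar> < r \<and> \<bar>Im w\<bar> < r} (Complex t \<tau>) \<partial>lborel) \<le>
          (\<integral>\<^sup>+t. ennreal (norm (f (Complex (Re z + 1 * t) (Im z + \<tau>))) powr p) \<partial>lborel)"
          by (intro nn_integral_mono) (auto simp: indicator_def plus_complex.code)
        also have "\<dots> = (\<integral>\<^sup>+t. ennreal (norm (f (Complex t (Im z + \<tau>))) powr p) \<partial>lborel)"
          by (subst (2) nn_integral_real_affine[where c=1 and t="Re z"]) auto
        also have "\<dots> \<le> ennreal K" by (rule K(2)[OF pos])
        finally show ?thesis using True by simp
      next
        case False
        then have "\<not> \<bar>\<tau>\<bar> < r" by auto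
        then show ?thesis by simp
      qed
    qed auto
    also have "\<dots> = ennreal (6 powr p / r\<^sup>2) * (ennreal K * ennreal (2 * r))"
      using r by (simp add: nn_integral_cmult_indicator)
    also have "\<dots> = ennreal (6 powr p / r\<^sup>2 * (K * (2 * r)))"
      using K r by (simp flip: ennreal_mult' ennreal_mult'')
    finally have "norm (f z) powr p \<le> 6 powr p / r\<^sup>2 * (K * (2 * r))"
      using K r by (subst (asm) ennreal_le_iff) auto
    then have "(norm (f z) powr p) powr (1 / p) \<le> B"
      unfolding B_def using p by (intro powr_mono2) auto
    then show ?thesis using p by (simp add: powr_powr)
  qed
  moreover have "B \<ge> 0" by (simp add: B_def)
  ultimately show ?thesis using that by blast
qed

section \<open>A maximum principle for powers of the modulus\<close>

text \<open>
  Near a point with \<open>f z0 \<noteq> 0\<close> there is a holomorphic \<open>k\<close> with \<open>|k| = |f|\<^sup>q\<close>, normalised so that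
  \<open>k z0 > 0\<close>. Then \<open>|exp (k - W)| \<le> exp (|f|\<^sup>q - Re W)\<close> with equality at \<open>z0\<close>, so a maximum of the right
  side at \<open>z0\<close> is one of the left side, and the maximum modulus principle applies.
\<close>
lemma local_max_power_minus_harmonic:
  assumes S: "open S" and f: "f holomorphic_on S" and W: "W holomorphic_on S"
    and z0: "z0 \<in> S" "f z0 \<noteq> 0"
    and max: "\<And>z. z \<in> S \<Longrightarrow> norm (f z) powr q - Re (W z) \<le> norm (f z0) powr q - Re (W z0)"
  obtains e where "e > 0" "ball z0 e \<subseteq> S"
    "\<And>z. z \<in> ball z0 e \<Longrightarrow> norm (f z) powr q - Re (W z) = norm (f z0) powr q - Re (W z0)"
proof -
  define v where "v z = norm (f z) powr q - Re (W z)" for z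
  have "continuous_on S f" using f by (rule holomorphic_on_imp_continuous_on)
  then have "continuous (at z0) f" using S z0 by (simp add: continuous_on_eq_continuous_at)
  then have "((\<lambda>z. f z / f z0) \<longlongrightarrow> f z0 / f z0) (at z0)"
    using z0 by (intro tendsto_intros) (auto simp: isCont_def)
  then have "((\<lambda>z. f z / f z0) \<longlongrightarrow> 1) (at z0)" using z0 by simp
  then have "eventually (\<lambda>z. dist (f z / f z0) 1 < 1) (at z0)"
    by (rule tendstoD) simp
  then obtain d where d: "d > 0" "\<And>z. z \<noteq> z0 \<Longrightarrow> dist z z0 < d \<Longrightarrow> dist (f z / f z0) 1 < 1"
    unfolding eventually_at by auto
  obtain e' where e': "e' > 0" "ball z0 e' \<subseteq> S" using S z0 open_contains_ball by blast
  define e where "e = min d e'"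
  define T where "T = ball z0 e"
  have T: "T \<subseteq> S" "z0 \<in> T" "open T" "connected T" "e > 0" using d e' by (auto simp: T_def e_def)
  have near: "Re (f z / f z0) > 0" if "z \<in> T" for z
  proof -
    have "dist (f z / f z0) 1 < 1"
      using that d(2)[of z] z0 by (cases "z = z0") (auto simp: T_def e_def dist_commute)
    then have "\<bar>Re (f z / f z0 - 1)\<bar> < 1" using abs_Re_le_cmod[of "f z / f z0 - 1"] by (simp add: dist_norm)
    then show ?thesis by simp
  qed
  \<comment> \<open>Dividing by \<open>f z0\<close> keeps the argument of the logarithm in the right half-plane.\<close>
  define k where "k z = of_real (norm (f z0) powr q) * exp (of_real q * Ln (f z / f z0))" for z
  have nonneg: "f z / f z0 \<notin> \<real>\<^sub>\<le>\<^sub>0" if "z \<in> T" for z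
    using near[OF that] by (meson complex_nonpos_Reals_iff not_le)
  have kh: "k holomorphic_on T"
    unfolding k_def using nonneg z0 T
    by (intro holomorphic_intros holomorphic_on_subset[OF f]) auto
  have nk: "norm (k z) = norm (f z) powr q" if "z \<in> T" for z
  proof -
    have "f z \<noteq> 0" using near[OF that] by auto
    then have "norm (k z) = norm (f z0) powr q * (norm (f z) / norm (f z0)) powr q"
      using z0 by (simp add: k_def norm_mult norm_divide powr_def)
    then show ?thesis using z0 by (simp add: powr_mult[symmetric])
  qed
  \<comment> \<open>Exponentiating turns a maximum of \<open>Re (k - W)\<close> into a maximum of a modulus.\<close>
  define E where "E z = exp (k z - W z)" for z
  have Eh: "E holomorphic_on T" unfolding E_def
    using T by (intro holomorphic_intros kh holomorphic_on_subset[OF W])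
  have "k z0 = of_real (norm (f z0) powr q)" using z0 by (simp add: k_def)
  then have E0: "norm (E z0) = exp (v z0)" by (simp add: E_def v_def)
  have Ele: "norm (E z) \<le> exp (v z)" if "z \<in> T" for z
    using complex_Re_le_cmod[of "k z"] nk[OF that] by (simp add: E_def v_def)
  have "E constant_on T"
  proof (rule maximum_modulus_principle[OF Eh T(3,4,3) order_refl T(2)])
    fix z assume "z \<in> T"
    then show "norm (E z) \<le> norm (E z0)" unfolding E0
      using Ele[of z] max[of z] T by (auto simp: v_def intro: order_trans)
  qed
  then have const: "E z = E z0" if "z \<in> T" for z
    using that T by (auto simp: constant_on_def)
  have "v z = v z0" if "z \<in> T" for z
    using Ele[OF that] const[OF that] E0 max[of z] that T by (auto simp: v_def intro: antisym)
  with T that[of e] show ?thesis unfolding v_def T_def by blast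
qed

text \<open>
  The maximum principle for \<open>|f|\<^sup>q - Re W\<close>, stated without boundary values: the difference is
  asymptotically nonpositive when \<open>z\<close> leaves every compact subset. A positive maximum cannot lie at a
  zero of \<open>f\<close>, since \<open>Re W \<ge> 0\<close>; so the set where it is attained, which is closed by continuity, is open
  by the previous lemma.
\<close>
lemma power_norm_le_harmonic:
  assumes S: "open S" "connected S" and f: "f holomorphic_on S" and W: "W holomorphic_on S"
    and q: "q > 0" and Wnn: "\<And>z. z \<in> S \<Longrightarrow> 0 \<le> Re (W z)"
    and small: "\<And>\<eta>. \<eta> > 0 \<Longrightarrow> \<exists>K. compact K \<and> K \<subseteq> S \<and> (\<forall>z\<in>S-K. norm (f z) powr q - Re (W z) \<le> \<eta>)"
    and z: "z \<in> S"
  shows "norm (f z) powr q \<le> Re (W z)"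
proof (rule ccontr)
  define v where "v z = norm (f z) powr q - Re (W z)" for z
  assume "\<not> ?thesis"
  then have vz: "v z > 0" by (simp add: v_def)
  then obtain K where K: "compact K" "K \<subseteq> S" "\<And>w. w \<in> S - K \<Longrightarrow> v w \<le> v z / 2"
    using small[of "v z / 2"] by (auto simp: v_def)
  have zK: "z \<in> K" using K(3)[of z] z vz by fastforce
  have contv: "continuous_on S v"
    unfolding v_def using f W q
    by (intro continuous_intros continuous_on_powr' holomorphic_on_imp_continuous_on) auto
  obtain z0 where z0: "z0 \<in> K" "\<And>w. w \<in> K \<Longrightarrow> v w \<le> v z0"
    using continuous_attains_sup[OF K(1) _ continuous_on_subset[OF contv K(2)]] zK by blast
  have v0: "v z0 \<ge> v z" using z0 zK by auto
  have max: "v w \<le> v z0" if "w \<in> S" for w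
    using that K(3)[of w] z0(2)[of w] v0 vz by (cases "w \<in> K") auto
  define E where "E = {w\<in>S. v w = v z0}"
  have "openin (top_of_set S) E"
  proof -
    have "open E" unfolding open_contains_ball
    proof
      fix w assume w: "w \<in> E"
      then have ws: "w \<in> S" and vw: "v w = v z0" by (auto simp: E_def)
      have "norm (f w) powr q > 0" using vw v0 vz Wnn[OF ws] unfolding v_def by linarith
      then have "f w \<noteq> 0" by auto
      from local_max_power_minus_harmonic[OF S(1) f W ws this, of q] obtain e where
        "e > 0" "ball w e \<subseteq> S" "\<And>z. z \<in> ball w e \<Longrightarrow> v z = v w"
        using max vw by (auto simp: v_def)
      then show "\<exists>e>0. ball w e \<subseteq> E" using vw by (auto simp: E_def intro!: exI[of _ e])
    qed
    then show ?thesis by (intro open_subset) (auto simp: E_def)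
  qed
  moreover have "closedin (top_of_set S) E"
    unfolding E_def using contv by (rule continuous_closedin_preimage_constant)
  ultimately have "E = {} \<or> E = S" using S(2) by (simp add: connected_clopen)
  moreover have "z0 \<in> E" using z0 K by (auto simp: E_def)
  ultimately have ES: "E = S" by auto
  have "S \<subseteq> K"
  proof
    fix w assume w: "w \<in> S"
    then have "v w = v z0" using ES by (auto simp: E_def)
    then show "w \<in> K" using K(3)[of w] w v0 vz by fastforce
  qed
  then have "compact S" using K by (simp add: subset_antisym)
  then show False using compact_open[of S] S(1) z by auto
qed

section \<open>Comparison with the Poisson integral\<close>

definition poisson :: "real \<Rightarrow> real \<Rightarrow> real" where
  "poisson y t = y / (pi * (t\<^sup>2 + y\<^sup>2))"

lemma poisson_measurable [measurable]: "poisson y \<in> borel_measurable borel"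
  unfolding poisson_def by measurable

lemma poisson_nonneg: "y > 0 \<Longrightarrow> 0 \<le> poisson y t"
  by (simp add: poisson_def)

lemma poisson_minus [simp]: "poisson y (- t) = poisson y t"
  by (simp add: poisson_def)

lemma poisson_commute: "poisson y (x - t) = poisson y (t - x)"
  by (simp add: poisson_def power2_commute)

lemma poisson_continuous: "y > 0 \<Longrightarrow> continuous_on A (poisson y)"
  unfolding poisson_def
  by (intro continuous_intros) (simp add: add_nonneg_pos less_imp_neq[symmetric])

lemma poisson_eq_Im: "y > 0 \<Longrightarrow> Im (1 / (of_real t - Complex x y)) = pi * poisson y (t - x)"
  by (simp add: poisson_def Im_divide power2_eq_square)

lemma DERIV_arctan_poisson:
  assumes "y > 0"
  shows "((\<lambda>t. arctan ((t - x) / y) / pi) has_real_derivative poisson y (t - x)) (at t within A)"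
proof -
  have "((\<lambda>t. arctan ((t - x) / y) / pi) has_real_derivative
      inverse (1 + ((t - x) / y)\<^sup>2) * (1 / y) / pi) (at t within A)"
    using assms by (auto intro!: derivative_eq_intros)
  also have "inverse (1 + ((t - x) / y)\<^sup>2) * (1 / y) / pi = poisson y (t - x)"
  proof -
    have "y\<^sup>2 + (t - x)\<^sup>2 > 0" using assms by (simp add: add_pos_nonneg)
    then show ?thesis using assms
      by (simp add: poisson_def field_simps power2_eq_square)
  qed
  finally show ?thesis .
qed

lemma filterlim_scaled_at_top:
  fixes x y :: real
  assumes "y > 0"
  shows "filterlim (\<lambda>N. (real N + x) / y) at_top sequentially"
proof -
  have "filterlim (\<lambda>N. x + real N) at_top sequentially"
    by (rule filterlim_tendsto_add_at_top[OF tendsto_const filterlim_real_sequentially])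
  then have "filterlim (\<lambda>N. (1 / y) * (x + real N)) at_top sequentially"
    by (rule filterlim_tendsto_pos_mult_at_top[OF tendsto_const, rotated]) (use assms in auto)
  then show ?thesis by (simp add: add.commute)
qed

lemma nn_integral_poisson:
  assumes "y > 0"
  shows "(\<integral>\<^sup>+t. ennreal (poisson y (t - x)) \<partial>lborel) = 1"
    and "(\<integral>\<^sup>+t. ennreal (poisson y (x - t)) \<partial>lborel) = 1"
proof -
  have half: "(\<integral>\<^sup>+t. ennreal (poisson y t) * indicator {0..} t \<partial>lborel) = ennreal (1 / 2)"
  proof (subst nn_integral_FTC_atLeast[where F = "\<lambda>t. arctan (t / y) / pi" and T = "(pi/2) / pi"])
    show "((\<lambda>t. arctan (t / y) / pi) \<longlongrightarrow> (pi/2) / pi) at_top"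
    proof (intro tendsto_divide tendsto_const filterlim_compose[OF tendsto_arctan_at_top])
      show "filterlim (\<lambda>t. t / y) at_top at_top"
        using filterlim_tendsto_pos_mult_at_top[OF tendsto_const[of "1/y"] _ filterlim_ident] assms by simp
    qed auto
    show "((\<lambda>t. arctan (t / y) / pi) has_real_derivative poisson y t) (at t)" for t
      using DERIV_arctan_poisson[OF assms, of 0] by simp
  qed (use assms in \<open>auto simp: poisson_nonneg\<close>)
  have half': "(\<integral>\<^sup>+t. ennreal (poisson y t) * indicator {..<0} t \<partial>lborel) = ennreal (1 / 2)"
  proof -
    have "(\<integral>\<^sup>+t. ennreal (poisson y t) * indicator {0..} t \<partial>lborel) =
        (\<integral>\<^sup>+t. ennreal (poisson y t) * indicator {0..} (- t) \<partial>lborel)"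
      by (subst nn_integral_real_affine[where c="-1" and t=0]) auto
    also have "\<dots> = (\<integral>\<^sup>+t. ennreal (poisson y t) * indicator {..<0} t \<partial>lborel)"
      by (intro nn_integral_cong_AE, use AE_lborel_singleton[of 0] in eventually_elim) (auto simp: indicator_def)
    finally show ?thesis using half by simp
  qed
  have full: "(\<integral>\<^sup>+t. ennreal (poisson y t) \<partial>lborel) = 1"
  proof -
    have "(\<integral>\<^sup>+t. ennreal (poisson y t) \<partial>lborel) =
      (\<integral>\<^sup>+t. ennreal (poisson y t) * indicator {0..} t + ennreal (poisson y t) * indicator {..<0} t \<partial>lborel)"
      by (intro nn_integral_cong) (auto simp: indicator_def)
    also have "\<dots> = ennreal (1/2) + ennreal (1/2)"
      by (subst nn_integral_add) (auto simp: half half')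
    also have "\<dots> = 1" by (subst ennreal_plus[symmetric]) auto
    finally show ?thesis .
  qed
  have "(\<integral>\<^sup>+t. ennreal (poisson y t) \<partial>lborel) = (\<integral>\<^sup>+t. ennreal (poisson y (t - x)) \<partial>lborel)"
    by (subst nn_integral_real_affine[where c=1 and t="-x"]) auto
  with full show "(\<integral>\<^sup>+t. ennreal (poisson y (t - x)) \<partial>lborel) = 1" by simp
  then show "(\<integral>\<^sup>+t. ennreal (poisson y (x - t)) \<partial>lborel) = 1" by (simp only: poisson_commute)
qed

lemma integral_poisson_interval:
  assumes "y > 0" "N \<ge> 0"
  shows "((\<lambda>t. poisson y (t - x)) has_integral (arctan ((N - x) / y) + arctan ((N + x) / y)) / pi) {-N..N}"
proof -
  have "((\<lambda>t. poisson y (t - x)) has_integral (arctan ((N - x) / y) / pi - arctan ((- N - x) / y) / pi)) {-N..N}"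
    using assms DERIV_arctan_poisson[OF assms(1), of x]
    by (intro fundamental_theorem_of_calculus) (auto simp: has_real_derivative_iff_has_vector_derivative[symmetric])
  moreover have "arctan ((- N - x) / y) = - arctan ((N + x) / y)"
    by (simp add: arctan_minus[symmetric] minus_divide_left del: arctan_minus)
  ultimately show ?thesis by (simp add: add_divide_distrib)
qed

lemma integral_poisson_interval_le:
  assumes "y > 0" "N \<ge> 0"
  shows "integral {-N..N} (\<lambda>t. poisson y (t - x)) \<le> 1"
proof -
  have "(arctan ((N - x) / y) + arctan ((N + x) / y)) / pi \<le> (pi / 2 + pi / 2) / pi"
    by (intro divide_right_mono add_mono less_imp_le arctan_ubound) auto
  then show ?thesis using integral_unique[OF integral_poisson_interval[OF assms, of x]] by simp
qed

lemma integral_poisson_interval_tendsto: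
  assumes "y > 0"
  shows "(\<lambda>N. integral {-real N..real N} (\<lambda>t. poisson y (t - x))) \<longlonglongrightarrow> 1"
proof -
  have "(\<lambda>N. (arctan ((real N - x) / y) + arctan ((real N + x) / y)) / pi) \<longlonglongrightarrow> (pi / 2 + pi / 2) / pi"
    using filterlim_scaled_at_top[OF assms, of x] filterlim_scaled_at_top[OF assms, of "-x"]
    by (intro tendsto_divide tendsto_add tendsto_const filterlim_compose[OF tendsto_arctan_at_top]) auto
  then show ?thesis
    by (simp add: integral_unique[OF integral_poisson_interval[OF assms]])
qed

text \<open>
  The comparison function is the Poisson integral of the boundary function that equals \<open>|F|\<^sup>q\<close> on
  \<open>[-N, N]\<close> and the bound \<open>S\<close> outside, written as \<open>S\<close> minus an integral over a compact interval.
  In this form it is visibly the real part of a holomorphic function and tends to \<open>S\<close> at infinity,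
  where the bound \<open>|F|\<^sup>q \<le> S\<close> then gives the comparison.
\<close>
lemma power_norm_le_poisson_truncated:
  fixes F :: "complex \<Rightarrow> complex"
  assumes cont: "continuous_on {z. Im z \<ge> 0} F" and holo: "F holomorphic_on upper_half_plane"
    and q: "q > 0" and S: "\<And>z. Im z \<ge> 0 \<Longrightarrow> norm (F z) powr q \<le> S"
    and y: "y > 0" and N: "N \<ge> 0"
  shows "norm (F (Complex x y)) powr q \<le>
     S - integral {-N..N} (\<lambda>t. (S - norm (F (Complex t 0)) powr q) * poisson y (t - x))"
proof -
  define \<psi> where "\<psi> t = S - norm (F (Complex t 0)) powr q" for t
  have Snn: "S \<ge> 0" by (rule order_trans[OF powr_ge_zero S[of 0]]) simp
  have \<psi>0: "0 \<le> \<psi> t" "\<psi> t \<le> S" for t using S[of "Complex t 0"] by (auto simp: \<psi>_def)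
  have contq: "continuous_on {z. Im z \<ge> 0} (\<lambda>z. norm (F z) powr q)"
    using cont q by (intro continuous_intros continuous_on_powr') auto
  have cont\<psi>: "continuous_on A \<psi>" for A
    unfolding \<psi>_def
    by (intro continuous_intros continuous_on_compose2[OF contq]) (auto simp: Complex_eq intro!: continuous_intros)
  define G where "G z = integral (cbox (-N) N) (\<lambda>t. complex_of_real (\<psi> t) / (of_real t - z))" for z
  define W where "W z = of_real S - 1 / (of_real pi * \<i>) * G z" for z
  have ne: "of_real t - z \<noteq> 0" if "z \<in> upper_half_plane" for t z
    using that by (auto simp: upper_half_plane_def complex_eq_iff)
  have intg: "(\<lambda>t. complex_of_real (\<psi> t) / (of_real t - z)) integrable_on cbox (-N) N" if "z \<in> upper_half_plane" for z
    using ne[OF that] by (intro integrable_continuous continuous_intros cont\<psi>) auto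
  have Gh: "G holomorphic_on upper_half_plane"
    unfolding G_def
  proof (rule leibniz_rule_holomorphic[where fx = "\<lambda>z t. complex_of_real (\<psi> t) / (of_real t - z)\<^sup>2"])
    fix z t assume "z \<in> upper_half_plane"
    then show "((\<lambda>z. complex_of_real (\<psi> t) / (of_real t - z)) has_field_derivative of_real (\<psi> t) / (of_real t - z)\<^sup>2)
        (at z within upper_half_plane)"
      using ne[of z t] by (auto intro!: derivative_eq_intros simp: power2_eq_square)
  next
    show "continuous_on (upper_half_plane \<times> cbox (- N) N) (\<lambda>(z, t). complex_of_real (\<psi> t) / (complex_of_real t - z)\<^sup>2)"
      unfolding case_prod_beta'
      by (intro continuous_intros continuous_on_compose2[OF cont\<psi>]) (auto simp: upper_half_plane_def)
  qed (use intg convex_upper_half_plane in auto)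
  have Wh: "W holomorphic_on upper_half_plane"
    unfolding W_def by (intro holomorphic_intros Gh) auto
  have ReW: "Re (W (Complex x y)) = S - integral {-N..N} (\<lambda>t. \<psi> t * poisson y (t - x))" if "y > 0" for x y
  proof -
    have "Im (G (Complex x y)) = integral (cbox (-N) N) (\<lambda>t. Im (complex_of_real (\<psi> t) / (of_real t - Complex x y)))"
      unfolding G_def using integral_linear[OF intg bounded_linear_Im, of "Complex x y"] that by (simp add: o_def)
    also have "\<dots> = integral {-N..N} (\<lambda>t. pi * (\<psi> t * poisson y (t - x)))"
      unfolding cbox_interval
    proof (rule integral_cong)
      fix t
      have "Im (of_real (\<psi> t) * (1 / (of_real t - Complex x y))) = \<psi> t * (pi * poisson y (t - x))"
        unfolding poisson_eq_Im[OF that, symmetric] by (simp only: Im_complex_of_real Re_complex_of_real times_complex.sel)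
      then show "Im (of_real (\<psi> t) / (of_real t - Complex x y)) = pi * (\<psi> t * poisson y (t - x))" by simp
    qed
    also have "\<dots> = pi * integral {-N..N} (\<lambda>t. \<psi> t * poisson y (t - x))" by simp
    finally have ImG: "Im (G (Complex x y)) = pi * integral {-N..N} (\<lambda>t. \<psi> t * poisson y (t - x))" .
    have "1 / (of_real pi * \<i>) * G (Complex x y) = of_real (1/pi) * (- \<i> * G (Complex x y))"
      by (simp add: field_simps)
    then have "Re (1 / (of_real pi * \<i>) * G (Complex x y)) = 1 / pi * Im (G (Complex x y))"
      by (simp only: Re_complex_of_real Im_complex_of_real times_complex.sel) simp
    then show ?thesis by (simp add: W_def ImG)
  qed
  have intP: "(\<lambda>t. poisson y (t - x)) integrable_on {-N..N}" if "y > 0" for x y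
    using integral_poisson_interval[OF that N] by blast
  have int\<psi>P: "(\<lambda>t. \<psi> t * poisson y (t - x)) integrable_on {-N..N}" if "y > 0" for x y
    by (intro integrable_continuous_interval continuous_intros cont\<psi> continuous_on_compose2[OF poisson_continuous[OF that, of UNIV]]) auto
  have bound1: "integral {-N..N} (\<lambda>t. \<psi> t * poisson y (t - x)) \<le> c + 2 * N * k"
    if "y > 0" "c \<ge> 0" and le: "\<And>t. t \<in> {-N..N} \<Longrightarrow> \<psi> t * poisson y (t - x) \<le> c * poisson y (t - x) + k" for x y c k
  proof -
    have "integral {-N..N} (\<lambda>t. \<psi> t * poisson y (t - x)) \<le> integral {-N..N} (\<lambda>t. c * poisson y (t - x) + k)"
      using that by (intro integral_le int\<psi>P integrable_add integrable_on_mult_right intP) auto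
    also have "\<dots> = c * integral {-N..N} (\<lambda>t. poisson y (t - x)) + 2 * N * k"
      using N that by (subst integral_add) (auto intro!: integrable_on_mult_right intP)
    also have "\<dots> \<le> c * 1 + 2 * N * k"
      using that N by (intro add_mono mult_left_mono integral_poisson_interval_le) auto
    finally show ?thesis by simp
  qed
  have "norm (F z) powr q \<le> Re (W z)" if z: "z \<in> upper_half_plane" for z
  proof (rule power_norm_le_harmonic[OF open_upper_half_plane _ holo Wh q _ _ z])
    show "connected upper_half_plane" by (rule convex_connected[OF convex_upper_half_plane])
    fix z assume "z \<in> upper_half_plane"
    then have z: "Im z > 0" by (simp add: upper_half_plane_def)
    have "integral {-N..N} (\<lambda>t. \<psi> t * poisson (Im z) (t - Re z)) \<le> S + 2 * N * 0"
      using \<psi>0 poisson_nonneg[OF z] by (intro bound1 z Snn) (auto intro: mult_right_mono)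
    then show "0 \<le> Re (W z)" using ReW[OF z, of "Re z"] by simp
  next
    fix \<eta> :: real assume \<eta>: "\<eta> > 0"
    \<comment> \<open>Outside the disc of radius \<open>R\<close> the kernel is at most \<open>1/(\<pi>(R - N))\<close> on \<open>[-N, N]\<close>, which makes the integral at most \<open>\<eta>\<close>.\<close>
    define R where "R = N + (2 * N * S / \<eta> + 1)"
    have RN: "R - N > 0" using N Snn \<eta> by (auto simp: R_def intro!: add_nonneg_pos)
    have Rb: "2 * N * (S / (pi * (R - N))) \<le> \<eta>"
    proof -
      have "2 * N * S \<le> \<eta> * (R - N)" using \<eta> by (simp add: R_def field_simps)
      also have "\<dots> \<le> \<eta> * (pi * (R - N))"
        using \<eta> RN pi_gt3 by (intro mult_left_mono) auto
      finally show ?thesis using RN by (simp add: field_simps)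
    qed
    define K' where "K' = cbox (Complex (-R-1) 0) (Complex (R+1) 1)"
    have "uniformly_continuous_on K' (\<lambda>z. norm (F z) powr q)"
      unfolding K'_def
      by (intro compact_uniformly_continuous continuous_on_subset[OF contq]) (auto simp: in_cbox_complex_iff)
    then obtain d' where d': "d' > 0" "\<And>z w. z \<in> K' \<Longrightarrow> w \<in> K' \<Longrightarrow> dist w z < d' \<Longrightarrow>
        dist (norm (F w) powr q) (norm (F z) powr q) < \<eta> / 4"
      using \<eta> by (auto elim!: uniformly_continuous_onE[of _ _ "\<eta> / 4"])
    define d where "d = min d' 1"
    have d: "d > 0" "d \<le> 1" "d \<le> d'" using d' by (auto simp: d_def)
    \<comment> \<open>Below height \<open>h\<close> the part of the integral with \<open>|t - x| \<ge> d\<close>, where the kernel is at most \<open>h/d\<^sup>2\<close>, is at most \<open>\<eta>/2\<close>.\<close>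
    define h where "h = min d (d\<^sup>2 * \<eta> / (2 * (2 * N * S + 1)))"
    have NS: "2 * N * S + 1 > 0" using N Snn by (intro add_nonneg_pos) auto
    have h: "h > 0" using d \<eta> NS by (simp add: h_def)
    define K where "K = {z. Im z \<ge> h} \<inter> cball 0 R"
    have "compact K" unfolding K_def by (intro closed_Int_compact closed_halfspace_Im_ge) auto
    moreover have "K \<subseteq> upper_half_plane" using h by (auto simp: K_def upper_half_plane_def)
    moreover have "norm (F z) powr q - Re (W z) \<le> \<eta>" if zK: "z \<in> upper_half_plane - K" for z
    proof -
      have Im: "Im z > 0" using zK by (simp add: upper_half_plane_def)
      have ReWz: "Re (W z) = S - integral {-N..N} (\<lambda>t. \<psi> t * poisson (Im z) (t - Re z))"
        using ReW[OF Im, of "Re z"] by simp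
      consider "norm z > R" | "norm z \<le> R" "Im z < h" using zK by (force simp: K_def)
      then show ?thesis
      proof cases
        case 1
        have "integral {-N..N} (\<lambda>t. \<psi> t * poisson (Im z) (t - Re z)) \<le> 0 + 2 * N * (S / (pi * (R - N)))"
        proof (rule bound1[OF Im order_refl])
          fix t assume t: "t \<in> {-N..N}"
          have "R - N \<le> norm (of_real t - z)"
            using 1 t norm_triangle_ineq2[of z "of_real t"] by (auto simp: norm_minus_commute)
          then have "norm (1 / (of_real t - z)) \<le> 1 / (R - N)"
            using RN by (simp add: norm_divide frac_le)
          moreover have "pi * poisson (Im z) (t - Re z) \<le> norm (1 / (of_real t - z))"
            using poisson_eq_Im[OF Im, of t "Re z"] abs_Im_le_cmod[of "1 / (of_real t - z)"] by simp
          ultimately have "pi * poisson (Im z) (t - Re z) \<le> 1 / (R - N)" by linarith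
          then have "pi * poisson (Im z) (t - Re z) / pi \<le> 1 / (R - N) / pi"
            by (rule divide_right_mono) simp
          then have "poisson (Im z) (t - Re z) \<le> 1 / (pi * (R - N))"
            by (simp add: mult.commute)
          then have "\<psi> t * poisson (Im z) (t - Re z) \<le> S * (1 / (pi * (R - N)))"
            using \<psi>0[of t] Snn poisson_nonneg[OF Im] by (intro mult_mono) auto
          then show "\<psi> t * poisson (Im z) (t - Re z) \<le> 0 * poisson (Im z) (t - Re z) + S / (pi * (R - N))" by simp
        qed
        then show ?thesis using Rb S[of z] Im unfolding ReWz by linarith
      next
        case 2
        define x where "x = Re z"
        have xR: "\<bar>x\<bar> \<le> R" using 2 abs_Re_le_cmod[of z] by (simp add: x_def)
        have hd: "Im z < d" using 2 by (simp add: h_def)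
        have inK: "Complex s 0 \<in> K'" if "\<bar>s - x\<bar> < d" for s
          using that xR d RN N unfolding K'_def in_cbox_complex_iff by auto
        have "z \<in> K'" using xR hd d Im unfolding K'_def in_cbox_complex_iff x_def by auto
        moreover have "dist z (Complex x 0) < d'"
        proof -
          have "z - Complex x 0 = Complex 0 (Im z)" by (simp add: complex_eq_iff x_def)
          then have "dist z (Complex x 0) = norm (Complex 0 (Im z))" by (simp add: dist_norm)
          also have "\<dots> = Im z" using Im by (simp add: cmod_def)
          finally show ?thesis using hd d by simp
        qed
        moreover have x0: "Complex x 0 \<in> K'" using inK[of x] d by simp
        ultimately have "\<bar>norm (F z) powr q - norm (F (Complex x 0)) powr q\<bar> < \<eta> / 4"
          using d'(2)[of "Complex x 0" z] by (simp add: dist_real_def)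
        then have near: "norm (F z) powr q \<le> S - \<psi> x + \<eta> / 4"
          unfolding \<psi>_def abs_less_iff by linarith
        have \<psi>near: "\<psi> t \<le> \<psi> x + \<eta> / 4" if "\<bar>t - x\<bar> < d" for t
        proof -
          have "dist (Complex t 0) (Complex x 0) < d'"
            using that d by (simp add: dist_norm cmod_def)
          then have "\<bar>norm (F (Complex t 0)) powr q - norm (F (Complex x 0)) powr q\<bar> < \<eta> / 4"
            using d'(2)[OF x0 inK[OF that]] by (simp add: dist_real_def)
          then show ?thesis
            unfolding \<psi>_def abs_less_iff by linarith
        qed
        have "integral {-N..N} (\<lambda>t. \<psi> t * poisson (Im z) (t - x)) \<le> (\<psi> x + \<eta> / 4) + 2 * N * (S * (h / d\<^sup>2))"
        proof (rule bound1[OF Im])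
          show "0 \<le> \<psi> x + \<eta> / 4" using \<psi>0[of x] \<eta> by simp
          fix t
          show "\<psi> t * poisson (Im z) (t - x) \<le> (\<psi> x + \<eta> / 4) * poisson (Im z) (t - x) + S * (h / d\<^sup>2)"
          proof (cases "\<bar>t - x\<bar> < d")
            case True
            then have "\<psi> t * poisson (Im z) (t - x) \<le> (\<psi> x + \<eta> / 4) * poisson (Im z) (t - x)"
              using \<psi>near poisson_nonneg[OF Im] by (intro mult_right_mono) auto
            moreover have "S * (h / d\<^sup>2) \<ge> 0" using Snn h by simp
            ultimately show ?thesis by linarith
          next
            case False
            then have "d\<^sup>2 \<le> (t - x)\<^sup>2" using d abs_le_square_iff[of d "t - x"] by simp
            then have "d\<^sup>2 \<le> (t - x)\<^sup>2 + (Im z)\<^sup>2" by (simp add: add_increasing2)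
            then have "1 * d\<^sup>2 \<le> pi * ((t - x)\<^sup>2 + (Im z)\<^sup>2)" using pi_gt3 by (intro mult_mono) auto
            then have "poisson (Im z) (t - x) \<le> h / d\<^sup>2"
              unfolding poisson_def using 2 Im d by (intro frac_le) auto
            then have "\<psi> t * poisson (Im z) (t - x) \<le> S * (h / d\<^sup>2)"
              using \<psi>0[of t] Snn poisson_nonneg[OF Im] by (intro mult_mono) auto
            moreover have "0 \<le> (\<psi> x + \<eta> / 4) * poisson (Im z) (t - x)"
              using \<psi>0[of x] \<eta> poisson_nonneg[OF Im] by (intro mult_nonneg_nonneg) auto
            ultimately show ?thesis by linarith
          qed
        qed
        moreover have "2 * N * (S * (h / d\<^sup>2)) \<le> \<eta> / 2"
        proof -
          have "h \<le> d\<^sup>2 * \<eta> / (2 * (2 * N * S + 1))" by (simp add: h_def)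
          then have "h * (2 * (2 * N * S + 1)) \<le> d\<^sup>2 * \<eta>" using NS by (simp add: pos_le_divide_eq)
          moreover have "2 * (2 * N * S * h) \<le> h * (2 * (2 * N * S + 1))" using h by (simp add: algebra_simps)
          ultimately have "2 * (2 * N * S * h) \<le> d\<^sup>2 * \<eta>" by linarith
          then show ?thesis using d by (simp add: field_simps)
        qed
        ultimately show ?thesis using near unfolding ReWz x_def[symmetric] by linarith
      qed
    qed
    ultimately show "\<exists>K. compact K \<and> K \<subseteq> upper_half_plane \<and>
        (\<forall>z\<in>upper_half_plane - K. norm (F z) powr q - Re (W z) \<le> \<eta>)" by blast
  qed
  from this[of "Complex x y"] y show ?thesis by (simp add: ReW \<psi>_def)
qed

lemma power_norm_le_poisson_integral:
  fixes F :: "complex \<Rightarrow> complex"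
  assumes cont: "continuous_on {z. Im z \<ge> 0} F" and holo: "F holomorphic_on upper_half_plane"
    and q: "q > 0" and S: "\<And>z. Im z \<ge> 0 \<Longrightarrow> norm (F z) powr q \<le> S"
    and y: "y > 0"
  shows "ennreal (norm (F (Complex x y)) powr q) \<le>
     (\<integral>\<^sup>+t. ennreal (poisson y (x - t)) * ennreal (norm (F (Complex t 0)) powr q) \<partial>lborel)" (is "_ \<le> ?I")
proof -
  define \<phi> where "\<phi> t = norm (F (Complex t 0)) powr q" for t
  have contq: "continuous_on {z. Im z \<ge> 0} (\<lambda>z. norm (F z) powr q)"
    using cont q by (intro continuous_intros continuous_on_powr') auto
  have cont\<phi>: "continuous_on A \<phi>" for A
    unfolding \<phi>_def
    by (intro continuous_on_compose2[OF contq]) (auto simp: Complex_eq intro!: continuous_intros)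
  have contP: "continuous_on A (\<lambda>t. poisson y (t - x))" for A
    by (intro continuous_on_compose2[OF poisson_continuous[OF y, of UNIV]] continuous_intros) auto
  define J where "J N = integral {-real N..real N} (\<lambda>t. poisson y (t - x))" for N
  have "ennreal (norm (F (Complex x y)) powr q) \<le> ennreal (S * (1 - J N)) + ?I" for N
  proof -
    have cP: "(\<lambda>t. poisson y (t - x)) integrable_on {-real N..real N}"
      and cphiP: "(\<lambda>t. \<phi> t * poisson y (t - x)) integrable_on {-real N..real N}"
      by (intro integrable_continuous_interval continuous_intros cont\<phi> contP)+
    have "norm (F (Complex x y)) powr q \<le> S - integral {-real N..real N} (\<lambda>t. (S - \<phi> t) * poisson y (t - x))"
      unfolding \<phi>_def by (rule power_norm_le_poisson_truncated[OF assms]) auto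
    also have "\<dots> = S * (1 - J N) + integral {-real N..real N} (\<lambda>t. \<phi> t * poisson y (t - x))"
      using cP cphiP by (simp add: left_diff_distrib integral_diff J_def right_diff_distrib integrable_on_mult_right)
    finally have "ennreal (norm (F (Complex x y)) powr q) \<le>
        ennreal (S * (1 - J N) + integral {-real N..real N} (\<lambda>t. \<phi> t * poisson y (t - x)))" by (rule ennreal_leI)
    also have "\<dots> \<le> ennreal (S * (1 - J N)) + ennreal (integral {-real N..real N} (\<lambda>t. \<phi> t * poisson y (t - x)))"
    proof -
      have "J N \<le> 1" unfolding J_def by (rule integral_poisson_interval_le[OF y]) simp
      moreover have "S \<ge> 0" by (rule order_trans[OF powr_ge_zero S[of 0]]) simp
      ultimately have a: "S * (1 - J N) \<ge> 0" by simp
      have b: "integral {-real N..real N} (\<lambda>t. \<phi> t * poisson y (t - x)) \<ge> 0"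
        by (intro integral_nonneg cphiP) (auto simp: \<phi>_def poisson_nonneg[OF y])
      from a b show ?thesis by simp
    qed
    also have "ennreal (integral {-real N..real N} (\<lambda>t. \<phi> t * poisson y (t - x))) =
       (\<integral>\<^sup>+t. ennreal (indicator {-real N..real N} t * (\<phi> t * poisson y (t - x))) \<partial>lborel)"
      by (rule nn_integral_has_integral_lebesgue[OF _ integrable_integral[OF cphiP], symmetric])
         (auto simp: \<phi>_def poisson_nonneg[OF y])
    also have "\<dots> \<le> ?I"
      by (intro nn_integral_mono)
         (auto simp: indicator_def \<phi>_def poisson_commute[of y x] poisson_nonneg[OF y] ennreal_mult'[symmetric] mult.commute)
    finally show ?thesis by simp
  qed
  moreover have "(\<lambda>N. ennreal (S * (1 - J N)) + ?I) \<longlonglongrightarrow> ennreal (S * (1 - 1)) + ?I"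
    unfolding J_def using integral_poisson_interval_tendsto[OF y, of x]
    by (intro tendsto_add tendsto_const tendsto_ennrealI tendsto_intros)
  ultimately have "ennreal (norm (F (Complex x y)) powr q) \<le> ennreal (S * (1 - 1)) + ?I"
    by (intro LIMSEQ_le_const) auto
  then show ?thesis by simp
qed

section \<open>Boundary values of Hardy functions\<close>

lemma filterlim_vertical_approach:
  assumes "\<And>y. y > 0 \<Longrightarrow> Complex x y \<in> S"
  shows "filterlim (\<lambda>y. Complex x y) (at (complex_of_real x) within S) (at_right 0)"
  unfolding filterlim_at
proof
  show "\<forall>\<^sub>F y in at_right 0. Complex x y \<in> S \<and> Complex x y \<noteq> complex_of_real x"
    using assms by (auto simp: eventually_at_filter complex_eq_iff)
  have "((\<lambda>y. of_real x + \<i> * of_real y) \<longlongrightarrow> of_real x + \<i> * of_real 0) (at_right 0)"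
    by (intro tendsto_intros)
  also have "(\<lambda>y. of_real x + \<i> * of_real y) = Complex x"
    by (auto simp: fun_eq_iff complex_eq_iff)
  finally show "(Complex x \<longlongrightarrow> complex_of_real x) (at_right 0)" by (simp add: complex_of_real_def)
qed

lemma nontangential_imp_vertical_limit:
  assumes "nontangential_limit f x w"
  shows "((\<lambda>y. f (Complex x y)) \<longlongrightarrow> w) (at_right 0)"
proof -
  have "(f \<longlongrightarrow> w) (at (complex_of_real x) within {z. \<bar>Re z - x\<bar> < 1 * Im z})"
    using assms unfolding nontangential_limit_def by (metis zero_less_one)
  then show ?thesis
    by (rule filterlim_compose) (rule filterlim_vertical_approach, simp)
qed

lemma filterlim_inverse_Suc_at_right: "filterlim (\<lambda>n. 1 / real (Suc n)) (at_right 0) sequentially"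
  unfolding filterlim_at using LIMSEQ_inverse_real_of_nat by (auto simp: inverse_eq_divide)

lemma le_one_plus_powr: "t \<le> 1 + t powr p" if "t \<ge> 0" "1 \<le> p" for t p :: real
proof (cases "t \<le> 1")
  case False
  then have "t powr 1 \<le> t powr p" using that by (intro powr_mono) auto
  then show ?thesis using False by simp
qed (simp add: add_increasing2)

text \<open>
  A boundary function is determined only almost everywhere and need not be Borel measurable; the limit along
  one fixed sequence of heights is a Borel representative.
\<close>
lemma vertical_limit_measurable_representative:
  fixes f :: "complex \<Rightarrow> complex"
  assumes f: "continuous_on upper_half_plane f"
    and lim: "AE x in lborel. ((\<lambda>y. f (Complex x y)) \<longlongrightarrow> g x) (at_right 0)"
  obtains u where "u \<in> borel_measurable borel" "AE x in lborel. u x = g x"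
    "AE x in lborel. ((\<lambda>y. f (Complex x y)) \<longlongrightarrow> u x) (at_right 0)"
proof -
  define u where "u x = lim (\<lambda>n. f (Complex x (1 / real (Suc n))))" for x
  have meas: "u \<in> borel_measurable borel"
    unfolding u_def
    by (intro borel_measurable_lim_metric horizontal_slice_measurable[OF f]) auto
  have eq: "AE x in lborel. u x = g x"
    using lim
  proof eventually_elim
    case (elim x)
    from filterlim_compose[OF elim filterlim_inverse_Suc_at_right] show ?case unfolding u_def by (rule limI)
  qed
  show ?thesis
  proof (rule that[OF meas eq])
    show "AE x in lborel. ((\<lambda>y. f (Complex x y)) \<longlongrightarrow> u x) (at_right 0)"
      using lim eq by eventually_elim simp
  qed
qed

lemma powr_half_square: "(x powr (p / 2))\<^sup>2 = x powr p" if "x \<ge> 0" for x p :: real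
  by (simp add: power2_eq_square powr_add[symmetric])

text \<open>
  The Poisson comparison applied to \<open>f(\<sqdot> + i e\<^sub>n)\<close> with \<open>e\<^sub>n \<rightarrow> 0\<close>. To pass to the limit under the integral, cut
  \<open>s\<^sub>n = |f(\<sqdot> + i e\<^sub>n)|\<^sup>p\<^sup>/\<^sup>2\<close> at a level \<open>l\<close>: the part below converges by dominated convergence, and the
  excess is at most \<open>s\<^sub>n\<^sup>2 / l = |f(\<sqdot> + i e\<^sub>n)|\<^sup>p / l\<close>, whose integral is \<open>O(1/l)\<close> uniformly in \<open>n\<close>.
\<close>
lemma hardy_le_poisson_boundary:
  assumes f: "f \<in> hardy p" and p: "1 \<le> p" and [measurable]: "u \<in> borel_measurable borel"
    and lim: "AE x in lborel. ((\<lambda>y. f (Complex x y)) \<longlongrightarrow> u x) (at_right 0)"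
    and y: "y > 0"
  shows "ennreal (norm (f (Complex x y)) powr (p / 2)) \<le>
     (\<integral>\<^sup>+t. ennreal (poisson y (x - t)) * ennreal (norm (u t) powr (p / 2)) \<partial>lborel)" (is "_ \<le> ?I")
proof -
  define q where "q = p / 2"
  have q: "q > 0" using p by (simp add: q_def)
  define e where "e n = 1 / real (Suc n)" for n
  have e0: "e n > 0" for n by (simp add: e_def)
  have e: "filterlim e (at_right 0) sequentially"
    unfolding e_def by (rule filterlim_inverse_Suc_at_right)
  obtain K where K: "K \<ge> 0" "\<And>y. y > 0 \<Longrightarrow> (\<integral>\<^sup>+x. ennreal (norm (f (Complex x y)) powr p) \<partial>lborel) \<le> ennreal K"
    using hardy_slice_bound[OF f] by blast
  have fcont: "continuous_on upper_half_plane f"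
    by (intro holomorphic_on_imp_continuous_on hardy_holomorphic[OF f])
  define s where "s n t = norm (f (Complex t (e n))) powr q" for n t
  have [measurable]: "s n \<in> borel_measurable borel" for n
    unfolding s_def using hardy_slice_measurable[OF f e0[of n]] by simp
  have step: "ennreal (norm (f (Complex x (y + e n))) powr q) \<le>
     (\<integral>\<^sup>+t. ennreal (poisson y (x - t)) * ennreal (s n t) \<partial>lborel)" for n
  proof -
    define F where "F z = f (z + \<i> * of_real (e n))" for z
    obtain B where B: "B \<ge> 0" "\<And>z. Im z \<ge> e n \<Longrightarrow> norm (f z) \<le> B"
      using hardy_bounded[OF f p e0[of n]] by blast
    have FC: "F (Complex a b) = f (Complex a (b + e n))" for a b
      by (simp add: F_def Complex_eq algebra_simps)
    have "ennreal (norm (F (Complex x y)) powr q) \<le>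
       (\<integral>\<^sup>+t. ennreal (poisson y (x - t)) * ennreal (norm (F (Complex t 0)) powr q) \<partial>lborel)"
    proof (rule power_norm_le_poisson_integral[OF _ _ q _ y])
      show "continuous_on {z. 0 \<le> Im z} F"
        unfolding F_def by (intro continuous_on_compose2[OF fcont] continuous_intros)
          (use e0[of n] in \<open>auto simp: upper_half_plane_def\<close>)
      show "F holomorphic_on upper_half_plane"
        unfolding F_def
        by (intro holomorphic_on_compose_gen[OF _ hardy_holomorphic[OF f], unfolded o_def] holomorphic_intros)
          (use e0[of n] in \<open>auto simp: upper_half_plane_def\<close>)
      show "norm (F z) powr q \<le> B powr q" if "0 \<le> Im z" for z
        unfolding F_def using that q e0[of n] by (intro powr_mono2 B) auto
    qed
    then show ?thesis by (simp add: FC s_def)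
  qed
  have Pbound: "poisson y t \<le> 1 / (pi * y)" for t
  proof -
    have "y / (pi * (t\<^sup>2 + y\<^sup>2)) \<le> y / (pi * y\<^sup>2)"
      using y by (intro divide_left_mono mult_left_mono mult_pos_pos) (auto simp: add_nonneg_pos)
    then show ?thesis using y by (simp add: poisson_def power2_eq_square)
  qed
  have "ennreal (norm (f (Complex x y)) powr q) \<le> ?I + ennreal (K / (pi * y * l))" if l: "l > 0" for l
  proof -
    have split: "(\<integral>\<^sup>+t. ennreal (poisson y (x - t)) * ennreal (s n t) \<partial>lborel) \<le>
       (\<integral>\<^sup>+t. ennreal (poisson y (x - t)) * ennreal (min (s n t) l) \<partial>lborel) + ennreal (K / (pi * y * l))" for n
    proof -
      have pw: "ennreal (poisson y (x - t)) * ennreal (s n t) \<le>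
         ennreal (poisson y (x - t)) * ennreal (min (s n t) l) + ennreal (1 / (pi * y * l)) * ennreal (norm (f (Complex t (e n))) powr p)" for t
      proof -
        have sn: "s n t \<ge> 0" by (simp add: s_def)
        have "s n t \<le> min (s n t) l + (s n t)\<^sup>2 / l"
        proof (cases "s n t \<le> l")
          case False
          then have "l * s n t \<le> s n t * s n t" using sn by (intro mult_right_mono) auto
          then have "s n t \<le> (s n t)\<^sup>2 / l" using l by (simp add: field_simps power2_eq_square)
          then show ?thesis using False l by simp
        qed (use l in auto)
        then have "poisson y (x - t) * s n t \<le> poisson y (x - t) * (min (s n t) l + (s n t)\<^sup>2 / l)"
          using poisson_nonneg[OF y] by (rule mult_left_mono)
        also have "\<dots> = poisson y (x - t) * min (s n t) l + poisson y (x - t) * ((s n t)\<^sup>2 / l)"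
          by (simp add: distrib_left)
        also have "\<dots> \<le> poisson y (x - t) * min (s n t) l + 1 / (pi * y) * ((s n t)\<^sup>2 / l)"
          using l by (intro add_left_mono mult_right_mono Pbound) auto
        also have "(s n t)\<^sup>2 = norm (f (Complex t (e n))) powr p"
          by (simp add: s_def q_def powr_half_square)
        finally have "ennreal (poisson y (x - t) * s n t) \<le> ennreal (poisson y (x - t) * min (s n t) l + 
            1 / (pi * y * l) * norm (f (Complex t (e n))) powr p)" by (intro ennreal_leI) simp
        also have "\<dots> = ennreal (poisson y (x - t) * min (s n t) l) + ennreal (1 / (pi * y * l) * norm (f (Complex t (e n))) powr p)"
          using y l sn poisson_nonneg[OF y] by (intro ennreal_plus) auto
        also have "ennreal (poisson y (x - t) * min (s n t) l) = ennreal (poisson y (x - t)) * ennreal (min (s n t) l)"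
          using poisson_nonneg[OF y] by (rule ennreal_mult')
        also have "ennreal (1 / (pi * y * l) * norm (f (Complex t (e n))) powr p) = ennreal (1 / (pi * y * l)) * ennreal (norm (f (Complex t (e n))) powr p)"
          by (rule ennreal_mult'') simp
        also have "ennreal (poisson y (x - t) * s n t) = ennreal (poisson y (x - t)) * ennreal (s n t)"
          using poisson_nonneg[OF y] by (rule ennreal_mult')
        finally show ?thesis .
      qed
      have [measurable]: "(\<lambda>t. f (Complex t (e n))) \<in> borel_measurable borel"
        by (rule hardy_slice_measurable[OF f e0])
      have "(\<integral>\<^sup>+t. ennreal (poisson y (x - t)) * ennreal (s n t) \<partial>lborel) \<le>
        (\<integral>\<^sup>+t. ennreal (poisson y (x - t)) * ennreal (min (s n t) l) + ennreal (1 / (pi * y * l)) * ennreal (norm (f (Complex t (e n))) powr p) \<partial>lborel)"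
        by (intro nn_integral_mono pw)
      also have "\<dots> = (\<integral>\<^sup>+t. ennreal (poisson y (x - t)) * ennreal (min (s n t) l) \<partial>lborel) + 
          ennreal (1 / (pi * y * l)) * (\<integral>\<^sup>+t. ennreal (norm (f (Complex t (e n))) powr p) \<partial>lborel)"
        by (subst nn_integral_add) (auto simp: nn_integral_cmult)
      also have "\<dots> \<le> (\<integral>\<^sup>+t. ennreal (poisson y (x - t)) * ennreal (min (s n t) l) \<partial>lborel) + 
          ennreal (1 / (pi * y * l)) * ennreal K"
        by (intro add_left_mono mult_left_mono K e0) auto
      also have "ennreal (1 / (pi * y * l)) * ennreal K = ennreal (K / (pi * y * l))"
        using y l K by (simp flip: ennreal_mult')
      finally show ?thesis .
    qed
    have conv: "(\<lambda>n. \<integral>\<^sup>+t. ennreal (poisson y (x - t)) * ennreal (min (s n t) l) \<partial>lborel) \<longlonglongrightarrow>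
       (\<integral>\<^sup>+t. ennreal (poisson y (x - t)) * ennreal (min (norm (u t) powr q) l) \<partial>lborel)"
    proof (rule nn_integral_dominated_convergence[where w = "\<lambda>t. ennreal (poisson y (x - t)) * ennreal l"])
      show "(\<integral>\<^sup>+t. ennreal (poisson y (x - t)) * ennreal l \<partial>lborel) < \<infinity>"
        by (subst nn_integral_multc) (auto simp: nn_integral_poisson[OF y])
      show "AE t in lborel. ennreal (poisson y (x - t)) * ennreal (min (s n t) l) \<le> ennreal (poisson y (x - t)) * ennreal l" for n
        by (intro AE_I2 mult_left_mono ennreal_leI) auto
      show "AE t in lborel. (\<lambda>n. ennreal (poisson y (x - t)) * ennreal (min (s n t) l)) \<longlonglongrightarrow>
          ennreal (poisson y (x - t)) * ennreal (min (norm (u t) powr q) l)"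
        using lim
      proof eventually_elim
        case (elim t)
        have "(\<lambda>n. f (Complex t (e n))) \<longlonglongrightarrow> u t" using filterlim_compose[OF elim e] .
        then have "(\<lambda>n. s n t) \<longlonglongrightarrow> norm (u t) powr q"
          unfolding s_def using q by (intro tendsto_powr' tendsto_norm tendsto_const) auto
        then show ?case by (intro tendsto_mult_ennreal tendsto_const tendsto_ennrealI tendsto_min) auto
      qed
    qed auto
    have conv2: "(\<lambda>n. ennreal (norm (f (Complex x (y + e n))) powr q)) \<longlonglongrightarrow> ennreal (norm (f (Complex x y)) powr q)"
    proof -
      have "continuous (at (Complex x y)) f"
        using fcont open_upper_half_plane y by (simp add: continuous_on_eq_continuous_at)
      moreover have "(\<lambda>n. Complex x (y + e n)) \<longlonglongrightarrow> Complex x y"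
      proof -
        have "e \<longlonglongrightarrow> 0" using e unfolding filterlim_at by auto
        then have "(\<lambda>n. of_real x + \<i> * of_real (y + e n)) \<longlonglongrightarrow> of_real x + \<i> * of_real (y + 0)"
          by (intro tendsto_intros)
        then show ?thesis by (simp add: Complex_eq)
      qed
      ultimately have "(\<lambda>n. f (Complex x (y + e n))) \<longlonglongrightarrow> f (Complex x y)"
        by (rule isCont_tendsto_compose)
      then show ?thesis
        using q by (intro tendsto_ennrealI tendsto_powr' tendsto_norm tendsto_const) auto
    qed
    have "ennreal (norm (f (Complex x y)) powr q) \<le>
        (\<integral>\<^sup>+t. ennreal (poisson y (x - t)) * ennreal (min (norm (u t) powr q) l) \<partial>lborel) + ennreal (K / (pi * y * l))"
      by (rule LIMSEQ_le[OF conv2 tendsto_add[OF conv tendsto_const]])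
         (use order_trans[OF step split] in auto)
    also have "\<dots> \<le> ?I + ennreal (K / (pi * y * l))"
      unfolding q_def by (intro add_right_mono nn_integral_mono mult_left_mono ennreal_leI) auto
    finally show ?thesis .
  qed note ineq = this
  have "(\<lambda>n. ?I + ennreal (K / (pi * y * real (Suc n)))) \<longlonglongrightarrow> ?I + ennreal 0"
  proof (intro tendsto_add tendsto_const tendsto_ennrealI)
    have "(\<lambda>n. K / (pi * y) * inverse (real (Suc n))) \<longlonglongrightarrow> K / (pi * y) * 0"
      by (intro tendsto_mult tendsto_const LIMSEQ_inverse_real_of_nat)
    then show "(\<lambda>n. K / (pi * y * real (Suc n))) \<longlonglongrightarrow> 0" by (simp add: field_simps)
  qed
  then have "ennreal (norm (f (Complex x y)) powr q) \<le> ?I + ennreal 0"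
    by (rule LIMSEQ_le_const) (use ineq in auto)
  then show ?thesis by (simp add: q_def)
qed

text \<open>
  Square the Poisson inequality, use Cauchy--Schwarz with respect to the probability density \<open>P\<^sub>y\<close>, and
  integrate in \<open>x\<close>. The constant \<open>1\<close> matters: Scheffe's lemma below requires the norms not to exceed
  the norm of the limit.
\<close>
lemma hardy_slice_le_boundary:
  assumes f: "f \<in> hardy p" and p: "1 \<le> p" and [measurable]: "u \<in> borel_measurable borel"
    and lim: "AE x in lborel. ((\<lambda>y. f (Complex x y)) \<longlongrightarrow> u x) (at_right 0)"
    and y: "y > 0"
  shows "(\<integral>\<^sup>+x. ennreal (norm (f (Complex x y)) powr p) \<partial>lborel) \<le> (\<integral>\<^sup>+t. ennreal (norm (u t) powr p) \<partial>lborel)"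
proof -
  define g where "g t = norm (u t) powr (p / 2)" for t
  have [measurable]: "g \<in> borel_measurable borel" unfolding g_def by measurable
  have g2: "(g t)\<^sup>2 = norm (u t) powr p" for t by (simp add: g_def powr_half_square)
  have pw: "ennreal (norm (f (Complex x y)) powr p) \<le>
     (\<integral>\<^sup>+t. ennreal (poisson y (x - t)) * ennreal (norm (u t) powr p) \<partial>lborel)" for x
  proof -
    have "ennreal (norm (f (Complex x y)) powr p) = (ennreal (norm (f (Complex x y)) powr (p/2)))\<^sup>2"
      by (simp add: ennreal_power powr_half_square)
    also have "\<dots> \<le> (\<integral>\<^sup>+t. ennreal (poisson y (x - t)) * ennreal (g t) \<partial>lborel)\<^sup>2"
      unfolding g_def by (intro power_mono hardy_le_poisson_boundary[OF f p _ lim y]) auto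
    also have "(\<integral>\<^sup>+t. ennreal (poisson y (x - t)) * ennreal (g t) \<partial>lborel) =
       (\<integral>\<^sup>+t. ennreal (sqrt (poisson y (x - t))) * ennreal (sqrt (poisson y (x - t)) * g t) \<partial>lborel)"
      using poisson_nonneg[OF y] by (intro nn_integral_cong) (simp add: ennreal_mult'[symmetric] mult.assoc[symmetric])
    also have "\<dots>\<^sup>2 \<le> (\<integral>\<^sup>+t. (ennreal (sqrt (poisson y (x - t))))\<^sup>2 \<partial>lborel) *
         (\<integral>\<^sup>+t. (ennreal (sqrt (poisson y (x - t)) * g t))\<^sup>2 \<partial>lborel)"
      by (rule Cauchy_Schwarz_nn_integral) measurable
    also have "(\<integral>\<^sup>+t. (ennreal (sqrt (poisson y (x - t))))\<^sup>2 \<partial>lborel) = 1"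
      using poisson_nonneg[OF y] nn_integral_poisson(2)[OF y, of x] by (simp add: ennreal_power)
    also have "(\<integral>\<^sup>+t. (ennreal (sqrt (poisson y (x - t)) * g t))\<^sup>2 \<partial>lborel) =
       (\<integral>\<^sup>+t. ennreal (poisson y (x - t)) * ennreal (norm (u t) powr p) \<partial>lborel)"
      using poisson_nonneg[OF y]
      by (intro nn_integral_cong) (simp add: ennreal_power power_mult_distrib g2 g_def ennreal_mult'[symmetric] powr_half_square)
    finally show ?thesis by simp
  qed
  have "(\<integral>\<^sup>+x. ennreal (norm (f (Complex x y)) powr p) \<partial>lborel) \<le>
     (\<integral>\<^sup>+x. \<integral>\<^sup>+t. ennreal (poisson y (x - t)) * ennreal (norm (u t) powr p) \<partial>lborel \<partial>lborel)"
    by (intro nn_integral_mono pw)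
  also have "\<dots> = (\<integral>\<^sup>+t. \<integral>\<^sup>+x. ennreal (poisson y (x - t)) * ennreal (norm (u t) powr p) \<partial>lborel \<partial>lborel)"
    by (rule lborel_pair.Fubini'[symmetric]) measurable
  also have "\<dots> = (\<integral>\<^sup>+t. ennreal (norm (u t) powr p) \<partial>lborel)"
    by (simp add: nn_integral_multc nn_integral_poisson[OF y])
  finally show ?thesis .
qed

text \<open>
  Fatou's lemma along a sequence of heights tending to \<open>0\<close>.
\<close>
lemma hardy_boundary_power_integrable:
  assumes f: "f \<in> hardy p" and p: "1 \<le> p" and [measurable]: "u \<in> borel_measurable borel"
    and lim: "AE x in lborel. ((\<lambda>y. f (Complex x y)) \<longlongrightarrow> u x) (at_right 0)"
  shows "integrable lborel (\<lambda>x. norm (u x) powr p)"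
proof (rule integrableI_bounded)
  define e where "e n = 1 / real (Suc n)" for n
  have e0: "e n > 0" for n by (simp add: e_def)
  have e: "filterlim e (at_right 0) sequentially"
    unfolding e_def by (rule filterlim_inverse_Suc_at_right)
  obtain K where K: "K \<ge> 0" "\<And>y. y > 0 \<Longrightarrow> (\<integral>\<^sup>+x. ennreal (norm (f (Complex x y)) powr p) \<partial>lborel) \<le> ennreal K"
    using hardy_slice_bound[OF f] by blast
  have [measurable]: "(\<lambda>t. f (Complex t (e n))) \<in> borel_measurable borel" for n
    by (rule hardy_slice_measurable[OF f e0])
  have "(\<integral>\<^sup>+x. ennreal (norm (u x) powr p) \<partial>lborel) =
      (\<integral>\<^sup>+x. liminf (\<lambda>n. ennreal (norm (f (Complex x (e n))) powr p)) \<partial>lborel)"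
  proof (rule nn_integral_cong_AE, use lim in eventually_elim)
    case (elim x)
    have "(\<lambda>n. ennreal (norm (f (Complex x (e n))) powr p)) \<longlonglongrightarrow> ennreal (norm (u x) powr p)"
      using p filterlim_compose[OF elim e] by (intro tendsto_ennrealI tendsto_powr' tendsto_norm tendsto_const) auto
    then show ?case by (rule lim_imp_Liminf[OF trivial_limit_sequentially, symmetric])
  qed
  also have "\<dots> \<le> liminf (\<lambda>n. \<integral>\<^sup>+x. ennreal (norm (f (Complex x (e n))) powr p) \<partial>lborel)"
    by (rule nn_integral_liminf) measurable
  also have "\<dots> \<le> liminf (\<lambda>n::nat. ennreal K)"
    by (intro Liminf_mono always_eventually allI K e0)
  also have "\<dots> = ennreal K" by (simp add: Liminf_const)
  also have "\<dots> < \<infinity>" by simp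
  finally show "(\<integral>\<^sup>+x. ennreal (norm (norm (u x) powr p)) \<partial>lborel) < \<infinity>" by simp
qed measurable

text \<open>
  Scheffe's lemma gives convergence of \<open>|f(\<sqdot> + iy)|\<^sup>p\<close> to \<open>|u|\<^sup>p\<close> in \<open>L\<^sup>1\<close>. Its error \<open>d\<close> controls how far
  \<open>|f(\<sqdot> + iy) - u|\<close> can exceed the fixed function \<open>w = 2 + 2|u|\<^sup>p\<close>, which is integrable on bounded
  intervals; below \<open>w\<close> dominated convergence applies.
\<close>
lemma hardy_tendsto_boundary_L1_loc:
  assumes f: "f \<in> hardy p" and p: "1 \<le> p" and [measurable]: "u \<in> borel_measurable borel"
    and lim: "AE x in lborel. ((\<lambda>y. f (Complex x y)) \<longlongrightarrow> u x) (at_right 0)"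
  shows "((\<lambda>y. \<integral>\<^sup>+x. ennreal (norm (f (Complex x y) - u x)) * indicator {a..b} x \<partial>lborel) \<longlongrightarrow> 0) (at_right 0)"
proof (rule tendsto_at_right_sequentially[where b = 1])
  fix S :: "nat \<Rightarrow> real" assume S0: "\<And>n. 0 < S n" and S: "S \<longlonglongrightarrow> 0"
  have S': "filterlim S (at_right 0) sequentially"
    unfolding filterlim_at using S S0 by (auto simp: less_imp_neq[symmetric])
  have [measurable]: "(\<lambda>t. f (Complex t (S n))) \<in> borel_measurable borel" for n
    by (rule hardy_slice_measurable[OF f S0])
  have conv: "AE x in lborel. (\<lambda>n. f (Complex x (S n))) \<longlonglongrightarrow> u x"
    using lim by eventually_elim (rule filterlim_compose[OF _ S'])
  define d where "d n x = norm (norm (f (Complex x (S n))) powr p - norm (u x) powr p)" for n x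
  have [measurable]: "d n \<in> borel_measurable borel" for n unfolding d_def by measurable
  have d0: "(\<lambda>n. \<integral>\<^sup>+x. ennreal (d n x) \<partial>lborel) \<longlonglongrightarrow> 0"
    unfolding d_def
  proof (rule Scheffe_lemma2)
    show "integrable lborel (\<lambda>x. norm (u x) powr p)"
      by (rule hardy_boundary_power_integrable[OF f p _ lim]) measurable
    show "AE x in lborel. (\<lambda>n. norm (f (Complex x (S n))) powr p) \<longlonglongrightarrow> norm (u x) powr p"
      using conv by eventually_elim (use p in \<open>auto intro!: tendsto_powr' tendsto_norm\<close>)
    show "(\<integral>\<^sup>+x. ennreal (norm (norm (f (Complex x (S n))) powr p)) \<partial>lborel) \<le>
        (\<integral>\<^sup>+x. ennreal (norm (norm (u x) powr p)) \<partial>lborel)" for n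
      using hardy_slice_le_boundary[OF f p _ lim S0, of n] by simp
  qed measurable
  define w where "w x = 2 + 2 * norm (u x) powr p" for x
  have [measurable]: "w \<in> borel_measurable borel" unfolding w_def by measurable
  have w0: "w x \<ge> 0" for x by (simp add: w_def)
  have bd: "norm (f (Complex x (S n)) - u x) \<le> min (norm (f (Complex x (S n)) - u x)) (w x) + d n x" for n x
  proof -
    have "norm (f (Complex x (S n)) - u x) \<le> norm (f (Complex x (S n))) + norm (u x)"
      by (rule norm_triangle_ineq4)
    also have "\<dots> \<le> (1 + norm (f (Complex x (S n))) powr p) + (1 + norm (u x) powr p)"
      using p by (intro add_mono le_one_plus_powr) auto
    also have "\<dots> \<le> w x + d n x" unfolding w_def d_def by (simp add: abs_if)
    finally show ?thesis by (auto simp: d_def min_def)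
  qed
  have m0: "(\<lambda>n. \<integral>\<^sup>+x. ennreal (min (norm (f (Complex x (S n)) - u x)) (w x)) * indicator {a..b} x \<partial>lborel) \<longlonglongrightarrow> (\<integral>\<^sup>+x. 0 \<partial>(lborel :: real measure))"
  proof (rule nn_integral_dominated_convergence[where w = "\<lambda>x. ennreal (w x) * indicator {a..b} x"])
    have "(\<integral>\<^sup>+x. ennreal (w x) * indicator {a..b} x \<partial>lborel) \<le>
        (\<integral>\<^sup>+x. 2 * indicator {a..b} x + 2 * ennreal (norm (u x) powr p) \<partial>lborel)"
      by (intro nn_integral_mono) (auto simp: w_def indicator_def ennreal_mult' ennreal_plus)
    also have "\<dots> = 2 * emeasure lborel {a..b} + 2 * (\<integral>\<^sup>+x. ennreal (norm (u x) powr p) \<partial>lborel)"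
      by (simp add: nn_integral_add nn_integral_cmult nn_integral_cmult_indicator)
    also have "\<dots> < \<infinity>"
      using hardy_boundary_power_integrable[OF f p _ lim]
      by (auto simp: integrable_iff_bounded ennreal_mult_less_top emeasure_lborel_Icc_eq)
    finally show "(\<integral>\<^sup>+x. ennreal (w x) * indicator {a..b} x \<partial>lborel) < \<infinity>" .
    show "AE x in lborel. ennreal (min (norm (f (Complex x (S n)) - u x)) (w x)) * indicator {a..b} x \<le> ennreal (w x) * indicator {a..b} x" for n
      by (intro AE_I2 mult_right_mono ennreal_leI) auto
    show "AE x in lborel. (\<lambda>n. ennreal (min (norm (f (Complex x (S n)) - u x)) (w x)) * indicator {a..b} x) \<longlonglongrightarrow> 0"
      using conv
    proof eventually_elim
      case (elim x)
      have "(\<lambda>n. min (norm (f (Complex x (S n)) - u x)) (w x)) \<longlonglongrightarrow> min (norm (u x - u x)) (w x)"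
        using elim by (intro tendsto_intros)
      then have "(\<lambda>n. ennreal (min (norm (f (Complex x (S n)) - u x)) (w x)) * indicator {a..b} x) \<longlonglongrightarrow> ennreal 0 * indicator {a..b} x"
        using w0[of x] by (intro tendsto_mult_ennreal tendsto_const tendsto_ennrealI) (auto simp: indicator_def)
      then show ?case by simp
    qed
  qed auto
  have L: "(\<lambda>n. (\<integral>\<^sup>+x. ennreal (min (norm (f (Complex x (S n)) - u x)) (w x)) * indicator {a..b} x \<partial>lborel) + (\<integral>\<^sup>+x. ennreal (d n x) \<partial>lborel)) \<longlonglongrightarrow> 0 + 0"
    using m0 d0 by (intro tendsto_add) auto
  have le: "(\<integral>\<^sup>+x. ennreal (norm (f (Complex x (S n)) - u x)) * indicator {a..b} x \<partial>lborel) \<le>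
     (\<integral>\<^sup>+x. ennreal (min (norm (f (Complex x (S n)) - u x)) (w x)) * indicator {a..b} x \<partial>lborel) + (\<integral>\<^sup>+x. ennreal (d n x) \<partial>lborel)" for n
  proof -
    have "(\<integral>\<^sup>+x. ennreal (norm (f (Complex x (S n)) - u x)) * indicator {a..b} x \<partial>lborel) \<le>
      (\<integral>\<^sup>+x. ennreal (min (norm (f (Complex x (S n)) - u x)) (w x)) * indicator {a..b} x + ennreal (d n x) \<partial>lborel)"
    proof (intro nn_integral_mono)
      fix x
      have "ennreal (norm (f (Complex x (S n)) - u x)) \<le> ennreal (min (norm (f (Complex x (S n)) - u x)) (w x)) + ennreal (d n x)"
        using ennreal_leI[OF bd[of x n]] w0[of x] by (subst (asm) ennreal_plus) (auto simp: d_def)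
      then show "ennreal (norm (f (Complex x (S n)) - u x)) * indicator {a..b} x \<le>
         ennreal (min (norm (f (Complex x (S n)) - u x)) (w x)) * indicator {a..b} x + ennreal (d n x)"
        by (auto simp: indicator_def)
    qed
    also have "\<dots> = (\<integral>\<^sup>+x. ennreal (min (norm (f (Complex x (S n)) - u x)) (w x)) * indicator {a..b} x \<partial>lborel) + (\<integral>\<^sup>+x. ennreal (d n x) \<partial>lborel)"
      by (rule nn_integral_add) measurable
    finally show ?thesis .
  qed
  show "(\<lambda>n. \<integral>\<^sup>+x. ennreal (norm (f (Complex x (S n)) - u x)) * indicator {a..b} x \<partial>lborel) \<longlonglongrightarrow> 0"
    by (rule tendsto_sandwich[OF _ _ tendsto_const L[unfolded add_0_left]]) (use le in auto)
qed simp

section \<open>Continuation across the real line\<close>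

text \<open>
  A function that is holomorphic beyond the real line and agrees, below it, with a meromorphic function on the
  lower half-plane witnesses the existential behind \<^const>\<open>continuation\<close>.
\<close>
lemma continuation_exists:
  assumes f: "f holomorphic_on upper_half_plane"
    and F: "F holomorphic_on {z. Im z > - h}" and h: "h > 0"
    and Ff: "\<And>z. Im z > 0 \<Longrightarrow> F z = f z"
    and g: "g meromorphic_on {z. Im z < 0}"
    and Fg: "\<And>z. - h < Im z \<Longrightarrow> Im z < 0 \<Longrightarrow> F z = g z"
  shows "\<exists>G. G meromorphic_on UNIV \<and> G analytic_on range complex_of_real \<and> (\<forall>z\<in>upper_half_plane. G z = f z)"
proof -
  define G where "G z = (if Im z > - h then F z else g z)" for z
  have oF: "open {z. Im z > - h}" and og: "open {z. Im z < 0}"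
    by (simp_all add: open_halfspace_Im_gt open_halfspace_Im_lt)
  have "G holomorphic_on {z. Im z > - h}"
    using F by (rule holomorphic_transform) (auto simp: G_def)
  then have an: "G analytic_on {z. Im z > - h}" using oF by (simp add: analytic_on_open)
  have "G meromorphic_on {z. Im z < 0}"
  proof (subst meromorphic_on_cong[OF _ refl, of _ _ g])
    fix z assume "z \<in> {z. Im z < 0}"
    then have "eventually (\<lambda>w. w \<in> {z. Im z < 0}) (at z)"
      using og eventually_at_in_open' by blast
    then show "\<forall>\<^sub>F w in at z. G w = g w"
      by eventually_elim (auto simp: G_def Fg)
  qed (rule g)
  then have "G meromorphic_on ({z. Im z > - h} \<union> {z. Im z < 0})"
    using analytic_on_imp_meromorphic_on[OF an] by (intro meromorphic_on_Un)
  also have "{z. Im z > - h} \<union> {z. Im z < 0} = UNIV" using h by auto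
  finally have "G meromorphic_on UNIV" .
  moreover have "G analytic_on range complex_of_real"
    using an h by (auto elim!: analytic_on_subset)
  moreover have "\<forall>z\<in>upper_half_plane. G z = f z"
    using h by (auto simp: G_def Ff upper_half_plane_def)
  ultimately show ?thesis by blast
qed

text \<open>
  The identity theorem on a disc around \<open>x\<close>: whatever continuation was chosen, near the real line it is
  the given one, so that its values and derivatives there can be computed from \<open>F\<close>.
\<close>
lemma continuation_eq_near_real:
  assumes ex: "\<exists>G. G meromorphic_on UNIV \<and> G analytic_on range complex_of_real \<and> (\<forall>z\<in>upper_half_plane. G z = f z)"
    and F: "F holomorphic_on {z. Im z > - h}" and h: "h > 0"
    and Ff: "\<And>z. Im z > 0 \<Longrightarrow> F z = f z"
  shows "eventually (\<lambda>z. continuation f z = F z) (nhds (complex_of_real x))"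
proof -
  define c where "c = continuation f"
  have c: "c analytic_on range complex_of_real" "\<And>z. z \<in> upper_half_plane \<Longrightarrow> c z = f z"
    using someI_ex[OF ex] unfolding c_def continuation_def by auto
  obtain e where e: "e > 0" "c holomorphic_on ball (of_real x) e"
    using c(1) unfolding analytic_on_def by blast
  define T where "T = ball (complex_of_real x) (min e h)"
  define T' where "T' = T \<inter> upper_half_plane"
  have Tsub: "T \<subseteq> {z. Im z > - h}"
  proof
    fix z assume "z \<in> T"
    then have "norm (of_real x - z) < h" by (simp add: T_def dist_norm)
    then have "\<bar>Im (of_real x - z)\<bar> < h" using abs_Im_le_cmod[of "of_real x - z"] by linarith
    then show "z \<in> {z. Im z > - h}" by (simp add: abs_less_iff)
  qed
  have "c z = F z" if "z \<in> T" for z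
  proof (rule analytic_continuation_open[of T' T c F])
    show "open T'" "open T" by (auto simp: T'_def T_def open_upper_half_plane)
    show "connected T" by (simp add: T_def)
    have "Complex x (min e h / 2) \<in> T'"
    proof -
      have "of_real x - Complex x (min e h / 2) = Complex 0 (- (min e h / 2))" by (simp add: complex_eq_iff)
      then have "dist (of_real x) (Complex x (min e h / 2)) = min e h / 2"
        using e h by (simp add: dist_norm cmod_def)
      then show ?thesis using e h by (auto simp: T'_def T_def)
    qed
    then show "T' \<noteq> {}" by auto
    show "T' \<subseteq> T" by (auto simp: T'_def)
    show "c holomorphic_on T" using e(2) by (rule holomorphic_on_subset) (auto simp: T_def)
    show "F holomorphic_on T" using F Tsub by (rule holomorphic_on_subset)
    show "c z = F z" if "z \<in> T'" for z
      using that c(2) Ff by (auto simp: T'_def upper_half_plane_def)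
    show "z \<in> T" by fact
  qed
  moreover have "eventually (\<lambda>z. z \<in> T) (nhds (complex_of_real x))"
    using e h by (intro eventually_nhds_in_open) (auto simp: T_def)
  ultimately show ?thesis unfolding c_def by (auto elim: eventually_mono)
qed

section \<open>Inner functions with bounded derivative\<close>

lemma closure_upper_half_plane: "closure upper_half_plane = {z. Im z \<ge> 0}"
  using closure_halfspace_gt[of "\<i>" 0] by (simp add: upper_half_plane_def)

lemma continuous_AE_eq_imp_eq:
  fixes g :: "real \<Rightarrow> real"
  assumes "continuous_on UNIV g" "AE x in lborel. g x = c"
  shows "g x = c"
proof (rule ccontr)
  assume ne: "g x \<noteq> c"
  define U where "U = {x. g x \<noteq> c}"
  have oU: "open U" unfolding U_def
    using open_Collect_neq[OF assms(1), of "\<lambda>_. c"] by auto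
  then have [measurable]: "U \<in> sets borel" by (rule borel_open)
  have "emeasure lborel U = 0"
    using assms(2) AE_iff_measurable[of U lborel "\<lambda>x. g x = c"] \<open>U \<in> sets borel\<close>
    by (simp add: U_def)
  then have "U \<in> null_sets lborel" by auto
  then have "negligible U" by (simp add: negligible_iff_null_sets null_sets_completionI)
  then show False using open_not_negligible[OF oU] ne by (auto simp: U_def)
qed

text \<open>
  A bounded derivative makes \<open>\<Theta>\<close> Lipschitz, hence continuous up to the line, where it is unimodular
  almost everywhere and so, by continuity, everywhere. Consequently it has no zeros near the line, and the
  reflected function \<open>1 / cnj (\<Theta> (cnj z))\<close> has the same values on the line.
\<close>
lemma inner_function_reflection:
  assumes inn: "inner_function \<Theta>" and der: "deriv \<Theta> \<in> hardy_inf"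
  obtains h G where "h > 0" "G holomorphic_on {z. Im z > - h}" "\<And>z. Im z > 0 \<Longrightarrow> G z = \<Theta> z"
    "\<And>x. norm (G (of_real x)) = 1"
    "\<And>z. - h < Im z \<Longrightarrow> Im z < 0 \<Longrightarrow> G z = inverse (cnj (\<Theta> (cnj z)))"
proof -
  have hol: "\<Theta> holomorphic_on upper_half_plane" using inn by (simp add: inner_function_def hardy_inf_def)
  obtain L where L: "L > 0" "\<And>z. z \<in> upper_half_plane \<Longrightarrow> norm (deriv \<Theta> z) \<le> L"
    using der unfolding hardy_inf_def bounded_pos by auto
  have "L-lipschitz_on upper_half_plane \<Theta>"
  proof (rule lipschitz_onI)
    fix z w assume zw: "z \<in> upper_half_plane" "w \<in> upper_half_plane"
    show "dist (\<Theta> z) (\<Theta> w) \<le> L * dist z w"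
      unfolding dist_norm
    proof (rule field_differentiable_bound[OF convex_upper_half_plane _ L(2) zw])
      fix z assume "z \<in> upper_half_plane"
      then show "(\<Theta> has_field_derivative deriv \<Theta> z) (at z within upper_half_plane)"
        using holomorphic_derivI[OF hol open_upper_half_plane] by blast
    qed
  qed (use L in auto)
  then obtain T where T: "L-lipschitz_on {z. Im z \<ge> 0} T" "\<And>z. z \<in> upper_half_plane \<Longrightarrow> T z = \<Theta> z"
    using lipschitz_extend_closure[of L upper_half_plane \<Theta>] by (auto simp: closure_upper_half_plane)
  have Tc: "continuous_on {z. Im z \<ge> 0} T" by (rule lipschitz_on_continuous_on[OF T(1)])
  obtain \<theta> where \<theta>: "has_boundary_values \<Theta> \<theta>" "AE x in lborel. norm (\<theta> x) = 1"
    using inn by (auto simp: inner_function_def)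
  have vert: "((\<lambda>y. T (Complex x y)) \<longlongrightarrow> T (of_real x)) (at_right 0)" for x
  proof -
    have "(T \<longlongrightarrow> T (of_real x)) (at (of_real x) within {z. Im z \<ge> 0})"
      using Tc by (auto simp: continuous_on_def)
    moreover have "filterlim (\<lambda>y. Complex x y) (at (of_real x) within {z. Im z \<ge> 0}) (at_right 0)"
      by (rule filterlim_vertical_approach) simp
    ultimately show ?thesis by (rule filterlim_compose)
  qed
  have "AE x in lborel. norm (T (of_real x)) = 1"
    using \<theta> unfolding has_boundary_values_def
  proof eventually_elim
    case (elim x)
    have "((\<lambda>y. T (Complex x y)) \<longlongrightarrow> \<theta> x) (at_right 0)"
      using nontangential_imp_vertical_limit[OF elim(1)]
      by (rule Lim_transform_eventually) (auto simp: eventually_at_filter T(2))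
    then have "T (of_real x) = \<theta> x" using vert[of x] tendsto_unique[OF trivial_limit_at_right_real] by blast
    with elim show ?case by simp
  qed
  moreover have "continuous_on UNIV (\<lambda>x. norm (T (of_real x)))"
    by (intro continuous_intros continuous_on_compose2[OF Tc]) auto
  ultimately have T1: "norm (T (of_real x)) = 1" for x by (rule continuous_AE_eq_imp_eq[rotated])
  \<comment> \<open>The Lipschitz constant \<open>L\<close> is qualitative here; the sharp constant is found later, from the extension to the line.\<close>
  define h where "h = 1 / (L + 1)"
  have h: "h > 0" using L by (simp add: h_def)
  have Tne: "T z \<noteq> 0" if "0 \<le> Im z" "Im z < h" for z
  proof
    assume "T z = 0"
    have "z - of_real (Re z) = Complex 0 (Im z)" by (simp add: complex_eq_iff)
    then have d: "dist z (of_real (Re z)) = Im z" using that by (simp add: dist_norm cmod_def)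
    have "1 = norm (T z - T (of_real (Re z)))" using T1[of "Re z"] \<open>T z = 0\<close> by simp
    also have "\<dots> \<le> L * Im z" using lipschitz_onD[OF T(1), of z "of_real (Re z)"] that d by (simp add: dist_norm)
    also have "\<dots> \<le> L * h" using that L by (intro mult_left_mono) auto
    also have "\<dots> < 1" using L by (simp add: h_def)
    finally show False by simp
  qed
  define G where "G z = (if Im z \<ge> 0 then T z else inverse (cnj (T (cnj z))))" for z
  define S where "S = {z. Im z > - h}"
  have oS: "open S" unfolding S_def by (rule open_halfspace_Im_gt)
  have cG: "continuous_on S G"
  proof -
    have "continuous_on S (\<lambda>z. if - Im z \<le> 0 then T z else inverse (cnj (T (cnj z))))"
    proof (rule continuous_on_cases_le)
      show "continuous_on {z \<in> S. - Im z \<le> 0} T" using Tc by (rule continuous_on_subset) auto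
      show "continuous_on {z \<in> S. 0 \<le> - Im z} (\<lambda>z. inverse (cnj (T (cnj z))))"
        by (intro continuous_intros continuous_on_compose2[OF Tc]) (auto simp: S_def Tne)
      show "continuous_on S (\<lambda>z. - Im z)" by (intro continuous_intros)
      fix z assume "z \<in> S" "- Im z = 0"
      then have "Im z = 0" by auto
      then obtain x where x: "z = of_real x" by (metis complex_is_Real_iff Reals_cases)
      have "T (of_real x) * cnj (T (of_real x)) = 1"
        using T1[of x] complex_norm_square[of "T (of_real x)"] by simp
      then show "T z = inverse (cnj (T (cnj z)))"
        using x by (simp add: inverse_eq_divide nonzero_eq_divide_eq) 
           (metis mult_zero_right zero_neq_one complex_cnj_zero_iff nonzero_eq_divide_eq)
    qed
    then show ?thesis by (simp add: G_def[abs_def])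
  qed
  have "G holomorphic_on S"
  proof (rule holomorphic_on_paste_across_line[OF oS, of "\<i>" _ 0])
    have "(cnj \<circ> \<Theta> \<circ> cnj) holomorphic_on {z. Im z < 0}"
      by (rule holomorphic_on_compose_cnj_cnj)
         (auto intro!: holomorphic_on_subset[OF hol] simp: upper_half_plane_def open_halfspace_Im_lt)
    then have "(cnj \<circ> \<Theta> \<circ> cnj) holomorphic_on S \<inter> {z. Im z < 0}"
      by (rule holomorphic_on_subset) auto
    moreover have "(cnj \<circ> \<Theta> \<circ> cnj) z \<noteq> 0" if "z \<in> S \<inter> {z. Im z < 0}" for z
      using that Tne[of "cnj z"] T(2)[of "cnj z"] by (auto simp: S_def upper_half_plane_def)
    ultimately have "(\<lambda>z. inverse ((cnj \<circ> \<Theta> \<circ> cnj) z)) holomorphic_on S \<inter> {z. Im z < 0}"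
      by (rule holomorphic_on_inverse)
    then have "G holomorphic_on S \<inter> {z. Im z < 0}"
      by (rule holomorphic_transform) (auto simp: G_def T(2) upper_half_plane_def)
    then show "G holomorphic_on S \<inter> {z. \<i> \<bullet> z < 0}" by simp
    have "G holomorphic_on upper_half_plane"
      using hol by (rule holomorphic_transform) (auto simp: G_def T(2) upper_half_plane_def)
    then show "G holomorphic_on S \<inter> {z. 0 < \<i> \<bullet> z}"
      by (rule holomorphic_on_subset) (auto simp: upper_half_plane_def)
  qed (use cG in auto)
  show ?thesis
  proof (rule that[OF h])
    show "G holomorphic_on {z. - h < Im z}" using \<open>G holomorphic_on S\<close> by (simp add: S_def)
    show "G z = \<Theta> z" if "Im z > 0" for z using that by (simp add: G_def T(2) upper_half_plane_def)
    show "norm (G (of_real x)) = 1" for x by (simp add: G_def T1)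
    show "G z = inverse (cnj (\<Theta> (cnj z)))" if "- h < Im z" "Im z < 0" for z
      using that by (simp add: G_def T(2) upper_half_plane_def)
  qed
qed

lemma reflected_inner_meromorphic:
  assumes "\<Theta> holomorphic_on upper_half_plane"
  shows "(\<lambda>z. inverse (cnj (\<Theta> (cnj z)))) meromorphic_on {z. Im z < 0}"
proof -
  have "(cnj \<circ> \<Theta> \<circ> cnj) holomorphic_on {z. Im z < 0}"
    by (rule holomorphic_on_compose_cnj_cnj)
       (auto intro!: holomorphic_on_subset[OF assms] simp: upper_half_plane_def open_halfspace_Im_lt)
  then have "(cnj \<circ> \<Theta> \<circ> cnj) analytic_on {z. Im z < 0}"
    by (simp add: analytic_on_open open_halfspace_Im_lt)
  then have "(\<lambda>z. inverse ((cnj \<circ> \<Theta> \<circ> cnj) z)) meromorphic_on {z. Im z < 0}"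
    by (intro meromorphic_on_inverse analytic_on_imp_meromorphic_on)
  then show ?thesis by (simp add: o_def)
qed

text \<open>
  The function \<open>w\<close> constructed here is the trace of \<open>\<Theta>\<close> on the line; the estimate says that \<open>\<Theta>\<close> is Lipschitz in the
  vertical direction with constant \<^term>\<open>deriv_sup_norm \<Theta>\<close>. That number is a supremum over the line only; it
  bounds the derivative in the half-plane because \<open>|\<Theta>'|\<close> is at most the Poisson integral of its
  boundary values.
\<close>
lemma inner_function_near_unimodular:
  assumes inn: "inner_function \<Theta>" and der: "deriv \<Theta> \<in> hardy_inf"
  obtains w :: "real \<Rightarrow> complex" where "0 \<le> deriv_sup_norm \<Theta>" "\<And>x. norm (w x) = 1"
    "\<And>x y. 0 < y \<Longrightarrow> norm (\<Theta> (Complex x y) - w x) \<le> deriv_sup_norm \<Theta> * y"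
proof -
  obtain h G where h: "h > 0" and G: "G holomorphic_on {z. Im z > - h}" "\<And>z. Im z > 0 \<Longrightarrow> G z = \<Theta> z"
    and G1: "\<And>x. norm (G (of_real x)) = 1"
    and Gm: "\<And>z. - h < Im z \<Longrightarrow> Im z < 0 \<Longrightarrow> G z = inverse (cnj (\<Theta> (cnj z)))"
    using inner_function_reflection[OF assms] by metis
  have hol: "\<Theta> holomorphic_on upper_half_plane" using inn by (simp add: inner_function_def hardy_inf_def)
  have ex: "\<exists>G. G meromorphic_on UNIV \<and> G analytic_on range complex_of_real \<and> (\<forall>z\<in>upper_half_plane. G z = \<Theta> z)"
    by (rule continuation_exists[OF hol G(1) h G(2) reflected_inner_meromorphic[OF hol] Gm]) auto
  have deq: "deriv (continuation \<Theta>) (of_real x) = deriv G (of_real x)" for x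
    by (intro deriv_cong_ev continuation_eq_near_real[OF ex G(1) h G(2)] refl)
  have oS: "open {z. Im z > - h}" by (rule open_halfspace_Im_gt)
  have dG: "deriv G holomorphic_on {z. Im z > - h}" using G(1) oS by (rule holomorphic_deriv)
  have dcont: "continuous_on {z. Im z \<ge> 0} (deriv G)"
    by (rule continuous_on_subset[OF holomorphic_on_imp_continuous_on[OF dG]]) (use h in auto)
  have dGT: "deriv G z = deriv \<Theta> z" if "Im z > 0" for z
  proof (rule deriv_cong_ev)
    have "eventually (\<lambda>w. w \<in> upper_half_plane) (nhds z)"
      using that by (intro eventually_nhds_in_open open_upper_half_plane) (simp add: upper_half_plane_def)
    then show "\<forall>\<^sub>F w in nhds z. G w = \<Theta> w"
      by eventually_elim (simp add: G(2) upper_half_plane_def)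
  qed simp
  obtain L where L: "L > 0" "\<And>z. z \<in> upper_half_plane \<Longrightarrow> norm (deriv \<Theta> z) \<le> L"
    using der unfolding hardy_inf_def bounded_pos by auto
  have dL: "norm (deriv G z) \<le> L" if "Im z \<ge> 0" for z
  proof -
    have "deriv G ` closure upper_half_plane \<subseteq> cball 0 L"
    proof (rule image_closure_subset)
      show "continuous_on (closure upper_half_plane) (deriv G)"
        using dcont by (simp add: closure_upper_half_plane)
      show "deriv G ` upper_half_plane \<subseteq> cball 0 L"
        using L(2) dGT by (auto simp: upper_half_plane_def)
    qed simp
    then show ?thesis using that by (auto simp: closure_upper_half_plane)
  qed
  define M where "M = deriv_sup_norm \<Theta>"
  have bdd: "bdd_above (range (\<lambda>x. norm (deriv G (of_real x))))"
    using dL by (intro bdd_aboveI[of _ L]) auto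
  have Mx: "norm (deriv G (of_real x)) \<le> M" for x
    unfolding M_def deriv_sup_norm_def deq by (rule cSUP_upper[OF _ bdd]) simp
  have M0: "0 \<le> M" using Mx[of 0] norm_ge_zero order_trans by blast
  have dM: "norm (deriv G z) \<le> M" if "Im z \<ge> 0" for z
  proof (cases "Im z = 0")
    case True
    then obtain x where "z = of_real x" by (metis complex_is_Real_iff Reals_cases)
    then show ?thesis using Mx by simp
  next
    case False
    then have y: "Im z > 0" using that by simp
    have "ennreal (norm (deriv G (Complex (Re z) (Im z))) powr 1) \<le>
      (\<integral>\<^sup>+t. ennreal (poisson (Im z) (Re z - t)) * ennreal (norm (deriv G (Complex t 0)) powr 1) \<partial>lborel)"
    proof (rule power_norm_le_poisson_integral[OF dcont _ _ _ y])
      show "deriv G holomorphic_on upper_half_plane"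
        by (rule holomorphic_on_subset[OF dG]) (use h in \<open>auto simp: upper_half_plane_def\<close>)
      show "norm (deriv G z) powr 1 \<le> L" if "0 \<le> Im z" for z using dL[OF that] by simp
    qed simp
    also have "\<dots> \<le> (\<integral>\<^sup>+t. ennreal (poisson (Im z) (Re z - t)) * ennreal M \<partial>lborel)"
      using Mx by (intro nn_integral_mono mult_left_mono ennreal_leI) (auto simp: complex_of_real_def)
    also have "\<dots> = ennreal M"
      by (simp add: nn_integral_multc nn_integral_poisson[OF y])
    finally show ?thesis using M0 by simp
  qed
  have near: "norm (\<Theta> z - G (of_real (Re z))) \<le> M * Im z" if y: "Im z > 0" for z
  proof -
    have "norm (G z - G (of_real (Re z))) \<le> M * norm (z - of_real (Re z))"
    proof (rule field_differentiable_bound[of "{z. Im z \<ge> 0}" G "deriv G"])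
      show "convex {z. Im z \<ge> 0}" by (rule convex_halfspace_Im_ge)
      fix z assume "z \<in> {z. 0 \<le> Im z}"
      then have z: "Im z \<ge> 0" by simp
      then have "(G has_field_derivative deriv G z) (at z)"
        using holomorphic_derivI[OF G(1) oS, of z] h by simp
      then show "(G has_field_derivative deriv G z) (at z within {z. 0 \<le> Im z})"
        by (rule has_field_derivative_at_within)
      show "norm (deriv G z) \<le> M" using dM[OF z] .
    qed (use y in auto)
    moreover have "norm (z - of_real (Re z)) = Im z"
    proof -
      have "z - of_real (Re z) = Complex 0 (Im z)" by (simp add: complex_eq_iff)
      then show ?thesis using y by (simp add: cmod_def)
    qed
    ultimately show ?thesis using G(2)[OF y] by simp
  qed
  show ?thesis
  proof (rule that)
    show "0 \<le> deriv_sup_norm \<Theta>" using M0 by (simp add: M_def)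
    show "norm (G (of_real x)) = 1" for x by (rule G1)
    show "norm (\<Theta> (Complex x y) - G (of_real x)) \<le> deriv_sup_norm \<Theta> * y" if "0 < y" for x y
      using near[of "Complex x y"] that by (simp add: M_def)
  qed
qed

section \<open>Gluing across the real line\<close>

text \<open>
  A primitive of \<open>f\<close> satisfies \<open>\<Phi>(x + iy) = \<Phi>(a + iy) + \<integral>\<^sub>a\<^sup>x f(t + iy) dt\<close>. As \<open>y \<rightarrow> 0\<close> the integral
  converges uniformly for bounded \<open>x\<close> by the \<open>L\<^sup>1\<close> convergence, and \<open>\<Phi>(a + iy)\<close> converges because \<open>f\<close> is
  bounded on the vertical segment just above \<open>a\<close>; the primitive is chosen with limit \<open>0\<close> at \<open>a\<close>. The
  difference of indicators encodes the oriented integral from \<open>a\<close> to \<open>x\<close> for either order of the two.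
\<close>
lemma primitive_continuous_to_boundary:
  fixes f :: "complex \<Rightarrow> complex" and u :: "real \<Rightarrow> complex"
  assumes b: "b > 0" and f: "f holomorphic_on {z. 0 < Im z \<and> Im z < b}"
    and u: "\<And>c d. integrable lborel (\<lambda>t. indicator {c..d} t *\<^sub>R u t)"
    and L1: "\<And>c d. ((\<lambda>y. \<integral>\<^sup>+x. ennreal (norm (f (Complex x y) - u x)) * indicator {c..d} x \<partial>lborel) \<longlongrightarrow> 0) (at_right 0)"
    and vert: "((\<lambda>y. f (Complex a y)) \<longlongrightarrow> l) (at_right 0)"
  obtains \<Phi> where "\<And>z. 0 < Im z \<Longrightarrow> Im z < b \<Longrightarrow> (\<Phi> has_field_derivative f z) (at z)"
    "continuous_on {z. 0 \<le> Im z \<and> Im z < b} \<Phi>"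
    "\<And>x. \<Phi> (of_real x) = (LINT t|lborel. (indicator {a..x} t - indicator {x..a} t) *\<^sub>R u t)"
proof -
  define S where "S = {z. 0 < Im z \<and> Im z < b}"
  have S_eq: "S = {z. Im z > 0} \<inter> {z. Im z < b}" by (auto simp: S_def)
  have S: "open S" "convex S" unfolding S_eq
    by (auto intro!: open_Int convex_Int simp: open_halfspace_Im_gt open_halfspace_Im_lt convex_halfspace_Im_gt convex_halfspace_Im_lt)
  have fS: "f holomorphic_on S" using f by (simp add: S_def)
  obtain P where P0: "\<And>z. z \<in> S \<Longrightarrow> (P has_field_derivative f z) (at z within S)"
    using holomorphic_convex_primitive'[OF S(2,1) fS] by blast
  then have P: "(P has_field_derivative f z) (at z)" if "z \<in> S" for z
    using that S(1) by (metis at_within_open)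
  have Pc: "continuous_on S P"
    using P0 by (meson DERIV_continuous continuous_on_eq_continuous_within)
  define \<sigma> :: "real \<Rightarrow> real \<Rightarrow> real" where "\<sigma> x t = indicator {a..x} t - indicator {x..a} t" for x t
  define I where "I x = (LINT t|lborel. \<sigma> x t *\<^sub>R u t)" for x
  have intu: "integrable lborel (\<lambda>t. \<sigma> x t *\<^sub>R u t)" for x
    unfolding \<sigma>_def scaleR_diff_left by (intro Bochner_Integration.integrable_diff u)
  have hor: "has_bochner_integral lborel (\<lambda>t. indicator {c..d} t *\<^sub>R f (Complex t y)) (P (Complex d y) - P (Complex c y))"
    if "c \<le> d" "0 < y" "y < b" for c d y
  proof (rule has_bochner_integral_FTC_Icc[OF that(1)])
    fix t
    have "((\<lambda>t. Complex t y) has_vector_derivative 1) (at t within {c..d})"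
      unfolding Complex_eq has_vector_derivative_def
      by (auto intro!: derivative_eq_intros simp: scaleR_conv_of_real)
    moreover have "(P has_field_derivative f (Complex t y)) (at (Complex t y) within (\<lambda>t. Complex t y) ` {c..d})"
      using P[of "Complex t y"] that by (auto simp: S_def intro: has_field_derivative_at_within)
    ultimately have "((P \<circ> (\<lambda>t. Complex t y)) has_vector_derivative 1 * f (Complex t y)) (at t within {c..d})"
      by (rule field_vector_diff_chain_within)
    then show "((\<lambda>t. P (Complex t y)) has_vector_derivative f (Complex t y)) (at t within {c..d})"
      by (simp add: o_def)
  next
    show "continuous_on {c..d} (\<lambda>t. f (Complex t y))"
      by (rule continuous_on_compose2[OF holomorphic_on_imp_continuous_on[OF fS]])
         (use that in \<open>auto simp: S_def Complex_eq intro!: continuous_intros\<close>)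
  qed
  have ftc: "has_bochner_integral lborel (\<lambda>t. \<sigma> x t *\<^sub>R f (Complex t y)) (P (Complex x y) - P (Complex a y))"
    if y: "0 < y" "y < b" for x y
  proof -
    consider "x = a" | "a < x" | "x < a" by linarith
    then show ?thesis
    proof cases
      case 2
      then show ?thesis using hor[of a x y] y by (simp add: \<sigma>_def)
    next
      case 3
      then show ?thesis using has_bochner_integral_minus[OF hor[of x a y]] y by (simp add: \<sigma>_def)
    qed (simp add: \<sigma>_def has_bochner_integral_zero)
  qed
  have diff: "ennreal (norm (P (Complex x y) - P (Complex a y) - I x)) \<le>
      (\<integral>\<^sup>+t. ennreal (norm (f (Complex t y) - u t)) * indicator {-R..R} t \<partial>lborel)"
    if y: "0 < y" "y < b" and R: "\<bar>a\<bar> \<le> R" "\<bar>x\<bar> \<le> R" for x y R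
  proof -
    have "has_bochner_integral lborel (\<lambda>t. \<sigma> x t *\<^sub>R f (Complex t y) - \<sigma> x t *\<^sub>R u t)
        (P (Complex x y) - P (Complex a y) - I x)"
      unfolding I_def by (intro has_bochner_integral_diff ftc y has_bochner_integral_integrable intu)
    then have "integrable lborel (\<lambda>t. \<sigma> x t *\<^sub>R f (Complex t y) - \<sigma> x t *\<^sub>R u t)"
      and eq: "P (Complex x y) - P (Complex a y) - I x = (LINT t|lborel. \<sigma> x t *\<^sub>R f (Complex t y) - \<sigma> x t *\<^sub>R u t)"
      by (simp_all add: has_bochner_integral_iff)
    then have "ennreal (norm (P (Complex x y) - P (Complex a y) - I x)) \<le>
        (\<integral>\<^sup>+t. ennreal (norm (\<sigma> x t *\<^sub>R f (Complex t y) - \<sigma> x t *\<^sub>R u t)) \<partial>lborel)"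
      unfolding eq by (intro integral_norm_bound_ennreal)
    also have "\<dots> \<le> (\<integral>\<^sup>+t. ennreal (norm (f (Complex t y) - u t)) * indicator {-R..R} t \<partial>lborel)"
      using R by (intro nn_integral_mono) (auto simp: \<sigma>_def indicator_def norm_minus_commute scaleR_diff_right[symmetric])
    finally show ?thesis .
  qed
  obtain c where c: "((\<lambda>y. P (Complex a y)) \<longlongrightarrow> c) (at_right 0)"
  proof -
    have "eventually (\<lambda>y. dist (f (Complex a y)) l < 1) (at_right 0)" using vert by (rule tendstoD) simp
    then obtain d where d: "d > 0" "\<And>y. 0 < y \<Longrightarrow> y < d \<Longrightarrow> dist (f (Complex a y)) l < 1"
      unfolding eventually_at_right_field by auto
    define e where "e = min d b"
    have e: "e > 0" "e \<le> d" "e \<le> b" using d b by (auto simp: e_def)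
    define B where "B = norm l + 1"
    have fB: "norm (f (Complex a y)) \<le> B" if "y \<in> {0<..<e}" for y
      using d(2)[of y] that e norm_triangle_ineq2[of "f (Complex a y)" l] by (auto simp: B_def dist_norm)
    have "B-lipschitz_on {0<..<e} (\<lambda>y. P (Complex a y))"
    proof (rule lipschitz_onI)
      fix y y' :: real assume yy: "y \<in> {0<..<e}" "y' \<in> {0<..<e}"
      have "norm (P (Complex a y) - P (Complex a y')) \<le> B * norm (Complex a y - Complex a y')"
      proof (rule field_differentiable_bound[of "{z. Re z = a \<and> Im z \<in> {0<..<e}}" P f])
        have "{z. Re z = a \<and> Im z \<in> {0<..<e}} =
            ({z. Re z \<ge> a} \<inter> {z. Re z \<le> a}) \<inter> ({z. Im z > 0} \<inter> {z. Im z < e})" by auto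
        then show "convex {z. Re z = a \<and> Im z \<in> {0<..<e}}"
          by (simp only:) (intro convex_Int convex_halfspace_Re_ge convex_halfspace_Re_le convex_halfspace_Im_gt convex_halfspace_Im_lt)
        fix z assume z: "z \<in> {z. Re z = a \<and> Im z \<in> {0<..<e}}"
        then have "z \<in> S" using e by (auto simp: S_def)
        from P[OF this] show "(P has_field_derivative f z) (at z within {z. Re z = a \<and> Im z \<in> {0<..<e}})"
          by (rule has_field_derivative_at_within)
        show "norm (f z) \<le> B" using fB[of "Im z"] z by (cases z) auto
      qed (use yy in auto)
      moreover have "norm (Complex a y - Complex a y') = dist y y'"
        by (simp add: cmod_def dist_real_def complex_eq_iff)
      ultimately show "dist (P (Complex a y)) (P (Complex a y')) \<le> B * dist y y'" by (simp add: dist_norm)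
    qed (simp add: B_def)
    then obtain g where g: "B-lipschitz_on (closure {0<..<e}) g" "\<And>y. y \<in> {0<..<e} \<Longrightarrow> g y = P (Complex a y)"
      using lipschitz_extend_closure by blast
    have "continuous_on {0..e} g" using lipschitz_on_continuous_on[OF g(1)] e by simp
    then have "(g \<longlongrightarrow> g 0) (at 0 within {0..e})" using e by (auto simp: continuous_on_def)
    then have "(g \<longlongrightarrow> g 0) (at_right 0)" using e
      by (metis at_within_Icc_at_right)
    moreover have "eventually (\<lambda>y. g y = P (Complex a y)) (at_right 0)"
      unfolding eventually_at_right_field using e g(2) by auto
    ultimately have "((\<lambda>y. P (Complex a y)) \<longlongrightarrow> g 0) (at_right 0)" by (rule Lim_transform_eventually)
    then show ?thesis using that by blast
  qed
  have unif: "\<exists>d>0. d \<le> b \<and> (\<forall>x y. \<bar>x\<bar> \<le> R \<longrightarrow> 0 < y \<longrightarrow> y < d \<longrightarrow> norm (P (Complex x y) - c - I x) < \<epsilon>)"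
    if \<epsilon>: "\<epsilon> > 0" and R: "\<bar>a\<bar> \<le> R" for \<epsilon> R
  proof -
    have "eventually (\<lambda>y. (\<integral>\<^sup>+t. ennreal (norm (f (Complex t y) - u t)) * indicator {-R..R} t \<partial>lborel) < ennreal (\<epsilon> / 2)) (at_right 0)"
      using order_tendstoD(2)[OF L1[of "-R" R], of "ennreal (\<epsilon> / 2)"] \<epsilon> by simp
    moreover have "eventually (\<lambda>y. dist (P (Complex a y)) c < \<epsilon> / 2) (at_right 0)"
      using c by (rule tendstoD) (use \<epsilon> in auto)
    ultimately have "eventually (\<lambda>y. (\<integral>\<^sup>+t. ennreal (norm (f (Complex t y) - u t)) * indicator {-R..R} t \<partial>lborel) < ennreal (\<epsilon> / 2) \<and>
        dist (P (Complex a y)) c < \<epsilon> / 2) (at_right 0)" by (rule eventually_conj)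
    then obtain d where d: "d > 0" "\<And>y. 0 < y \<Longrightarrow> y < d \<Longrightarrow>
       (\<integral>\<^sup>+t. ennreal (norm (f (Complex t y) - u t)) * indicator {-R..R} t \<partial>lborel) < ennreal (\<epsilon> / 2) \<and>
        dist (P (Complex a y)) c < \<epsilon> / 2"
      unfolding eventually_at_right_field by auto
    have "norm (P (Complex x y) - c - I x) < \<epsilon>" if x: "\<bar>x\<bar> \<le> R" and y: "0 < y" "y < min d b" for x y
    proof -
      have "ennreal (norm (P (Complex x y) - P (Complex a y) - I x)) < ennreal (\<epsilon> / 2)"
        using le_less_trans[OF diff] d(2)[of y] x y R by auto
      then have "norm (P (Complex x y) - P (Complex a y) - I x) < \<epsilon> / 2"
        using \<epsilon> by (simp add: ennreal_less_iff)
      moreover have "norm (P (Complex a y) - c) < \<epsilon> / 2" using d(2)[of y] y by (simp add: dist_norm)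
      ultimately have "norm ((P (Complex x y) - P (Complex a y) - I x) + (P (Complex a y) - c)) < \<epsilon>"
        by (intro norm_triangle_lt) linarith
      then show ?thesis by (simp add: algebra_simps)
    qed
    then show ?thesis using d b by (intro exI[of _ "min d b"]) auto
  qed
  define \<Phi> where "\<Phi> z = (if Im z > 0 then P z - c else I (Re z))" for z
  have Icont: "isCont I x0" for x0
    unfolding continuous_at_eps_delta
  proof (intro allI impI)
    fix \<epsilon> :: real assume \<epsilon>: "\<epsilon> > 0"
    define R where "R = max \<bar>a\<bar> (\<bar>x0\<bar> + 1)"
    obtain d where d: "d > 0" "d \<le> b" "\<And>x y. \<bar>x\<bar> \<le> R \<Longrightarrow> 0 < y \<Longrightarrow> y < d \<Longrightarrow> norm (P (Complex x y) - c - I x) < \<epsilon> / 3"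
      using unif[of "\<epsilon> / 3" R] \<epsilon> by (auto simp: R_def)
    define y where "y = d / 2"
    have y: "0 < y" "y < d" using d by (auto simp: y_def)
    have "continuous_on UNIV (\<lambda>x. P (Complex x y))"
      by (rule continuous_on_compose2[OF Pc]) (use y d in \<open>auto simp: S_def Complex_eq intro!: continuous_intros\<close>)
    then have "isCont (\<lambda>x. P (Complex x y)) x0" by (simp add: continuous_on_eq_continuous_at)
    then obtain s where s: "s > 0" "\<And>x. dist x x0 < s \<Longrightarrow> dist (P (Complex x y)) (P (Complex x0 y)) < \<epsilon> / 3"
      unfolding continuous_at_eps_delta using \<epsilon> by (metis divide_pos_pos zero_less_numeral)
    have "dist (I x) (I x0) < \<epsilon>" if x: "dist x x0 < min s 1" for x
    proof -
      have "\<bar>x\<bar> \<le> R" "\<bar>x0\<bar> \<le> R" using x by (auto simp: R_def dist_real_def)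
      then have "norm (P (Complex x y) - c - I x) < \<epsilon> / 3" "norm (P (Complex x0 y) - c - I x0) < \<epsilon> / 3"
        using d(3) y by auto
      moreover have "norm (P (Complex x y) - P (Complex x0 y)) < \<epsilon> / 3" using s(2)[of x] x by (simp add: dist_norm)
      ultimately have "norm ((P (Complex x y) - P (Complex x0 y)) - (P (Complex x y) - c - I x) + (P (Complex x0 y) - c - I x0)) < \<epsilon>"
        using norm_triangle_ineq4[of "P (Complex x y) - P (Complex x0 y)" "P (Complex x y) - c - I x"]
        by (intro norm_triangle_lt) linarith
      then show ?thesis by (simp add: dist_norm)
    qed
    then show "\<exists>d>0. \<forall>x. dist x x0 < d \<longrightarrow> dist (I x) (I x0) < \<epsilon>"
      using s by (intro exI[of _ "min s 1"]) auto
  qed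
  have \<Phi>c: "continuous_on {z. 0 \<le> Im z \<and> Im z < b} \<Phi>"
    unfolding continuous_on_eq_continuous_within
  proof
    fix z0 assume z0: "z0 \<in> {z. 0 \<le> Im z \<and> Im z < b}"
    show "continuous (at z0 within {z. 0 \<le> Im z \<and> Im z < b}) \<Phi>"
    proof (cases "Im z0 > 0")
      case True
      then have zS: "z0 \<in> S" using z0 by (simp add: S_def)
      have "continuous_on S (\<lambda>z. P z - c)" by (intro continuous_intros Pc)
      then have "continuous_on S \<Phi>"
        by (rule continuous_on_eq) (simp add: \<Phi>_def S_def)
      then have "continuous (at z0) \<Phi>" using S(1) zS by (simp add: continuous_on_eq_continuous_at)
      then show ?thesis by (rule continuous_at_imp_continuous_at_within)
    next
      case False
      define x0 where "x0 = Re z0"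
      have zx: "z0 = of_real x0" using False z0 by (simp add: x0_def complex_eq_iff)
      show ?thesis unfolding continuous_within_eps_delta
      proof (intro allI impI)
        fix \<epsilon> :: real assume \<epsilon>: "\<epsilon> > 0"
        define R where "R = max \<bar>a\<bar> (\<bar>x0\<bar> + 1)"
        obtain d where d: "d > 0" "d \<le> b" "\<And>x y. \<bar>x\<bar> \<le> R \<Longrightarrow> 0 < y \<Longrightarrow> y < d \<Longrightarrow> norm (P (Complex x y) - c - I x) < \<epsilon> / 2"
          using unif[of "\<epsilon> / 2" R] \<epsilon> by (auto simp: R_def)
        obtain s where s: "s > 0" "\<And>x. dist x x0 < s \<Longrightarrow> dist (I x) (I x0) < \<epsilon> / 2"
          using Icont[of x0, unfolded continuous_at_eps_delta, rule_format, of "\<epsilon> / 2"] \<epsilon> by auto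
        have "dist (\<Phi> z) (\<Phi> z0) < \<epsilon>" if z: "z \<in> {z. 0 \<le> Im z \<and> Im z < b}" "dist z z0 < min (min d s) 1" for z
        proof -
          have re: "dist (Re z) x0 < min (min d s) 1" and im: "\<bar>Im z\<bar> < min (min d s) 1"
            using z(2) abs_Re_le_cmod[of "z - z0"] abs_Im_le_cmod[of "z - z0"] by (auto simp: dist_norm zx)
          have "\<bar>Re z\<bar> \<le> R" using re by (auto simp: R_def dist_real_def)
          then have "norm (\<Phi> z - I (Re z)) < \<epsilon> / 2"
            using d(3)[of "Re z" "Im z"] im \<epsilon> by (auto simp: \<Phi>_def)
          moreover have "dist (I (Re z)) (I x0) < \<epsilon> / 2" using s(2) re by simp
          moreover have "\<Phi> z0 = I x0" by (simp add: \<Phi>_def zx)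
          ultimately show ?thesis using dist_triangle[of "\<Phi> z" "I x0" "I (Re z)"] by (simp add: dist_norm)
        qed
        then show "\<exists>d>0. \<forall>x'\<in>{z. 0 \<le> Im z \<and> Im z < b}. dist x' z0 < d \<longrightarrow> dist (\<Phi> x') (\<Phi> z0) < \<epsilon>"
          using d s by (intro exI[of _ "min (min d s) 1"]) auto
      qed
    qed
  qed
  show ?thesis
  proof (rule that[OF _ \<Phi>c])
    show "\<Phi> (of_real x) = (LINT t|lborel. (indicator {a..x} t - indicator {x..a} t) *\<^sub>R u t)" for x
      by (simp add: \<Phi>_def I_def \<sigma>_def)
    fix z assume z: "0 < Im z" "Im z < b"
    then have zS: "z \<in> S" by (simp add: S_def)
    have "((\<lambda>z. P z - c) has_field_derivative f z) (at z)"
      using P[OF zS] by (auto intro!: derivative_eq_intros)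
    moreover have "eventually (\<lambda>w. P w - c = \<Phi> w) (nhds z)"
      using eventually_nhds_in_open[OF S(1) zS] by eventually_elim (simp add: \<Phi>_def S_def)
    ultimately show "(\<Phi> has_field_derivative f z) (at z)"
      by (rule DERIV_cong_ev[OF refl _ refl, THEN iffD1, rotated])
  qed
qed

text \<open>
  The function on the lower side is given by its reflection \<open>g\<close>, so that the previous lemma serves both
  sides. The two primitives are normalised at the same point \<open>a\<close> and have the same boundary function
  \<open>x \<mapsto> \<integral>\<^sub>a\<^sup>x u\<close>; together they form a continuous function that is holomorphic off the line.
\<close>
lemma analytic_gluing_across_real_line:
  fixes f g :: "complex \<Rightarrow> complex" and u :: "real \<Rightarrow> complex"
  assumes b: "b > 0"
    and f: "f holomorphic_on {z. 0 < Im z \<and> Im z < b}"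
    and g: "g holomorphic_on {z. 0 < Im z \<and> Im z < b}"
    and u: "\<And>c d. integrable lborel (\<lambda>t. indicator {c..d} t *\<^sub>R u t)"
    and L1f: "\<And>c d. ((\<lambda>y. \<integral>\<^sup>+x. ennreal (norm (f (Complex x y) - u x)) * indicator {c..d} x \<partial>lborel) \<longlongrightarrow> 0) (at_right 0)"
    and L1g: "\<And>c d. ((\<lambda>y. \<integral>\<^sup>+x. ennreal (norm (g (Complex x y) - cnj (u x))) * indicator {c..d} x \<partial>lborel) \<longlongrightarrow> 0) (at_right 0)"
    and vertf: "((\<lambda>y. f (Complex a y)) \<longlongrightarrow> l) (at_right 0)"
    and vertg: "((\<lambda>y. g (Complex a y)) \<longlongrightarrow> l') (at_right 0)"
  obtains F where "F holomorphic_on {z. - b < Im z \<and> Im z < b}"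
    "\<And>z. 0 < Im z \<Longrightarrow> Im z < b \<Longrightarrow> F z = f z"
    "\<And>z. - b < Im z \<Longrightarrow> Im z < 0 \<Longrightarrow> F z = cnj (g (cnj z))"
proof -
  obtain \<Phi> where \<Phi>: "\<And>z. 0 < Im z \<Longrightarrow> Im z < b \<Longrightarrow> (\<Phi> has_field_derivative f z) (at z)"
    "continuous_on {z. 0 \<le> Im z \<and> Im z < b} \<Phi>"
    "\<And>x. \<Phi> (of_real x) = (LINT t|lborel. (indicator {a..x} t - indicator {x..a} t) *\<^sub>R u t)"
    by (rule primitive_continuous_to_boundary[OF b f u L1f vertf]) (rule that; simp)
  have u': "integrable lborel (\<lambda>t. indicator {c..d} t *\<^sub>R cnj (u t))" for c d :: real
    using integrable_bounded_linear[OF bounded_linear_cnj u[of c d]] by simp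
  obtain \<Psi> where \<Psi>: "\<And>z. 0 < Im z \<Longrightarrow> Im z < b \<Longrightarrow> (\<Psi> has_field_derivative g z) (at z)"
    "continuous_on {z. 0 \<le> Im z \<and> Im z < b} \<Psi>"
    "\<And>x. \<Psi> (of_real x) = (LINT t|lborel. (indicator {a..x} t - indicator {x..a} t) *\<^sub>R cnj (u t))"
    by (rule primitive_continuous_to_boundary[OF b g u' L1g vertg]) (rule that; simp)
  have bd: "\<Psi> (of_real x) = cnj (\<Phi> (of_real x))" for x
  proof -
    have "integrable lborel (\<lambda>t. (indicator {a..x} t - indicator {x..a} t) *\<^sub>R u t)"
      unfolding scaleR_diff_left by (intro Bochner_Integration.integrable_diff u)
    from integral_bounded_linear[OF bounded_linear_cnj this] show ?thesis
      by (simp add: \<Phi>(3) \<Psi>(3))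
  qed
  define S where "S = {z. - b < Im z \<and> Im z < b}"
  have S_eq: "S = {z. Im z > - b} \<inter> {z. Im z < b}" by (auto simp: S_def)
  have oS: "open S" unfolding S_eq
    by (intro open_Int open_halfspace_Im_gt open_halfspace_Im_lt)
  define G where "G z = (if - Im z \<le> 0 then \<Phi> z else cnj (\<Psi> (cnj z)))" for z
  have cG: "continuous_on S G"
    unfolding G_def
  proof (rule continuous_on_cases_le)
    show "continuous_on {z \<in> S. - Im z \<le> 0} \<Phi>" using \<Phi>(2) by (rule continuous_on_subset) (auto simp: S_def)
    show "continuous_on {z \<in> S. 0 \<le> - Im z} (\<lambda>z. cnj (\<Psi> (cnj z)))"
      by (intro continuous_intros continuous_on_compose2[OF \<Psi>(2)]) (auto simp: S_def)
    show "continuous_on S (\<lambda>z. - Im z)" by (intro continuous_intros)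
    fix z assume "z \<in> S" "- Im z = 0"
    then obtain x where "z = of_real x" by (metis complex_is_Real_iff Reals_cases neg_equal_0_iff_equal)
    then show "\<Phi> z = cnj (\<Psi> (cnj z))" by (simp add: bd)
  qed
  have up: "open {z. 0 < Im z \<and> Im z < b}" and lo: "open {z. - b < Im z \<and> Im z < 0}"
    using open_Int[OF open_halfspace_Im_gt[of 0] open_halfspace_Im_lt[of b]]
      open_Int[OF open_halfspace_Im_gt[of "-b"] open_halfspace_Im_lt[of 0]] by (auto simp: Collect_conj_eq)
  have Gup: "(G has_field_derivative f z) (at z)" if "0 < Im z" "Im z < b" for z
  proof -
    have "eventually (\<lambda>w. \<Phi> w = G w) (nhds z)"
      using eventually_nhds_in_open[OF up, of z] that by (auto simp: G_def elim!: eventually_mono)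
    with \<Phi>(1)[OF that] show ?thesis by (rule DERIV_cong_ev[OF refl _ refl, THEN iffD1, rotated])
  qed
  have Glo: "(G has_field_derivative cnj (g (cnj z))) (at z)" if "- b < Im z" "Im z < 0" for z
  proof -
    have "(cnj \<circ> \<Psi> \<circ> cnj has_field_derivative cnj (g (cnj z))) (at z)"
      using \<Psi>(1)[of "cnj z"] that by (simp add: has_field_derivative_cnj_cnj)
    moreover have "eventually (\<lambda>w. (cnj \<circ> \<Psi> \<circ> cnj) w = G w) (nhds z)"
      using eventually_nhds_in_open[OF lo, of z] that by (auto simp: G_def elim!: eventually_mono)
    ultimately show ?thesis by (rule DERIV_cong_ev[OF refl _ refl, THEN iffD1, rotated])
  qed
  have "G holomorphic_on S"
  proof (rule holomorphic_on_paste_across_line[OF oS, of "\<i>" _ 0])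
    show "G holomorphic_on S \<inter> {z. \<i> \<bullet> z < 0}"
      unfolding holomorphic_on_def field_differentiable_def
    proof
      fix z assume "z \<in> S \<inter> {z. \<i> \<bullet> z < 0}"
      then show "\<exists>D. (G has_field_derivative D) (at z within S \<inter> {z. \<i> \<bullet> z < 0})"
        using has_field_derivative_at_within[OF Glo] by (auto simp: S_def)
    qed
    show "G holomorphic_on S \<inter> {z. 0 < \<i> \<bullet> z}"
      unfolding holomorphic_on_def field_differentiable_def
    proof
      fix z assume "z \<in> S \<inter> {z. 0 < \<i> \<bullet> z}"
      then show "\<exists>D. (G has_field_derivative D) (at z within S \<inter> {z. 0 < \<i> \<bullet> z})"
        using has_field_derivative_at_within[OF Gup] by (auto simp: S_def)
    qed
  qed (use cG in auto)
  then have "deriv G holomorphic_on S" using oS by (rule holomorphic_deriv)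
  then show ?thesis
    unfolding S_def by (rule that) (use DERIV_imp_deriv[OF Gup] DERIV_imp_deriv[OF Glo] in auto)
qed

section \<open>Continuation of functions in the model space\<close>

lemma AE_lborel_imp_ex:
  assumes "AE x in (lborel :: real measure). P x"
  shows "\<exists>x. P x"
proof (rule ccontr)
  assume "\<not> ?thesis"
  with assms have "AE x in (lborel :: real measure). False" by simp
  then have "emeasure (lborel :: real measure) UNIV = 0"
    by (subst (asm) AE_iff_measurable[of UNIV]) auto
  then show False by simp
qed

lemma hardy_boundary_locally_integrable:
  fixes u :: "real \<Rightarrow> complex"
  assumes f: "f \<in> hardy p" and p: "1 \<le> p" and [measurable]: "u \<in> borel_measurable borel"
    and lim: "AE x in lborel. ((\<lambda>y. f (Complex x y)) \<longlongrightarrow> u x) (at_right 0)"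
  shows "integrable lborel (\<lambda>t. indicator {c..d} t *\<^sub>R u t)"
proof (rule Bochner_Integration.integrable_bound)
  have "integrable lborel (\<lambda>t. indicator {c..d} t :: real)"
    by (rule integrable_real_indicator) (auto simp: emeasure_lborel_Icc_eq)
  then show "integrable lborel (\<lambda>t. indicator {c..d} t + norm (u t) powr p)"
    using hardy_boundary_power_integrable[OF f p _ lim] by (intro Bochner_Integration.integrable_add) auto
  have "norm (indicator {c..d} t *\<^sub>R u t) \<le> norm (indicator {c..d} t + norm (u t) powr p)" for t
  proof -
    have "norm (u t) \<le> 1 + norm (u t) powr p" using p by (intro le_one_plus_powr) auto
    then show ?thesis by (auto simp: indicator_def)
  qed
  then show "AE t in lborel. norm (indicator {c..d} t *\<^sub>R u t) \<le> norm (indicator {c..d} t + norm (u t) powr p)"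
    by simp
qed measurable

text \<open>
  With \<open>T = \<Theta>\<close>, the quotient \<open>H / T\<close> is the reflection of the lower half of the continuation. Convergence
  passes from \<open>H\<close> to the quotient because the denominator converges uniformly and stays away from \<open>0\<close>.
\<close>
lemma quotient_tendsto_L1_loc:
  fixes H T :: "complex \<Rightarrow> complex" and v w :: "real \<Rightarrow> complex"
  assumes T: "\<And>x y. 0 < y \<Longrightarrow> y < b \<Longrightarrow> 1 / 2 \<le> norm (T (Complex x y))" and b: "b > 0"
    and near: "\<And>x y. 0 < y \<Longrightarrow> norm (T (Complex x y) - w x) \<le> M * y"
    and w: "\<And>x. norm (w x) = 1" and M: "M \<ge> 0"
    and [measurable]: "v \<in> borel_measurable borel" "\<And>y. 0 < y \<Longrightarrow> (\<lambda>x. H (Complex x y)) \<in> borel_measurable borel"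
    and v: "integrable lborel (\<lambda>t. indicator {c..d} t *\<^sub>R v t)"
    and L1: "((\<lambda>y. \<integral>\<^sup>+x. ennreal (norm (H (Complex x y) - v x)) * indicator {c..d} x \<partial>lborel) \<longlongrightarrow> 0) (at_right 0)"
  shows "((\<lambda>y. \<integral>\<^sup>+x. ennreal (norm (H (Complex x y) / T (Complex x y) - v x / w x)) * indicator {c..d} x \<partial>lborel) \<longlongrightarrow> 0) (at_right 0)"
proof -
  define V where "V = (\<integral>\<^sup>+x. ennreal (norm (v x)) * indicator {c..d} x \<partial>lborel)"
  have "V = (\<integral>\<^sup>+x. ennreal (norm (indicator {c..d} x *\<^sub>R v x)) \<partial>lborel)"
    unfolding V_def by (intro nn_integral_cong) (auto simp: indicator_def)
  also have "\<dots> < \<infinity>" using v by (simp add: integrable_iff_bounded)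
  finally obtain V' where V': "V = ennreal V'" "V' \<ge> 0" by (cases V rule: ennreal_cases) auto
  have pw: "norm (H z / T z - v x / w x) \<le> 2 * norm (H z - v x) + 2 * M * y * norm (v x)"
    if y: "0 < y" "y < b" and z: "z = Complex x y" for x y z
  proof -
    have "1 / norm (T z) \<le> 1 / (1 / 2)" using T[OF y, of x] by (intro frac_le) (auto simp: z)
    then have T2: "1 / norm (T z) \<le> 2" by simp
    have ne: "T z \<noteq> 0" "w x \<noteq> 0" using T[OF y, of x] w[of x] by (auto simp: z)
    have "H z / T z - v x / w x = (H z - v x) * (1 / T z) + v x * ((w x - T z) / w x * (1 / T z))"
      using ne by (simp add: field_simps)
    also have "norm \<dots> \<le> norm ((H z - v x) * (1 / T z)) + norm (v x * ((w x - T z) / w x * (1 / T z)))"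
      by (rule norm_triangle_ineq)
    also have "\<dots> = norm (H z - v x) * (1 / norm (T z)) + norm (v x) * (norm (T z - w x) * (1 / norm (T z)))"
      by (simp add: norm_mult norm_divide w norm_minus_commute)
    also have "\<dots> \<le> norm (H z - v x) * 2 + norm (v x) * (M * y * 2)"
      using T2 near[OF y(1), of x] M y by (intro add_mono mult_left_mono mult_mono) (auto simp: z)
    finally show ?thesis by (simp add: mult_ac)
  qed
  define U where "U y = 2 * (\<integral>\<^sup>+x. ennreal (norm (H (Complex x y) - v x)) * indicator {c..d} x \<partial>lborel) + ennreal (2 * M * y * V')" for y
  have "(U \<longlongrightarrow> 2 * 0 + ennreal (2 * M * 0 * V')) (at_right 0)"
    unfolding U_def by (intro tendsto_add ennreal_tendsto_cmult L1 tendsto_ennrealI tendsto_intros) auto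
  then have U0: "(U \<longlongrightarrow> 0) (at_right 0)" by simp
  have "eventually (\<lambda>y. 0 < y \<and> y < b) (at_right 0)" using b by (auto simp: eventually_at_right_field)
  then have le: "eventually (\<lambda>y. (\<integral>\<^sup>+x. ennreal (norm (H (Complex x y) / T (Complex x y) - v x / w x)) * indicator {c..d} x \<partial>lborel) \<le> U y) (at_right 0)"
  proof eventually_elim
    case (elim y)
    then have y: "0 < y" "y < b" by auto
    note [measurable] = assms(7)[OF y(1)]
    have "(\<integral>\<^sup>+x. ennreal (norm (H (Complex x y) / T (Complex x y) - v x / w x)) * indicator {c..d} x \<partial>lborel) \<le>
      (\<integral>\<^sup>+x. 2 * (ennreal (norm (H (Complex x y) - v x)) * indicator {c..d} x) + ennreal (2 * M * y) * (ennreal (norm (v x)) * indicator {c..d} x) \<partial>lborel)"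
    proof (intro nn_integral_mono)
      fix x
      have "ennreal (norm (H (Complex x y) / T (Complex x y) - v x / w x)) \<le>
         ennreal (2 * norm (H (Complex x y) - v x) + 2 * M * y * norm (v x))"
        by (intro ennreal_leI pw y refl)
      also have "\<dots> = ennreal (2 * norm (H (Complex x y) - v x)) + ennreal (2 * M * y * norm (v x))"
        using y M by (intro ennreal_plus) auto
      also have "ennreal (2 * norm (H (Complex x y) - v x)) = ennreal 2 * ennreal (norm (H (Complex x y) - v x))"
        by (rule ennreal_mult'') simp
      also have "ennreal (2 * M * y * norm (v x)) = ennreal (2 * M * y) * ennreal (norm (v x))"
        by (rule ennreal_mult'') simp
      finally show "ennreal (norm (H (Complex x y) / T (Complex x y) - v x / w x)) * indicator {c..d} x \<le>
         2 * (ennreal (norm (H (Complex x y) - v x)) * indicator {c..d} x) + ennreal (2 * M * y) * (ennreal (norm (v x)) * indicator {c..d} x)"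
        by (auto simp: indicator_def)
    qed
    also have "\<dots> = 2 * (\<integral>\<^sup>+x. ennreal (norm (H (Complex x y) - v x)) * indicator {c..d} x \<partial>lborel) + ennreal (2 * M * y) * V"
      unfolding V_def by (subst nn_integral_add) (auto simp: nn_integral_cmult)
    also have "ennreal (2 * M * y) * V = ennreal (2 * M * y * V')"
      unfolding V' by (rule ennreal_mult''[OF V'(2), symmetric])
    finally show ?case by (simp add: U_def)
  qed
  show ?thesis
    by (rule tendsto_sandwich[OF _ le tendsto_const U0]) simp
qed

text \<open>
  On the line \<open>1/w = cnj w\<close>, so the boundary function \<open>w \<sqdot> cnj v\<close> of \<open>f\<close> is the conjugate of
  \<open>v / w\<close>, the boundary function of \<open>H / \<Theta>\<close>. This is the hypothesis of the gluing lemma. The factor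
  \<open>2\<^sup>p\<close> comes from \<open>|\<Theta>| \<ge> 1/2\<close> and is only lost below the line.
\<close>
lemma model_space_continuation:
  assumes inn: "inner_function \<Theta>" and der: "deriv \<Theta> \<in> hardy_inf" and p: "1 \<le> p"
    and fK: "f \<in> model_space p \<Theta>" and b: "b > 0" and Mb: "deriv_sup_norm \<Theta> * b \<le> 1 / 2"
  obtains F where "F holomorphic_on {z. Im z > - b}" "\<And>x. F (of_real x) = real_trace f x"
    "\<And>y. - b < y \<Longrightarrow> (\<integral>\<^sup>+x. ennreal (norm (F (Complex x y)) powr p) \<partial>lborel) \<le>
        ennreal (2 powr p) * (\<integral>\<^sup>+x. ennreal (norm (real_trace f x) powr p) \<partial>lborel)"
proof -
  define M where "M = deriv_sup_norm \<Theta>"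
  have f: "f \<in> hardy p" using fK by (simp add: model_space_def)
  obtain u0 \<theta> h0 H where H: "H \<in> hardy p" and bv: "has_boundary_values H h0" "has_boundary_values f u0" "has_boundary_values \<Theta> \<theta>"
    and eq0: "AE x in lborel. u0 x = \<theta> x * cnj (h0 x)"
    using fK unfolding model_space_def hardy_boundary_def by blast
  have bvlim: "AE x in lborel. ((\<lambda>y. k (Complex x y)) \<longlongrightarrow> k0 x) (at_right 0)"
    if "has_boundary_values k k0" for k k0
    using that unfolding has_boundary_values_def
    by eventually_elim (rule nontangential_imp_vertical_limit)
  have hol: "\<Theta> holomorphic_on upper_half_plane" using inn by (simp add: inner_function_def hardy_inf_def)
  note fh = hardy_holomorphic[OF f] and Hh = hardy_holomorphic[OF H]
  obtain u where [measurable]: "u \<in> borel_measurable borel" and uu0: "AE x in lborel. u x = u0 x"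
    and u: "AE x in lborel. ((\<lambda>y. f (Complex x y)) \<longlongrightarrow> u x) (at_right 0)"
    using vertical_limit_measurable_representative[OF holomorphic_on_imp_continuous_on[OF fh] bvlim[OF bv(2)]] by blast
  obtain v where [measurable]: "v \<in> borel_measurable borel" and vh0: "AE x in lborel. v x = h0 x"
    and v: "AE x in lborel. ((\<lambda>y. H (Complex x y)) \<longlongrightarrow> v x) (at_right 0)"
    using vertical_limit_measurable_representative[OF holomorphic_on_imp_continuous_on[OF Hh] bvlim[OF bv(1)]] by blast
  obtain w where M0: "0 \<le> M" and w1: "\<And>x. norm (w x) = 1"
    and near: "\<And>x y. 0 < y \<Longrightarrow> norm (\<Theta> (Complex x y) - w x) \<le> M * y"
    by (rule inner_function_near_unimodular[OF inn der, folded M_def]) (rule that; assumption)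
  have half: "1 / 2 \<le> norm (\<Theta> (Complex x y))" if y: "0 < y" "y < b" for x y
  proof -
    have "M * y \<le> M * b" using y M0 by (intro mult_left_mono) auto
    then have "norm (\<Theta> (Complex x y) - w x) \<le> 1 / 2" using near[OF y(1), of x] Mb by (simp add: M_def)
    then show ?thesis using norm_triangle_ineq2[of "w x" "\<Theta> (Complex x y)"] w1[of x] by (simp add: norm_minus_commute)
  qed
  have Tlim: "((\<lambda>y. \<Theta> (Complex x y)) \<longlongrightarrow> w x) (at_right 0)" for x
  proof (rule Lim_null[THEN iffD2], rule Lim_null_comparison)
    show "\<forall>\<^sub>F y in at_right 0. norm (\<Theta> (Complex x y) - w x) \<le> M * y"
      using near by (auto simp: eventually_at_filter)
    have "((\<lambda>y. M * y) \<longlongrightarrow> M * 0) (at_right 0)" by (intro tendsto_intros)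
    then show "((\<lambda>y. M * y) \<longlongrightarrow> 0) (at_right 0)" by simp
  qed
  have uv: "AE x in lborel. u x = w x * cnj (v x)"
    using uu0 vh0 eq0 bvlim[OF bv(3)]
  proof eventually_elim
    case (elim x)
    have "w x = \<theta> x" using tendsto_unique[OF trivial_limit_at_right_real Tlim elim(4)] .
    then show ?case using elim by simp
  qed
  define g where "g z = H z / \<Theta> z" for z
  have Tne: "\<Theta> z \<noteq> 0" if "0 < Im z" "Im z < b" for z
    using half[OF that, of "Re z"] by auto
  have gh: "g holomorphic_on {z. 0 < Im z \<and> Im z < b}"
    unfolding g_def using Tne
    by (intro holomorphic_intros holomorphic_on_subset[OF Hh] holomorphic_on_subset[OF hol]) (auto simp: upper_half_plane_def)
  have cu: "AE x in lborel. cnj (u x) = v x / w x"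
    using uv
  proof eventually_elim
    case (elim x)
    have "w x * cnj (w x) = 1" using w1[of x] complex_norm_square[of "w x"] by simp
    moreover have "w x \<noteq> 0" using w1[of x] by auto
    ultimately have "cnj (w x) = 1 / w x" by (simp add: field_simps)
    then show ?case by (simp add: elim)
  qed
  have L1g: "((\<lambda>y. \<integral>\<^sup>+x. ennreal (norm (g (Complex x y) - cnj (u x))) * indicator {c..d} x \<partial>lborel) \<longlongrightarrow> 0) (at_right 0)" for c d
  proof -
    have "((\<lambda>y. \<integral>\<^sup>+x. ennreal (norm (H (Complex x y) / \<Theta> (Complex x y) - v x / w x)) * indicator {c..d} x \<partial>lborel) \<longlongrightarrow> 0) (at_right 0)"
      by (rule quotient_tendsto_L1_loc[OF half b near w1 M0 _ hardy_slice_measurable[OF H] hardy_boundary_locally_integrable[OF H p _ v]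
             hardy_tendsto_boundary_L1_loc[OF H p _ v]]) auto
    moreover have "(\<integral>\<^sup>+x. ennreal (norm (g (Complex x y) - cnj (u x))) * indicator {c..d} x \<partial>lborel) =
       (\<integral>\<^sup>+x. ennreal (norm (H (Complex x y) / \<Theta> (Complex x y) - v x / w x)) * indicator {c..d} x \<partial>lborel)" for y
      by (rule nn_integral_cong_AE) (use cu in eventually_elim, simp add: g_def)
    ultimately show ?thesis by simp
  qed
  have "\<exists>a. ((\<lambda>y. f (Complex a y)) \<longlongrightarrow> u a) (at_right 0) \<and> ((\<lambda>y. H (Complex a y)) \<longlongrightarrow> v a) (at_right 0)"
    by (rule AE_lborel_imp_ex) (use u v in eventually_elim, simp)
  then obtain a where af: "((\<lambda>y. f (Complex a y)) \<longlongrightarrow> u a) (at_right 0)"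
    and aH: "((\<lambda>y. H (Complex a y)) \<longlongrightarrow> v a) (at_right 0)" by blast
  have ag: "((\<lambda>y. g (Complex a y)) \<longlongrightarrow> v a / w a) (at_right 0)"
    unfolding g_def using w1[of a] by (intro tendsto_divide aH Tlim) auto
  have fh': "f holomorphic_on {z. 0 < Im z \<and> Im z < b}"
    by (rule holomorphic_on_subset[OF fh]) (auto simp: upper_half_plane_def)
  obtain E where E: "E holomorphic_on {z. - b < Im z \<and> Im z < b}"
    "\<And>z. 0 < Im z \<Longrightarrow> Im z < b \<Longrightarrow> E z = f z"
    "\<And>z. - b < Im z \<Longrightarrow> Im z < 0 \<Longrightarrow> E z = cnj (g (cnj z))"
    by (rule analytic_gluing_across_real_line[OF b fh' gh hardy_boundary_locally_integrable[OF f p _ u]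
          hardy_tendsto_boundary_L1_loc[OF f p _ u] L1g af ag]) (auto intro: that)
  define F where "F z = (if Im z > 0 then f z else E z)" for z
  have "F holomorphic_on {z. - b < Im z \<and> Im z < b} \<union> upper_half_plane"
  proof (rule holomorphic_on_Un)
    show "F holomorphic_on {z. - b < Im z \<and> Im z < b}"
      using E(1) by (rule holomorphic_transform) (auto simp: F_def E(2))
    show "F holomorphic_on upper_half_plane"
      using fh by (rule holomorphic_transform) (auto simp: F_def upper_half_plane_def)
    show "open {z. - b < Im z \<and> Im z < b}"
      using open_Int[OF open_halfspace_Im_gt[of "-b"] open_halfspace_Im_lt[of b]] by (simp add: Collect_conj_eq)
  qed (rule open_upper_half_plane)
  also have "{z. - b < Im z \<and> Im z < b} \<union> upper_half_plane = {z. Im z > - b}"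
    using b by (auto simp: upper_half_plane_def)
  finally have F: "F holomorphic_on {z. Im z > - b}" .
  have Ff: "F z = f z" if "Im z > 0" for z using that by (simp add: F_def)
  define R where "R z = inverse (cnj (\<Theta> (cnj z))) * cnj (H (cnj z))" for z
  have FR: "F z = R z" if "- b < Im z" "Im z < 0" for z
    using that E(3)[OF that] by (simp add: F_def R_def g_def divide_inverse mult.commute)
  have R: "R meromorphic_on {z. Im z < 0}"
  proof -
    have "(cnj \<circ> H \<circ> cnj) holomorphic_on {z. Im z < 0}"
      by (rule holomorphic_on_compose_cnj_cnj)
         (auto intro!: holomorphic_on_subset[OF Hh] simp: upper_half_plane_def open_halfspace_Im_lt)
    then have "(\<lambda>z. cnj (H (cnj z))) analytic_on {z. Im z < 0}"
      by (simp add: analytic_on_open open_halfspace_Im_lt o_def)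
    then show ?thesis unfolding R_def
      by (intro meromorphic_on_mult reflected_inner_meromorphic[OF hol] analytic_on_imp_meromorphic_on)
  qed
  have ex: "\<exists>G. G meromorphic_on UNIV \<and> G analytic_on range complex_of_real \<and> (\<forall>z\<in>upper_half_plane. G z = f z)"
    by (rule continuation_exists[OF fh F b Ff R FR])
  have trace: "F (of_real x) = real_trace f x" for x
    using eventually_nhds_x_imp_x[OF continuation_eq_near_real[OF ex F b Ff, of x]] by (simp add: real_trace_def)
  have Fu: "AE x in lborel. norm (real_trace f x) = norm (u x)"
    using u
  proof eventually_elim
    case (elim x)
    have "continuous (at (complex_of_real x)) F"
      using holomorphic_on_imp_continuous_on[OF F] open_halfspace_Im_gt[of "-b"] b by (simp add: continuous_on_eq_continuous_at)
    then have "(F \<longlongrightarrow> F (of_real x)) (at (complex_of_real x))" by (simp add: isCont_def)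
    then have "nontangential_limit F x (F (of_real x))"
      unfolding nontangential_limit_def by (auto intro: tendsto_within_subset)
    then have "((\<lambda>y. F (Complex x y)) \<longlongrightarrow> F (of_real x)) (at_right 0)"
      by (rule nontangential_imp_vertical_limit)
    then have "((\<lambda>y. f (Complex x y)) \<longlongrightarrow> F (of_real x)) (at_right 0)"
      by (rule Lim_transform_eventually) (auto simp: eventually_at_filter Ff)
    then have "F (of_real x) = u x" using tendsto_unique[OF trivial_limit_at_right_real _ elim] by blast
    then show ?case by (simp add: trace)
  qed
  have Iu: "(\<integral>\<^sup>+x. ennreal (norm (real_trace f x) powr p) \<partial>lborel) = (\<integral>\<^sup>+x. ennreal (norm (u x) powr p) \<partial>lborel)"
    by (rule nn_integral_cong_AE) (use Fu in eventually_elim, simp)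
  have Iv: "(\<integral>\<^sup>+x. ennreal (norm (u x) powr p) \<partial>lborel) = (\<integral>\<^sup>+x. ennreal (norm (v x) powr p) \<partial>lborel)"
    by (rule nn_integral_cong_AE) (use uv in eventually_elim, simp add: norm_mult w1)
  have two: "1 \<le> ennreal (2 powr p)" using p by (simp add: ge_one_powr_ge_zero)
  show ?thesis
  proof (rule that[OF F trace])
    fix y assume y: "- b < y"
    let ?I = "\<integral>\<^sup>+x. ennreal (norm (u x) powr p) \<partial>lborel"
    consider "y > 0" | "y = 0" | "y < 0" by linarith
    then show "(\<integral>\<^sup>+x. ennreal (norm (F (Complex x y)) powr p) \<partial>lborel) \<le>
        ennreal (2 powr p) * (\<integral>\<^sup>+x. ennreal (norm (real_trace f x) powr p) \<partial>lborel)"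
      unfolding Iu
    proof cases
      case 1
      then have "(\<integral>\<^sup>+x. ennreal (norm (F (Complex x y)) powr p) \<partial>lborel) \<le> ?I"
        using hardy_slice_le_boundary[OF f p _ u 1] by (simp add: Ff)
      also have "\<dots> \<le> ennreal (2 powr p) * ?I" using mult_right_mono[OF two, of ?I] by simp
      finally show "(\<integral>\<^sup>+x. ennreal (norm (F (Complex x y)) powr p) \<partial>lborel) \<le> ennreal (2 powr p) * ?I" .
    next
      case 2
      then have "(\<integral>\<^sup>+x. ennreal (norm (F (Complex x y)) powr p) \<partial>lborel) = ?I"
        using Iu by (simp add: trace complex_of_real_def[symmetric])
      also have "\<dots> \<le> ennreal (2 powr p) * ?I" using mult_right_mono[OF two, of ?I] by simp
      finally show "(\<integral>\<^sup>+x. ennreal (norm (F (Complex x y)) powr p) \<partial>lborel) \<le> ennreal (2 powr p) * ?I" .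
    next
      case 3
      define s where "s = - y"
      have s: "0 < s" "s < b" using 3 y by (auto simp: s_def)
      note [measurable] = hardy_slice_measurable[OF H s(1)]
      have "norm (F (Complex x y)) powr p \<le> 2 powr p * norm (H (Complex x s)) powr p" for x
      proof -
        have cz: "cnj (Complex x y) = Complex x s" by (simp add: complex_eq_iff s_def)
        have "norm (F (Complex x y)) = norm (H (Complex x s)) / norm (\<Theta> (Complex x s))"
          using FR[of "Complex x y"] 3 y by (simp add: R_def cz norm_mult norm_inverse divide_inverse)
        also have "\<dots> \<le> norm (H (Complex x s)) / (1 / 2)"
          using half[OF s, of x] by (intro frac_le) auto
        finally have "norm (F (Complex x y)) \<le> 2 * norm (H (Complex x s))" by simp
        then have "norm (F (Complex x y)) powr p \<le> (2 * norm (H (Complex x s))) powr p"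
          using p by (intro powr_mono2) auto
        then show ?thesis by (simp add: powr_mult)
      qed
      then have "(\<integral>\<^sup>+x. ennreal (norm (F (Complex x y)) powr p) \<partial>lborel) \<le>
          (\<integral>\<^sup>+x. ennreal (2 powr p) * ennreal (norm (H (Complex x s)) powr p) \<partial>lborel)"
        by (intro nn_integral_mono) (simp add: ennreal_mult'[symmetric] ennreal_leI)
      also have "\<dots> = ennreal (2 powr p) * (\<integral>\<^sup>+x. ennreal (norm (H (Complex x s)) powr p) \<partial>lborel)"
        by (rule nn_integral_cmult) measurable
      also have "\<dots> \<le> ennreal (2 powr p) * (\<integral>\<^sup>+x. ennreal (norm (v x) powr p) \<partial>lborel)"
        by (intro mult_left_mono hardy_slice_le_boundary[OF H p _ v s(1)]) auto
      finally show "(\<integral>\<^sup>+x. ennreal (norm (F (Complex x y)) powr p) \<partial>lborel) \<le> ennreal (2 powr p) * ?I"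
        unfolding Iv .
    qed
  qed
qed

section \<open>The embedding inequality\<close>

text \<open>
  Integrate the mean value inequality over squares of half-side \<open>b\<close> against \<open>\<mu>\<close> and apply Tonelli's theorem: a point
  \<open>t + i\<tau>\<close> of the strip is covered exactly by the squares with centre in \<open>(t - b, t + b)\<close>.
\<close>
lemma strip_Carleson_bound:
  fixes F :: "complex \<Rightarrow> complex" and \<mu> :: "real measure" and A D :: ennreal
  assumes F: "F holomorphic_on {z. \<bar>Im z\<bar> < b}" and b: "b > 0" and p: "1 \<le> p"
    and A: "\<And>y. \<bar>y\<bar> < b \<Longrightarrow> (\<integral>\<^sup>+x. ennreal (norm (F (Complex x y)) powr p) \<partial>lborel) \<le> A"
    and \<mu>: "sets \<mu> = sets borel" "sigma_finite_measure \<mu>"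
    and D: "\<And>x. emeasure \<mu> {x - b<..<x + b} \<le> D"
  shows "(\<integral>\<^sup>+x. ennreal (norm (F (of_real x)) powr p) \<partial>\<mu>) \<le> ennreal (6 powr p / b\<^sup>2) * (D * (A * ennreal (2 * b)))"
proof -
  note [measurable_cong] = \<mu>(1)
  interpret \<mu>: sigma_finite_measure \<mu> by (rule \<mu>)
  interpret pair_sigma_finite \<mu> "lborel :: real measure" ..
  define S where "S = {z. \<bar>Im z\<bar> < b}"
  have "S = {z. Im z > - b} \<inter> {z. Im z < b}" by (auto simp: S_def)
  then have oS: "open S" by (simp add: open_Int open_halfspace_Im_gt open_halfspace_Im_lt)
  define K where "K z = ennreal (norm (F z) powr p) * indicator S z" for z
  have [measurable]: "K \<in> borel_measurable borel"
    unfolding K_def[abs_def] using F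
    by (intro power_norm_indicator_measurable oS holomorphic_on_imp_continuous_on) (simp add: S_def)
  define Q where "Q x \<tau> t = K (Complex t \<tau>) * indicator {-b<..<b} (t - x)" for x \<tau> t
  have pw: "ennreal (norm (F (of_real x)) powr p) \<le> ennreal (6 powr p / b\<^sup>2) * (\<integral>\<^sup>+\<tau>. \<integral>\<^sup>+t. Q x \<tau> t \<partial>lborel \<partial>lborel)" for x
  proof -
    have "ennreal (norm (F (of_real x)) powr p) \<le> ennreal (6 powr p / b\<^sup>2) *
     (\<integral>\<^sup>+\<tau>. \<integral>\<^sup>+t. ennreal (norm (F (of_real x + Complex t \<tau>)) powr p) *
         indicator {w. \<bar>Re w\<bar> < b \<and> \<bar>Im w\<bar> < b} (Complex t \<tau>) \<partial>lborel \<partial>lborel)"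
      by (rule square_power_bound[OF holomorphic_on_subset[OF F] b p]) auto
    also have "\<dots> = ennreal (6 powr p / b\<^sup>2) * (\<integral>\<^sup>+\<tau>. \<integral>\<^sup>+t. Q x \<tau> (x + 1 * t) \<partial>lborel \<partial>lborel)"
      by (intro arg_cong2[of _ _ _ _ "(*)"] refl nn_integral_cong)
         (auto simp: Q_def K_def S_def indicator_def complex_of_real_def plus_complex.code)
    also have "(\<integral>\<^sup>+\<tau>. \<integral>\<^sup>+t. Q x \<tau> (x + 1 * t) \<partial>lborel \<partial>lborel) = (\<integral>\<^sup>+\<tau>. \<integral>\<^sup>+t. Q x \<tau> t \<partial>lborel \<partial>lborel)"
    proof (rule nn_integral_cong)
      fix \<tau>
      have "Q x \<tau> \<in> borel_measurable borel" unfolding Q_def by measurable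
      from nn_integral_real_affine[OF this, of 1 x]
      show "(\<integral>\<^sup>+t. Q x \<tau> (x + 1 * t) \<partial>lborel) = (\<integral>\<^sup>+t. Q x \<tau> t \<partial>lborel)" by simp
    qed
    finally show ?thesis .
  qed
  have swap: "(\<integral>\<^sup>+x. \<integral>\<^sup>+\<tau>. \<integral>\<^sup>+t. Q x \<tau> t \<partial>lborel \<partial>lborel \<partial>\<mu>) = (\<integral>\<^sup>+\<tau>. \<integral>\<^sup>+t. \<integral>\<^sup>+x. Q x \<tau> t \<partial>\<mu> \<partial>lborel \<partial>lborel)"
  proof -
    have "(\<integral>\<^sup>+x. \<integral>\<^sup>+\<tau>. \<integral>\<^sup>+t. Q x \<tau> t \<partial>lborel \<partial>lborel \<partial>\<mu>) = (\<integral>\<^sup>+\<tau>. \<integral>\<^sup>+x. \<integral>\<^sup>+t. Q x \<tau> t \<partial>lborel \<partial>\<mu> \<partial>lborel)"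
      unfolding Q_def by (rule Fubini'[symmetric]) measurable
    also have "\<dots> = (\<integral>\<^sup>+\<tau>. \<integral>\<^sup>+t. \<integral>\<^sup>+x. Q x \<tau> t \<partial>\<mu> \<partial>lborel \<partial>lborel)"
      unfolding Q_def by (intro nn_integral_cong Fubini'[symmetric]) measurable
    finally show ?thesis .
  qed
  have inner: "(\<integral>\<^sup>+x. Q x \<tau> t \<partial>\<mu>) \<le> D * K (Complex t \<tau>)" for \<tau> t
  proof -
    have "(\<integral>\<^sup>+x. Q x \<tau> t \<partial>\<mu>) = (\<integral>\<^sup>+x. K (Complex t \<tau>) * indicator {t - b<..<t + b} x \<partial>\<mu>)"
      unfolding Q_def by (intro nn_integral_cong) (auto simp: indicator_def)
    also have "\<dots> = K (Complex t \<tau>) * emeasure \<mu> {t - b<..<t + b}"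
      by (rule nn_integral_cmult_indicator) (simp add: \<mu>)
    also have "\<dots> \<le> K (Complex t \<tau>) * D" by (intro mult_left_mono D) auto
    finally show ?thesis by (simp add: mult.commute)
  qed
  have "(\<integral>\<^sup>+\<tau>. \<integral>\<^sup>+t. \<integral>\<^sup>+x. Q x \<tau> t \<partial>\<mu> \<partial>lborel \<partial>lborel) \<le> (\<integral>\<^sup>+\<tau>. \<integral>\<^sup>+t. D * K (Complex t \<tau>) \<partial>lborel \<partial>lborel)"
    by (intro nn_integral_mono inner)
  also have "\<dots> = D * (\<integral>\<^sup>+\<tau>. \<integral>\<^sup>+t. K (Complex t \<tau>) \<partial>lborel \<partial>lborel)"
    by (simp add: nn_integral_cmult)
  also have "\<dots> \<le> D * (\<integral>\<^sup>+\<tau>. A * indicator {-b<..<b} \<tau> \<partial>lborel)"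
  proof (intro mult_left_mono nn_integral_mono)
    fix \<tau> :: real
    show "(\<integral>\<^sup>+t. K (Complex t \<tau>) \<partial>lborel) \<le> A * indicator {-b<..<b} \<tau>"
    proof (cases "\<bar>\<tau>\<bar> < b")
      case True
      then have "(\<integral>\<^sup>+t. K (Complex t \<tau>) \<partial>lborel) = (\<integral>\<^sup>+t. ennreal (norm (F (Complex t \<tau>)) powr p) \<partial>lborel)"
        by (simp add: K_def S_def)
      also have "\<dots> \<le> A" using A[OF True] .
      finally show ?thesis using True by (simp add: abs_less_iff indicator_def)
    next
      case False
      then show ?thesis by (simp add: K_def S_def)
    qed
  qed auto
  also have "\<dots> = D * (A * ennreal (2 * b))"
    using b by (simp add: nn_integral_cmult_indicator)
  finally have main: "(\<integral>\<^sup>+\<tau>. \<integral>\<^sup>+t. \<integral>\<^sup>+x. Q x \<tau> t \<partial>\<mu> \<partial>lborel \<partial>lborel) \<le> D * (A * ennreal (2 * b))" .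
  have "(\<integral>\<^sup>+x. ennreal (norm (F (of_real x)) powr p) \<partial>\<mu>) \<le>
      (\<integral>\<^sup>+x. ennreal (6 powr p / b\<^sup>2) * (\<integral>\<^sup>+\<tau>. \<integral>\<^sup>+t. Q x \<tau> t \<partial>lborel \<partial>lborel) \<partial>\<mu>)"
    by (intro nn_integral_mono pw)
  also have "\<dots> = ennreal (6 powr p / b\<^sup>2) * (\<integral>\<^sup>+x. \<integral>\<^sup>+\<tau>. \<integral>\<^sup>+t. Q x \<tau> t \<partial>lborel \<partial>lborel \<partial>\<mu>)"
    unfolding Q_def by (rule nn_integral_cmult) measurable
  also have "\<dots> \<le> ennreal (6 powr p / b\<^sup>2) * (D * (A * ennreal (2 * b)))"
    unfolding swap by (intro mult_left_mono main) auto
  finally show ?thesis .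
qed

lemma emeasure_le_interval_density:
  assumes "sets \<mu> = sets borel" "\<delta> > 0" "2 * b \<le> \<delta>"
  shows "emeasure \<mu> {x - b<..<x + b} \<le> interval_density \<mu> \<delta> * ennreal \<delta>"
proof -
  have "emeasure \<mu> {x - b<..<x + b} \<le> emeasure \<mu> {x - b..x - b + \<delta>}"
    using assms by (intro emeasure_mono) auto
  also have "\<dots> = emeasure \<mu> {x - b..x - b + \<delta>} / ennreal \<delta> * ennreal \<delta>"
    using assms(2) by (simp add: ennreal_divide_times ennreal_divide_self)
  also have "\<dots> \<le> interval_density \<mu> \<delta> * ennreal \<delta>"
    unfolding interval_density_def by (intro mult_right_mono SUP_upper) auto
  finally show ?thesis .
qed

theorem theorem1p2:
  fixes p :: real
  assumes "1 \<le> p"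
  shows "\<exists>C::real. C > 0 \<and>
    (\<forall>(\<Theta> :: complex \<Rightarrow> complex) (\<mu> :: real measure) (\<delta> :: real).
       inner_function \<Theta> \<longrightarrow> deriv \<Theta> \<in> hardy_inf \<longrightarrow>
       sets \<mu> = sets borel \<longrightarrow> sigma_finite_measure \<mu> \<longrightarrow> \<delta> > 0 \<longrightarrow>
       (\<forall>f\<in>model_space p \<Theta>.
          (\<integral>\<^sup>+x. ennreal (norm (real_trace f x) powr p) \<partial>\<mu>)
            \<le> ennreal (C * (1 + deriv_sup_norm \<Theta> * \<delta>) powr p) * interval_density \<mu> \<delta>
               * (\<integral>\<^sup>+x. ennreal (norm (real_trace f x) powr p) \<partial>lborel)))"
proof (intro exI[of _ "4 * 12 powr p"] conjI allI impI ballI)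
  fix \<Theta> :: "complex \<Rightarrow> complex" and \<mu> :: "real measure" and \<delta> :: real and f
  assume inn: "inner_function \<Theta>" and der: "deriv \<Theta> \<in> hardy_inf"
    and \<mu>: "sets \<mu> = sets borel" "sigma_finite_measure \<mu>" and \<delta>: "\<delta> > 0"
    and f: "f \<in> model_space p \<Theta>"
  define M where "M = deriv_sup_norm \<Theta>"
  have M: "M \<ge> 0" unfolding M_def by (rule inner_function_near_unimodular[OF inn der])
  define k where "k = 1 + M * \<delta>"
  have k: "k \<ge> 1" using M \<delta> by (simp add: k_def)
  \<comment> \<open>This half-side satisfies both \<open>M * b \<le> 1 / 2\<close> and \<open>2 * b \<le> \<delta>\<close>, and is the largest that does up to a constant factor.\<close>
  define b where "b = \<delta> / (2 * k)"
  have b: "b > 0" using \<delta> k by (simp add: b_def)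
  have Mb: "M * b \<le> 1 / 2" using k by (simp add: b_def k_def field_simps)
  have b\<delta>: "2 * b \<le> \<delta>"
    using \<delta> k by (simp add: b_def field_simps)
  define I where "I = (\<integral>\<^sup>+x. ennreal (norm (real_trace f x) powr p) \<partial>lborel)"
  obtain F where F: "F holomorphic_on {z. Im z > - b}" "\<And>x. F (of_real x) = real_trace f x"
    "\<And>y. - b < y \<Longrightarrow> (\<integral>\<^sup>+x. ennreal (norm (F (Complex x y)) powr p) \<partial>lborel) \<le> ennreal (2 powr p) * I"
    by (rule model_space_continuation[OF inn der assms f b Mb[unfolded M_def], folded I_def]) (rule that; assumption)
  have "(\<integral>\<^sup>+x. ennreal (norm (F (of_real x)) powr p) \<partial>\<mu>) \<le>
      ennreal (6 powr p / b\<^sup>2) * ((interval_density \<mu> \<delta> * ennreal \<delta>) * ((ennreal (2 powr p) * I) * ennreal (2 * b)))"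
    by (rule strip_Carleson_bound[OF holomorphic_on_subset[OF F(1)] b assms F(3) \<mu> emeasure_le_interval_density[OF \<mu>(1) \<delta> b\<delta>]])
       (auto simp: abs_less_iff)
  also have "\<dots> = (ennreal (6 powr p / b\<^sup>2) * ennreal \<delta> * ennreal (2 powr p) * ennreal (2 * b)) * interval_density \<mu> \<delta> * I"
    by (simp only: mult_ac)
  also have "ennreal (6 powr p / b\<^sup>2) * ennreal \<delta> * ennreal (2 powr p) * ennreal (2 * b) =
      ennreal (6 powr p / b\<^sup>2 * \<delta> * 2 powr p * (2 * b))"
    using \<delta> b by (simp flip: ennreal_mult'')
  also have "6 powr p / b\<^sup>2 * \<delta> * 2 powr p * (2 * b) = 4 * 12 powr p * k"
  proof -
    have "6 powr p * 2 powr p = (12::real) powr p" by (simp flip: powr_mult)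
    moreover have "\<delta> = 2 * k * b" using k by (simp add: b_def)
    moreover have "6 powr p / b\<^sup>2 * (2 * k * b) * 2 powr p * (2 * b) = 4 * (6 powr p * 2 powr p) * k"
      using b by (simp add: field_simps power2_eq_square)
    ultimately show ?thesis by simp
  qed
  also have "ennreal (4 * 12 powr p * k) * interval_density \<mu> \<delta> * I \<le> ennreal (4 * 12 powr p * k powr p) * interval_density \<mu> \<delta> * I"
  proof (intro mult_right_mono ennreal_leI mult_left_mono)
    have "k powr 1 \<le> k powr p" using k assms by (intro powr_mono) auto
    then show "k \<le> k powr p" using k by simp
  qed auto
  finally show "(\<integral>\<^sup>+x. ennreal (norm (real_trace f x) powr p) \<partial>\<mu>)
            \<le> ennreal (4 * 12 powr p * (1 + deriv_sup_norm \<Theta> * \<delta>) powr p) * interval_density \<mu> \<delta>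
               * (\<integral>\<^sup>+x. ennreal (norm (real_trace f x) powr p) \<partial>lborel)"
    by (simp add: F(2) I_def k_def M_def)
qed simp

end
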